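(* Let $(\Phi,0,S,T)$ be the modular data of an RCFT, and let $N$ be any positive integer with $T^N=I$. Then the RCFT has the $\Gamma(N)$ congruence property provided either of the following holds: (a) $N$ is coprime to $p$, where $p=2$ or $p=3$, and $G_pT=T^{p^2}G_p$; (b) ($N$ arbitrary) writing $N=2^em$ with $m$ odd and letting $d$ be any integer with $d\equiv 1 \pmod{2^e}$ and $d\equiv 0\pmod m$, the following four relations all hold: (i) $T^{2^e}$ commutes with $ST^mS^{-1}$; (ii) $G_{2d-1}T=T\,G_{2d-1}$; (iii) $G_{2-d}T=T^{4-3d}G_{2-d}$; (iv) $G_{1+2d}T=T^{1+8d}G_{1+2d}$.
   Context: Modular data of an RCFT: a finite set $\Phi$ (primary fields) with a distinguished element $0\in\Phi$, and complex matrices $S,T$ indexed by $\Phi$ such that: $S$ and $T$ are unitary and symmetric; $T$ is diagonal and of finite order; $(ST)^3=I$; $C:=S^2$ (charge conjugation) is a permutation matrix with $C^2=I$, corresponding to a permutation $a\mapsto Ca$ of $\Phi$ with $C0=0$, and $C$ commutes with $S$ and $T$; $S_{0a}\neq 0$ for all $a$; and the fusion coefficients $N_{ab}^c=\sum_{d\in\Phi}S_{ad}S_{bd}\overline{S_{cd}}/S_{0d}$ (Verlinde's formula) are nonnegative integers. These relations define a representation $\rho$ of $\mathrm{SL}_2(\mathbb Z)$ with $\rho\begin{pmatrix}0&1\\-1&0\end{pmatrix}=S$ and $\rho\begin{pmatrix}1&1\\0&1\end{pmatrix}=T$. Congruence property: let $\Gamma(N)=\{A\in \mathrm{SL}_2(\mathbb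 Z): A\equiv I \pmod N\}$. The RCFT has the $\Gamma(N)$ congruence property if $\rho(A)=I$ for all $A\in\Gamma(N)$. Galois action: write $\xi_n=\exp[2\pi i/n]$. It is known that the entries of $S$ lie in a cyclotomic field $\mathbb Q[\xi_n]$, and that for each Galois automorphism $\sigma$ there are signs $\epsilon_\sigma(a)\in\{\pm1\}$ and a permutation $a\mapsto\sigma a$ of $\Phi$ with $\sigma(S_{ab})=\epsilon_\sigma(a)S_{\sigma a,b}=\epsilon_\sigma(b)S_{a,\sigma b}$ for all $a,b\in\Phi$. Define the matrix $G_\sigma$ by $(G_\sigma)_{ab}=\epsilon_\sigma(a)\delta_{b,\sigma(a)}$, so that $\sigma(S)=G_\sigma S=SG_\sigma^{-1}$ (entrywise action); $\sigma\mapsto G_\sigma$ is a representation of the Galois group. Choose $M$ divisible by $N$ such that all entries of $S$ lie in $\mathbb Q[\xi_M]$. For an integer $\ell$ coprime to $N$, $\sigma_\ell$ denotes an automorphism of $\mathbb Q[\xi_M]$ over $\mathbb Q$ with $\sigma_\ell(\xi_N)=\xi_N^\ell$, and $G_\ell:=G_{\sigma_\ell}$. *)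

theory Defs
  imports
    "HOL-Analysis.Analysis"
    "HOL-Computational_Algebra.Polynomial"
    "HOL-Number_Theory.Cong"
begin

primrec mat_pow :: "'r::semiring_1 ^ 'a ^ 'a \<Rightarrow> nat \<Rightarrow> 'r ^ 'a ^ 'a" where
  "mat_pow A 0 = mat 1"
| "mat_pow A (Suc n) = A ** mat_pow A n"

definition mat_powi :: "'r::semiring_1 ^ 'a ^ 'a \<Rightarrow> int \<Rightarrow> 'r ^ 'a ^ 'a" where
  "mat_powi A k = (if 0 \<le> k then mat_pow A (nat k) else mat_pow (matrix_inv A) (nat (- k)))"

definition conj_transpose :: "complex ^ 'a ^ 'a \<Rightarrow> complex ^ 'a ^ 'a" where
  "conj_transpose A = (\<chi> a b. cnj (A $ b $ a))"

definition unitary_matrix :: "complex ^ 'a ^ 'a \<Rightarrow> bool" where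
  "unitary_matrix A \<longleftrightarrow> A ** conj_transpose A = mat 1 \<and> conj_transpose A ** A = mat 1"

definition symmetric_matrix :: "complex ^ 'a ^ 'a \<Rightarrow> bool" where
  "symmetric_matrix A \<longleftrightarrow> transpose A = A"

definition diagonal_matrix :: "complex ^ 'a ^ 'a \<Rightarrow> bool" where
  "diagonal_matrix A \<longleftrightarrow> (\<forall>a b. a \<noteq> b \<longrightarrow> A $ a $ b = 0)"

definition signed_perm_matrix :: "('a \<Rightarrow> complex) \<Rightarrow> ('a \<Rightarrow> 'a) \<Rightarrow> complex ^ 'a ^ 'a" where
  "signed_perm_matrix eps \<pi> = (\<chi> a b. if b = \<pi> a then eps a else 0)"

definition perm_matrix :: "('a \<Rightarrow> 'a) \<Rightarrow> complex ^ 'a ^ 'a" where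
  "perm_matrix \<pi> = signed_perm_matrix (\<lambda>_. 1) \<pi>"

definition verlinde :: "'a::finite \<Rightarrow> complex ^ 'a ^ 'a \<Rightarrow> 'a \<Rightarrow> 'a \<Rightarrow> 'a \<Rightarrow> complex" where
  "verlinde z S a b c = (\<Sum>d\<in>UNIV. S $ a $ d * S $ b $ d * cnj (S $ c $ d) / S $ z $ d)"

text \<open>The set of primary fields is the finite type \<open>'a\<close>; the distinguished primary \<open>0\<close> is
  written \<open>z\<close>.\<close>

definition modular_data :: "'a::finite \<Rightarrow> complex ^ 'a ^ 'a \<Rightarrow> complex ^ 'a ^ 'a \<Rightarrow> bool" where
  "modular_data z S T \<longleftrightarrow>
     unitary_matrix S \<and> symmetric_matrix S \<and>
     unitary_matrix T \<and> symmetric_matrix T \<and>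
     diagonal_matrix T \<and> (\<exists>n>0. mat_pow T n = mat 1) \<and>
     mat_pow (S ** T) 3 = mat 1 \<and>
     (\<exists>\<kappa>. bij \<kappa> \<and> mat_pow S 2 = perm_matrix \<kappa> \<and> \<kappa> z = z) \<and>
     mat_pow (mat_pow S 2) 2 = mat 1 \<and>
     mat_pow S 2 ** S = S ** mat_pow S 2 \<and>
     mat_pow S 2 ** T = T ** mat_pow S 2 \<and>
     (\<forall>a. S $ z $ a \<noteq> 0) \<and>
     (\<forall>a b c. verlinde z S a b c \<in> \<nat>)"

definition SL2Z :: "(int ^ 2 ^ 2) set" where
  "SL2Z = {A. det A = 1}"

definition principal_congruence_subgroup :: "nat \<Rightarrow> (int ^ 2 ^ 2) set" where
  "principal_congruence_subgroup N =
     {A \<in> SL2Z. \<forall>i j. [A $ i $ j = mat 1 $ i $ j] (mod int N)}"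

text \<open>Since \<open>(0 1; -1 0)\<close> and \<open>(1 1; 0 1)\<close> generate \<open>SL2Z\<close>, the following conditions determine
  \<open>\<rho>\<close> on \<open>SL2Z\<close>; its values elsewhere are irrelevant.\<close>

definition modular_rep ::
  "complex ^ 'a ^ 'a \<Rightarrow> complex ^ 'a ^ 'a \<Rightarrow> (int ^ 2 ^ 2 \<Rightarrow> complex ^ 'a ^ 'a) \<Rightarrow> bool" where
  "modular_rep S T \<rho> \<longleftrightarrow>
     \<rho> (mat 1) = mat 1 \<and>
     (\<forall>A\<in>SL2Z. \<forall>B\<in>SL2Z. \<rho> (A ** B) = \<rho> A ** \<rho> B) \<and>
     \<rho> (vector [vector [0, 1], vector [-1, 0]]) = S \<and>
     \<rho> (vector [vector [1, 1], vector [0, 1]]) = T"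

text \<open>The existential quantifier picks out the unique representation and includes its existence
  in the claim.\<close>

definition has_congruence_property ::
  "complex ^ 'a ^ 'a \<Rightarrow> complex ^ 'a ^ 'a \<Rightarrow> nat \<Rightarrow> bool" where
  "has_congruence_property S T N \<longleftrightarrow>
     (\<exists>\<rho>. modular_rep S T \<rho> \<and> (\<forall>A\<in>principal_congruence_subgroup N. \<rho> A = mat 1))"

definition xi :: "nat \<Rightarrow> complex" where
  "xi n = exp (2 * of_real pi * \<i> / of_nat n)"

definition cyclotomic_field :: "nat \<Rightarrow> complex set" where
  "cyclotomic_field n = range (\<lambda>q::rat poly. poly (map_poly of_rat q) (xi n))"

text \<open>Automorphisms of \<open>cyclotomic_field n\<close> over the rationals, as functions on the complex numbers
  whose values outside the field are irrelevant.\<close>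

definition galois_aut :: "nat \<Rightarrow> (complex \<Rightarrow> complex) \<Rightarrow> bool" where
  "galois_aut n \<sigma> \<longleftrightarrow>
     bij_betw \<sigma> (cyclotomic_field n) (cyclotomic_field n) \<and>
     (\<forall>q. \<sigma> (of_rat q) = of_rat q) \<and>
     (\<forall>x\<in>cyclotomic_field n. \<forall>y\<in>cyclotomic_field n. \<sigma> (x + y) = \<sigma> x + \<sigma> y) \<and>
     (\<forall>x\<in>cyclotomic_field n. \<forall>y\<in>cyclotomic_field n. \<sigma> (x * y) = \<sigma> x * \<sigma> y)"

text \<open>For modular data \<open>S\<close> is invertible, so \<open>\<sigma>\<close> determines the signs \<open>eps\<close> and the permutation
  \<open>\<pi>\<close>, hence also \<open>signed_perm_matrix eps \<pi>\<close>.\<close>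

definition galois_sign_perm ::
  "complex ^ 'a ^ 'a \<Rightarrow> (complex \<Rightarrow> complex) \<Rightarrow> ('a \<Rightarrow> complex) \<Rightarrow> ('a \<Rightarrow> 'a) \<Rightarrow> bool" where
  "galois_sign_perm S \<sigma> eps \<pi> \<longleftrightarrow>
     (\<forall>a. eps a \<in> {1, -1}) \<and> bij \<pi> \<and>
     (\<forall>a b. \<sigma> (S $ a $ b) = eps a * S $ \<pi> a $ b) \<and>
     (\<forall>a b. \<sigma> (S $ a $ b) = eps b * S $ a $ \<pi> b)"

end

theory Submission
  imports Defs "HOL-Number_Theory.Number_Theory"
begin

text \<open>Let \<open>X i\<close> and \<open>Y i\<close> be the images of the upper and lower unipotent matrices. Because of
  \<open>G\<^sub>p T = T\<^bsup>p\<^sup>2\<^esup> G\<^sub>p\<close>, applying \<open>\<sigma>\<^sub>p\<close> entrywise acts on the image of \<open>\<Gamma>\<^sub>0(p)\<close>, for \<open>p\<close> equal to 2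
  or 3, like conjugation by \<open>diag(p, 1)\<close>, so the kernel of the representation is invariant under this
  conjugation. Since the powers of \<open>p\<close> meet enough residue classes, it follows that matrices that are
  diagonal modulo \<open>N\<close> conjugate \<open>X i\<close> and \<open>Y i\<close> as they should, and the image of \<open>\<Gamma>(N)\<close> is central.

  If \<open>u = 1 + b t\<close> is a unit modulo \<open>N\<close>, the decomposition of \<open>X b * Y t\<close> in the big cell has a torus
  factor. The main point is that this factor depends only on \<open>u\<close>. The prime powers
  dividing \<open>N\<close> can be treated separately: for primes from 5 on, multiplicativity of the torus factors and a
  pattern of quadratic residues suffice; the prime in \<open>{2, 3}\<close> different from \<open>p\<close> needs in addition
  that different expressions for \<open>-1\<close>, and for a matrix with upper left entry \<open>p\<close>, have the same image.
  Torus factors are then multiplicative in \<open>u\<close>, so every element of the image has a normal form that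
  depends only on the matrix modulo \<open>N\<close>, and \<open>\<Gamma>(N)\<close> acts trivially.

  In case (b), relation (i) lets \<open>T\<^bsup>1-d\<^esup>\<close> and \<open>T\<^sup>d\<close> generate commuting parts of levels \<open>m\<close> and \<open>2\<^sup>e\<close>, with
  \<open>S = S\<^sub>m S\<^sub>2\<close>. Relation (ii) gives \<open>G\<^bsub>2d-1\<^esub> = S\<^sub>m\<^sup>2 S\<^sub>2\<^sup>4\<close>, an involution, hence \<open>S\<^sub>m\<^sup>4 = S\<^sub>2\<^sup>4 = 1\<close> and both
  parts are representations. By (iii) and (iv) the argument above applies to them with \<open>p = 2\<close> and \<open>p = 3\<close>.\<close>

section \<open>Groups and integer powers\<close>

text \<open>For suitable N, SL_2(Z) has normal subgroups of finite index that contain the N-th power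
  of (1 1; 0 1) but not \<Gamma>(N), so the order of T alone cannot suffice. The symmetry diag(p, 1)
  plays the part that inverting p plays for SL_2(Z[1/p]), where the congruence subgroup property
  holds. It only relates the subgroup with lower left entry divisible by p to its conjugate, so a
  Galois relation informs about kernels and does not extend the representation. Centrality leaves
  open a central extension, and the computation with torus factors shows that it is trivial. The
  obstacle is at the primes 2 and 3: the differences u - 1 or s^2 - 1 that the general computation
  has to invert are never units there. In (b), modulo (2^e, m), the integers 2d-1, 2-d and 1+2d are
  (1, -1), (1, 2) and (3, 1). The first inverts one component and so isolates it; the second is the
  prime 2 on the odd level and trivial on the other; the third is the prime 3 on the level 2^e and
  trivial on the other.\<close>

class group_mult = monoid_mult + inverse +
  assumes inverse_mult_self [simp]: "inverse a * a = 1"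
begin

lemma mult_inverse_self [simp]: "a * inverse a = 1"
proof -
  have "a * inverse a = inverse (inverse a) * inverse a * (a * inverse a)"
    by simp
  also have "\<dots> = inverse (inverse a) * (inverse a * a) * inverse a"
    by (simp only: mult.assoc)
  finally show ?thesis by simp
qed

lemma inverse_mult_cancel_left [simp]: "inverse a * (a * b) = b"
  by (simp add: mult.assoc [symmetric])

lemma mult_inverse_cancel_left [simp]: "a * (inverse a * b) = b"
  by (simp add: mult.assoc [symmetric])

lemma group_left_cancel: "a * b = a * c \<longleftrightarrow> b = c"
  by (metis inverse_mult_cancel_left)

lemma group_right_cancel: "b * a = c * a \<longleftrightarrow> b = c"
  by (metis mult.assoc mult_inverse_self mult_1_right)

lemma inverse_eqI: "a * b = 1 \<Longrightarrow> inverse a = b"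
  by (metis inverse_mult_cancel_left mult_1_right)

lemma inverse_eqI': "a * b = 1 \<Longrightarrow> inverse b = a"
  by (metis group_right_cancel inverse_mult_self)

lemma group_inverse_inverse [simp]: "inverse (inverse a) = a"
  by (rule inverse_eqI) simp

lemma group_inverse_1 [simp]: "inverse 1 = 1"
  by (rule inverse_eqI) simp

lemma group_inverse_mult: "inverse (a * b) = inverse b * inverse a"
  by (rule inverse_eqI) (simp add: mult.assoc)

lemma group_eq_iff: "a = b \<longleftrightarrow> inverse a * b = 1"
  by (metis inverse_mult_self mult_inverse_cancel_left mult_1_right)

lemma commute_inverse: "a * b = b * a \<Longrightarrow> a * inverse b = inverse b * a"
  by (metis inverse_mult_cancel_left mult.assoc mult_inverse_self mult_1_right)

end

lemma group_powi_Suc: "(g::'g::group_mult) powi (i + 1) = g * g powi i"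
proof (cases "i \<ge> 0")
  case True
  then show ?thesis by (simp add: power_int_def nat_add_distrib)
next
  case False
  then have "i = - int (Suc (nat (- i - 1)))" by simp
  then obtain n where n: "i = - int (Suc n)" ..
  show ?thesis
    unfolding n by (cases n) (simp_all add: power_int_def nat_add_distrib)
qed

lemma group_powi_add: "(g::'g::group_mult) powi (i + j) = g powi i * g powi j"
proof (induction i rule: int_induct [where k = 0])
  case base
  show ?case by (simp add: power_int_def)
next
  case (step1 i)
  have "g powi (i + 1 + j) = g * g powi (i + j)"
    using group_powi_Suc[of g "i + j"] by (simp add: algebra_simps)
  then show ?case by (simp add: step1 group_powi_Suc mult.assoc)
next
  case (step2 i)
  have "g * g powi (i - 1 + j) = g powi (i + j)"
    using group_powi_Suc[of g "i - 1 + j"] by (simp add: algebra_simps)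
  moreover have "g * g powi (i - 1) = g powi i"
    using group_powi_Suc[of g "i - 1"] by simp
  ultimately have "g * g powi (i - 1 + j) = g * (g powi (i - 1) * g powi j)"
    by (simp add: step2 mult.assoc[symmetric])
  then show ?case by (simp only: group_left_cancel)
qed

lemma group_powi_0 [simp]: "(g::'g::group_mult) powi 0 = 1"
  by (simp add: power_int_def)

lemma group_powi_1 [simp]: "(g::'g::group_mult) powi 1 = g"
  by (simp add: power_int_def)

lemma group_powi_minus: "(g::'g::group_mult) powi (- i) = inverse (g powi i)"
  using group_powi_add[of g i "- i"] inverse_eqI by fastforce

lemma group_powi_left_1: "(1::'g::group_mult) powi k = 1"
  by (simp add: power_int_def)

lemma commute_mult:
  fixes g h :: "'g::group_mult"
  shows "g * k = k * g \<Longrightarrow> h * k = k * h \<Longrightarrow> g * h * k = k * (g * h)"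
  by (metis mult.assoc)

lemma commute_mult':
  fixes g h :: "'g::group_mult"
  shows "k * g = g * k \<Longrightarrow> k * h = h * k \<Longrightarrow> k * (g * h) = g * h * k"
  by (metis mult.assoc)

lemma central_powi:
  assumes "(z::'g::group_mult) * g = g * z"
  shows "z * g powi i = g powi i * z"
proof (induction i rule: int_induct [where k = 0])
  case base
  show ?case by simp
next
  case (step1 i)
  show ?case unfolding group_powi_Suc by (rule commute_mult'[OF assms step1(2)])
next
  case (step2 i)
  have "g * g powi (i - 1) = g powi i"
    using group_powi_Suc[of g "i - 1"] by simp
  then have "g powi (i - 1) = inverse g * g powi i" by (metis inverse_mult_cancel_left)
  then show ?case using commute_mult'[OF commute_inverse[OF assms] step2(2)] by simp
qed

section \<open>Generators of \<open>\<Gamma>\<^sub>0(p)\<close>\<close>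

text \<open>Turns single shears into the full quotient of a division step, whatever its
  sign.\<close>

lemma int_shift_induct:
  fixes P :: "int \<Rightarrow> int \<Rightarrow> bool" and u v :: int
  assumes "P a b"
    and "\<And>a b. P a b \<Longrightarrow> P (a + u) (b + v)"
    and "\<And>a b. P a b \<Longrightarrow> P (a - u) (b - v)"
  shows "P (a + k * u) (b + k * v)"
proof (induction k rule: int_induct [where k = 0])
  case base
  show ?case using assms(1) by simp
next
  case (step1 i)
  then show ?case using assms(2)[OF step1(2)] by (simp add: algebra_simps)
next
  case (step2 i)
  then show ?case using assms(3)[OF step2(2)] by (simp add: algebra_simps)
qed

lemma small_residue:
  fixes a m :: int
  assumes "m \<noteq> 0"
  obtains k where "2 * \<bar>a - k * m\<bar> \<le> \<bar>m\<bar>"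
proof -
  define r where "r = a mod \<bar>m\<bar>"
  have r: "0 \<le> r" "r < \<bar>m\<bar>" using assms by (simp_all add: r_def)
  have a: "a = (a div \<bar>m\<bar>) * \<bar>m\<bar> + r" by (simp add: r_def)
  define e where "e = (if 2 * r \<le> \<bar>m\<bar> then 0 else 1 :: int)"
  have "a - ((a div \<bar>m\<bar> + e) * sgn m) * m = r - e * \<bar>m\<bar>"
    by (subst a) (simp add: algebra_simps sgn_mult_abs abs_sgn)
  then have "2 * \<bar>a - ((a div \<bar>m\<bar> + e) * sgn m) * m\<bar> \<le> \<bar>m\<bar>"
    using r by (auto simp: e_def)
  then show ?thesis by (rule that)
qed

text \<open>Integer matrices with rows \<open>(a, b)\<close> and \<open>(c, d)\<close> are represented by their four entries.
  For \<open>p \<le> 3\<close> the Euclidean algorithm with nearest-integer division stays inside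
  \<open>\<Gamma>\<^sub>0(p)\<close>: after the two reductions \<open>|c|\<close> has dropped by the factor \<open>p / 4 < 1\<close>.\<close>

lemma Gamma0_induct:
  fixes P :: "int \<Rightarrow> int \<Rightarrow> int \<Rightarrow> int \<Rightarrow> bool" and p :: int
  assumes p: "1 \<le> p" "p \<le> 3" and det: "a * d - b * (p * c) = 1"
    and one: "P 1 0 0 1"
    and neg: "\<And>a b c d. a * d - b * (p * c) = 1 \<Longrightarrow> P a b c d \<Longrightarrow> P (- a) (- b) (- c) (- d)"
    and up: "\<And>a b c d. a * d - b * (p * c) = 1 \<Longrightarrow> P a b c d \<Longrightarrow> P (a + p * c) (b + d) c d"
    and um: "\<And>a b c d. a * d - b * (p * c) = 1 \<Longrightarrow> P a b c d \<Longrightarrow> P (a - p * c) (b - d) c d"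
    and lp: "\<And>a b c d. a * d - b * (p * c) = 1 \<Longrightarrow> P a b c d \<Longrightarrow> P a b (c + a) (d + p * b)"
    and lm: "\<And>a b c d. a * d - b * (p * c) = 1 \<Longrightarrow> P a b c d \<Longrightarrow> P a b (c - a) (d - p * b)"
  shows "P a b c d"
proof -
  define Q where "Q a b c d \<longleftrightarrow> a * d - b * (p * c) = 1 \<and> P a b c d" for a b c d
  have up': "Q (a + k * p * c) (b + k * d) c d" if "Q a b c d" for a b c d k
  proof -
    have "Q (a + k * (p * c)) (b + k * d) c d"
      by (rule int_shift_induct[where P = "\<lambda>a b. Q a b c d"])
        (use that in \<open>auto simp: Q_def intro: up um\<close>, auto simp: algebra_simps)
    then show ?thesis by (simp add: mult.assoc)
  qed
  have lo': "Q a b (c + k * a) (d + k * p * b)" if "Q a b c d" for a b c d k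
  proof -
    have "Q a b (c + k * a) (d + k * (p * b))"
      by (rule int_shift_induct[where P = "\<lambda>c d. Q a b c d"])
        (use that in \<open>auto simp: Q_def intro: lp lm\<close>, auto simp: algebra_simps)
    then show ?thesis by (simp add: mult.assoc)
  qed
  have "Q a b c d" if "a * d - b * (p * c) = 1" for a b c d
    using that
  proof (induction "nat \<bar>c\<bar>" arbitrary: a b c d rule: less_induct)
    case less
    show ?case
    proof (cases "c = 0")
      case True
      then have ad: "a * d = 1" using less.prems by simp
      have q1: "Q 1 b 0 1" for b
        using up'[of 1 0 0 1 b] one by (simp add: Q_def)
      from ad have "a = 1 \<and> d = 1 \<or> a = -1 \<and> d = -1" using zmult_eq_1_iff by auto
      then show ?thesis
      proof
        assume "a = 1 \<and> d = 1" then show ?thesis using q1 True by simp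
      next
        assume "a = -1 \<and> d = -1" then show ?thesis using neg[of 1 1 "-b" 0] q1[of "-b"] True
          by (simp add: Q_def)
      qed
    next
      case False
      obtain k where k: "2 * \<bar>a - k * (p * c)\<bar> \<le> \<bar>p * c\<bar>"
        using small_residue[of "p * c" a] False p by auto
      define a' where "a' = a - k * (p * c)"
      define b' where "b' = b - k * d"
      have det': "a' * d - b' * (p * c) = 1"
        using less.prems by (simp add: a'_def b'_def algebra_simps)
      show ?thesis
      proof (cases "a' = 0")
        \<comment> \<open>This happens only for \<open>p = 1\<close>, because the determinant makes
          \<open>p\<close> divide 1. The matrix with rows (0, b') and (c, d) then comes from the
          upper triangular one with rows (c, d + b') and (0, -b') by two row operations.\<close>
        case True
        then have "p * (- b' * c) = 1" using det' by (simp add: algebra_simps)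
        then have "p dvd 1" by (metis dvd_triv_left)
        then have p1: "p = 1" using p by simp
        then have bc: "b' * c = - 1" using det' True by simp
        have "Q c (d + b') 0 (- b')"
        proof -
          have "Q (c) (d + b') 0 (- b')"
            using less.hyps[of 0 c "-b'" "d + b'"] False bc by (simp add: mult.commute)
          then show ?thesis .
        qed
        then have "Q c (d + b') c (d + b' - b')" using lo'[of c "d + b'" 0 "-b'" 1] p1 by simp
        then have "Q c (d+b') c d" by simp
        then have "Q 0 b' c d" using up'[of c "d+b'" c d "-1"] p1 by simp
        then have "Q (a' + k * p * c) (b' + k * d) c d" using up'[of a' b' c d k] True by simp
        then show ?thesis by (simp add: a'_def b'_def algebra_simps)
      next
        case a': False
        obtain l where l: "2 * \<bar>c - l * a'\<bar> \<le> \<bar>a'\<bar>"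
          using small_residue[of a' c] a' by auto
        have "\<bar>p * c\<bar> \<le> 3 * \<bar>c\<bar>" using p by (simp add: abs_mult mult_right_mono)
        moreover have "2 * \<bar>a'\<bar> \<le> \<bar>p * c\<bar>" using k by (simp add: a'_def)
        moreover have "0 < \<bar>c\<bar>" using False by simp
        moreover have "x < y" if "m \<le> 3 * y" "2 * v \<le> m" "0 < y" "2 * x \<le> v" for m v x y :: int
          using that by linarith
        ultimately have "\<bar>c - l * a'\<bar> < \<bar>c\<bar>" using l by blast
        moreover have "a' * (d - l * (p * b')) - b' * (p * (c - l * a')) = 1"
          using det' by (simp add: algebra_simps)
        ultimately have "Q a' b' (c - l * a') (d - l * (p * b'))"
          using less.hyps[of "c - l * a'" a' "d - l * (p * b')" b'] by simp
        from lo'[OF this, of l] have "Q a' b' c d" by (simp add: algebra_simps)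
        from up'[OF this, of k] show ?thesis by (simp add: a'_def b'_def algebra_simps)
      qed
    qed
  qed
  then show ?thesis using det by (auto simp: Q_def)
qed

section \<open>Homomorphisms from \<open>SL\<^sub>2(\<int>)\<close>\<close>

text \<open>For \<open>p = 1\<close> the sign change of \<open>Gamma0_induct\<close> need not be
  assumed: a quarter turn is a product of three row operations, and its square is minus the
  identity.\<close>

lemma SL2_induct:
  fixes P :: "int \<Rightarrow> int \<Rightarrow> int \<Rightarrow> int \<Rightarrow> bool"
  assumes det: "a * d - b * c = 1"
    and one: "P 1 0 0 1"
    and up: "\<And>a b c d. a * d - b * c = 1 \<Longrightarrow> P a b c d \<Longrightarrow> P (a + c) (b + d) c d"
    and um: "\<And>a b c d. a * d - b * c = 1 \<Longrightarrow> P a b c d \<Longrightarrow> P (a - c) (b - d) c d"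
    and lp: "\<And>a b c d. a * d - b * c = 1 \<Longrightarrow> P a b c d \<Longrightarrow> P a b (c + a) (d + b)"
    and lm: "\<And>a b c d. a * d - b * c = 1 \<Longrightarrow> P a b c d \<Longrightarrow> P a b (c - a) (d - b)"
  shows "P a b c d"
proof -
  define Q where "Q a b c d \<longleftrightarrow> a * d - b * c = 1 \<and> P a b c d" for a b c d
  have s: "Q c d (- a) (- b)" if "Q a b c d" for a b c d
  proof -
    have 1: "P (a + c) (b + d) c d" using that up by (simp add: Q_def)
    have "P (a + c) (b + d) (c - (a + c)) (d - (b + d))"
      by (rule lm[OF _ 1]) (use that in \<open>simp add: Q_def algebra_simps\<close>)
    then have 2: "P (a + c) (b + d) (- a) (- b)" by simp
    have "P (a + c + - a) (b + d + - b) (- a) (- b)"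
      by (rule up[OF _ 2]) (use that in \<open>simp add: Q_def algebra_simps\<close>)
    then show ?thesis using that by (simp add: Q_def algebra_simps)
  qed
  have "Q a b c d"
  proof (rule Gamma0_induct[where p = 1 and P = Q])
    show "Q (- a) (- b) (- c) (- d)" if "a * d - b * (1 * c) = 1" "Q a b c d" for a b c d
      using s[OF s[OF that(2)]] by simp
    show "Q (a + 1 * c) (b + d) c d" if "a * d - b * (1 * c) = 1" "Q a b c d" for a b c d
      using up that by (simp add: Q_def) (simp add: algebra_simps)
    show "Q (a - 1 * c) (b - d) c d" if "a * d - b * (1 * c) = 1" "Q a b c d" for a b c d
      using um that by (simp add: Q_def) (simp add: algebra_simps)
    show "Q a b (c + a) (d + 1 * b)" if "a * d - b * (1 * c) = 1" "Q a b c d" for a b c d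
      using lp that by (simp add: Q_def) (simp add: algebra_simps)
    show "Q a b (c - a) (d - 1 * b)" if "a * d - b * (1 * c) = 1" "Q a b c d" for a b c d
      using lm that by (simp add: Q_def) (simp add: algebra_simps)
  qed (use det one in \<open>auto simp: Q_def\<close>)
  then show ?thesis by (simp add: Q_def)
qed

text \<open>Transposition exchanges row and column operations.\<close>

lemma SL2_induct_right:
  fixes P :: "int \<Rightarrow> int \<Rightarrow> int \<Rightarrow> int \<Rightarrow> bool"
  assumes det: "a * d - b * c = 1"
    and one: "P 1 0 0 1"
    and up: "\<And>a b c d. a * d - b * c = 1 \<Longrightarrow> P a b c d \<Longrightarrow> P a (b + a) c (d + c)"
    and um: "\<And>a b c d. a * d - b * c = 1 \<Longrightarrow> P a b c d \<Longrightarrow> P a (b - a) c (d - c)"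
    and lp: "\<And>a b c d. a * d - b * c = 1 \<Longrightarrow> P a b c d \<Longrightarrow> P (a + b) b (c + d) d"
    and lm: "\<And>a b c d. a * d - b * c = 1 \<Longrightarrow> P a b c d \<Longrightarrow> P (a - b) b (c - d) d"
  shows "P a b c d"
proof -
  have "a * d - c * b = 1" using det by (simp add: algebra_simps)
  then show ?thesis
  proof (rule SL2_induct[where P = "\<lambda>a c b d. P a b c d"])
  qed (use one in \<open>auto intro: up um lp lm simp: mult.commute\<close>)
qed

text \<open>Functions of four integers stand for functions on \<open>SL\<^sub>2(\<int>)\<close>; only their values on
  quadruples of determinant 1 matter.\<close>

locale SL2_hom =
  fixes r :: "int \<Rightarrow> int \<Rightarrow> int \<Rightarrow> int \<Rightarrow> 'g::group_mult"
  assumes hom: "a * d - b * c = 1 \<Longrightarrow> a' * d' - b' * c' = 1 \<Longrightarrow>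
    r a b c d * r a' b' c' d' = r (a * a' + b * c') (a * b' + b * d') (c * a' + d * c') (c * b' + d * d')"
begin

definition X where "X i = r 1 i 0 1"
definition Y where "Y i = r 1 0 i 1"
definition J where "J = r 0 1 (- 1) 0"

lemma hom_1 [simp]: "r 1 0 0 1 = 1"
proof -
  have "r 1 0 0 1 * r 1 0 0 1 = r 1 0 0 1" by (subst hom) simp_all
  then show ?thesis by (metis group_left_cancel mult_1_right)
qed

lemma hom_inverse: "a * d - b * c = 1 \<Longrightarrow> inverse (r a b c d) = r d (- b) (- c) a"
  by (rule inverse_eqI, subst hom) (simp_all add: algebra_simps)

lemma X_add: "X (i + j) = X i * X j" and Y_add: "Y (i + j) = Y i * Y j"
  by (simp_all add: X_def Y_def hom add.commute)

lemma X_0 [simp]: "X 0 = 1" and Y_0 [simp]: "Y 0 = 1"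
  by (simp_all add: X_def Y_def)

lemma r_X: "a * d - b * c = 1 \<Longrightarrow> r a b c d * X i = r a (b + i * a) c (d + i * c)"
  by (simp add: X_def hom algebra_simps)

lemma r_Y: "a * d - b * c = 1 \<Longrightarrow> r a b c d * Y i = r (a + i * b) b (c + i * d) d"
  by (simp add: Y_def hom algebra_simps)

lemma X_r: "a * d - b * c = 1 \<Longrightarrow> X i * r a b c d = r (a + i * c) (b + i * d) c d"
  by (simp add: X_def hom algebra_simps)

lemma Y_r: "a * d - b * c = 1 \<Longrightarrow> Y i * r a b c d = r a b (c + i * a) (d + i * b)"
  by (simp add: Y_def hom algebra_simps)

lemma J_X: "J * X i = Y (- i) * J" and J_Y: "J * Y i = X (- i) * J"
  by (simp_all add: J_def X_def Y_def hom)

lemma J_J: "J * J = r (- 1) 0 0 (- 1)"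
  by (simp add: J_def hom)

lemma commute_r:
  assumes "g * X 1 = X 1 * g" "g * Y 1 = Y 1 * g" "a * d - b * c = 1"
  shows "g * r a b c d = r a b c d * g"
  using assms(3)
proof (rule SL2_induct)
  fix a b c d :: int
  assume det: "a * d - b * c = 1" and com: "g * r a b c d = r a b c d * g"
  have m: "X (- 1) = inverse (X 1)" "Y (- 1) = inverse (Y 1)"
    by (simp_all add: X_def Y_def hom_inverse)
  have *: "g * (h * r a b c d) = h * r a b c d * g" if "g * h = h * g" for h
    using com that by (metis mult.assoc)
  note com' = assms(1,2) assms(1,2)[THEN commute_inverse, folded m]
  show "g * r (a + c) (b + d) c d = r (a + c) (b + d) c d * g"
    using *[OF com'(1)] X_r[OF det, of 1] by simp
  show "g * r (a - c) (b - d) c d = r (a - c) (b - d) c d * g"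
    using *[OF com'(3)] X_r[OF det, of "-1"] by simp
  show "g * r a b (c + a) (d + b) = r a b (c + a) (d + b) * g"
    using *[OF com'(2)] Y_r[OF det, of 1] by simp
  show "g * r a b (c - a) (d - b) = r a b (c - a) (d - b) * g"
    using *[OF com'(4)] Y_r[OF det, of "-1"] by simp
qed simp

end

section \<open>Reconstruction of a homomorphism on SL_2(Z) from the images of two generators\<close>

text \<open>The word follows the Euclidean algorithm on the first column: with
  \<open>q = a div c\<close> the matrix is \<open>T ^ q * S\<close> times the matrix with rows (-c,
  -d) and (a mod c, b - q d). For \<open>c = 0\<close> the factor \<open>S * S\<close> stands for
  minus the identity. A fixed word for each matrix replaces an appeal to the presentation of
  SL_2(Z); the relations enter only in showing that the words multiply.\<close>

function modular_word :: "'g::group_mult \<Rightarrow> 'g \<Rightarrow> int \<Rightarrow> int \<Rightarrow> int \<Rightarrow> int \<Rightarrow> 'g" where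
  "modular_word S T a b c d =
    (if c = 0 then (if a = 1 then T powi b else S * S * T powi (- b))
     else T powi (a div c) * S * modular_word S T (- c) (- d) (a mod c) (b - (a div c) * d))"
  by auto
termination
  by (relation "Wellfounded.measure (\<lambda>(S, T, a, b, c, d). nat \<bar>c\<bar>)") (auto simp: abs_mod_less)

declare modular_word.simps [simp del]

text \<open>Defining relations of SL_2(Z) for the generators (0 1; -1 0) and (1 1; 0 1).\<close>

locale modular_pair =
  fixes S T :: "'g::group_mult"
  assumes S4: "S * S * (S * S) = 1"
    and S2_T: "S * S * T = T * (S * S)"
    and ST3: "S * T * (S * T) * (S * T) = 1"
begin

abbreviation w where "w \<equiv> modular_word S T"
abbreviation z where "z \<equiv> S * S"

lemma z_T: "z * T powi i = T powi i * z"
  by (rule central_powi) (rule S2_T)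

lemma z_S: "z * S = S * z"
  by (simp add: mult.assoc)

lemma inverse_S: "inverse S = S * z"
  by (rule inverse_eqI) (use S4 in \<open>simp add: mult.assoc\<close>)

text \<open>A form of the relation for \<open>S * T\<close> with a single \<open>S\<close> on one
  side; the factor \<open>g\<close> makes it usable inside longer products. It settles the division
  with quotient -1 in \<open>w_S_step\<close>.\<close>

lemma inverse_TSTST: "inverse T * (S * (inverse T * (S * (inverse T * g)))) = S * g"
proof -
  define Z where "Z = z"
  have Z: "inverse T * (Z * h) = Z * (inverse T * h)" "S * (Z * h) = Z * (S * h)" "Z * (Z * h) = h" for h
    using commute_inverse[OF S2_T] z_S S4 unfolding Z_def by (metis mult.assoc mult_1_left)+
  have iS: "inverse S * h = Z * (S * h)" for h
    using inverse_S z_S by (simp add: Z_def mult.assoc)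
  have "S * (T * (S * (T * (S * T)))) = 1" using ST3 by (simp add: mult.assoc)
  then have "inverse S = T * (S * (T * (S * T)))" by (rule inverse_eqI)
  then have "S = inverse (T * (S * (T * (S * T))))" by (metis group_inverse_inverse)
  then have "S * g = inverse (T * (S * (T * (S * T)))) * g" by simp
  also have "\<dots> = inverse T * (inverse S * (inverse T * (inverse S * (inverse T * g))))"
    by (simp only: group_inverse_mult mult.assoc)
  finally have "S * g = inverse T * (inverse S * (inverse T * (inverse S * (inverse T * g))))" .
  then show ?thesis by (simp add: iS Z)
qed

text \<open>Replacing \<open>a\<close> by \<open>a + c\<close> raises the first quotient by one and
  leaves the remainder unchanged.\<close>

lemma w_T:
  assumes "a * d - b * c = 1"
  shows "w (a + c) (b + d) c d = T * w a b c d"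
proof (cases "c = 0")
  case True
  with assms have "a = 1 \<and> d = 1 \<or> a = -1 \<and> d = -1" using zmult_eq_1_iff[of a d] by auto
  then show ?thesis
  proof
    assume "a = 1 \<and> d = 1"
    then show ?thesis using True group_powi_Suc[of T b]
      by (simp add: modular_word.simps[of S T])
  next
    assume ad: "a = -1 \<and> d = -1"
    have "T powi (- b + 1) = T * T powi (- b)" by (rule group_powi_Suc)
    then have "z * T powi (1 - b) = T * (z * T powi (- b))"
      using S2_T by (metis add.commute mult.assoc uminus_add_conv_diff)
    then show ?thesis using True ad by (simp add: modular_word.simps[of S T])
  qed
next
  case False
  have "w (a + c) (b + d) c d
      = T powi (a div c + 1) * S * w (- c) (- d) (a mod c) (b + d - (a div c + 1) * d)"
    using False by (subst modular_word.simps) simp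
  also have "b + d - (a div c + 1) * d = b - a div c * d" by (simp add: algebra_simps)
  also have "T powi (a div c + 1) = T * T powi (a div c)" by (rule group_powi_Suc)
  finally show ?thesis using False
    by (simp add: modular_word.simps[of S T a] mult.assoc)
qed

text \<open>All quotients are the same for both matrices, since
  \<open>(- a) div (- c) = a div c\<close>. The sign only shows in the terminal case, and the
  central \<open>S * S\<close> travels back from there to the front.\<close>

lemma w_neg:
  assumes "a * d - b * c = 1"
  shows "w (- a) (- b) (- c) (- d) = z * w a b c d"
  using assms
proof (induction "nat \<bar>c\<bar>" arbitrary: a b c d rule: less_induct)
  case less
  show ?case
  proof (cases "c = 0")
    case True
    with less.prems have "a = 1 \<or> a = -1" using zmult_eq_1_iff[of a d] by auto
    then show ?thesis using True S4 by (auto simp: modular_word.simps[of S T] mult.assoc[symmetric])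
  next
    case False
    have "(- c) * (b - a div c * d) - (- d) * (a mod c) = 1"
      using less.prems by (simp add: algebra_simps minus_div_mult_eq_mod [symmetric])
    from less.hyps[OF _ this]
    have "w (- (- c)) (- (- d)) (- (a mod c)) (- (b - a div c * d))
      = z * w (- c) (- d) (a mod c) (b - a div c * d)"
      using False by (simp add: abs_mod_less)
    moreover have "T powi i * (S * (z * g)) = z * (T powi i * (S * g))" for g i
      using z_T[of i] z_S by (metis mult.assoc)
    ultimately show ?thesis using False
      by (simp add: modular_word.simps[of S T "- a"] modular_word.simps[of S T a] mult.assoc)
  qed
qed

text \<open>The algorithm for the rotated matrix divides \<open>c\<close> by \<open>- a\<close>,
  here with quotient -1. Unfolding this step and using the hypothesis for the smaller column
  \<open>(a - c, c)\<close> leaves the relation \<open>inverse_TSTST\<close>.\<close>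

lemma w_S_step:
  assumes det: "a * d - b * c = 1"
    and pos: "0 < a \<and> 0 < c \<or> a < 0 \<and> c < 0" and le: "\<bar>c\<bar> \<le> \<bar>a\<bar>"
    and IH: "\<And>a' b' c' d'. a' * d' - b' * c' = 1 \<Longrightarrow> \<bar>a'\<bar> + \<bar>c'\<bar> < \<bar>a\<bar> + \<bar>c\<bar> \<Longrightarrow>
      w c' d' (- a') (- b') = S * w a' b' c' d'"
  shows "w c d (- a) (- b) = S * w a b c d"
proof -
  have q: "c div (- a) = - 1"
  proof -
    show ?thesis
    proof (cases "0 < a")
      case True
      then have "(- c) div a = - 1" by (intro int_div_pos_eq[of _ _ _ "a - c"]) (use pos le in auto)
      then show ?thesis by (simp add: div_minus_right)
    next
      case False
      then show ?thesis by (intro int_div_pos_eq[of _ _ _ "c - a"]) (use pos le in auto)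
    qed
  qed
  have m: "c mod (- a) = c - a"
    using minus_div_mult_eq_mod[of c "- a"] by (simp add: q)
  have T: "w (a - c) (b - d) c d = inverse T * w a b c d" if "a * d - b * c = 1" for a b c d
    using w_T[of "a - c" d "b - d" c] that by (simp add: algebra_simps)
  have "w a b (c - a) (d - b) = inverse T * (S * (inverse T * w a b c d))"
  proof -
    have 1: "(a - c) * d - (b - d) * c = 1" using det by (simp add: algebra_simps)
    have 2: "c * (- (b - d)) - d * (- (a - c)) = 1" using det by (simp add: algebra_simps)
    have "w c d (- (a - c)) (- (b - d)) = S * w (a - c) (b - d) c d"
      by (rule IH[OF 1]) (use pos le in auto)
    then show ?thesis using T[OF det] T[OF 2] by simp
  qed
  moreover have "w c d (- a) (- b) = T powi (-1) * S * w a b (c - a) (d - b)"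
  proof -
    have "a \<noteq> 0" using pos by auto
    then show ?thesis by (subst modular_word.simps) (simp add: q m)
  qed
  ultimately have "w c d (- a) (- b) = inverse T * (S * (inverse T * (S * (inverse T * w a b c d))))"
    by (simp add: group_powi_minus mult.assoc)
  then show ?thesis by (simp add: inverse_TSTST)
qed

text \<open>Signs and sizes of \<open>a\<close> and \<open>c\<close> decide the first quotient. If
  it is 0, the claim is the defining equation of the word, for the given matrix or, through
  \<open>neg\<close>, for the rotated one. If it is -1, \<open>w_S_step\<close> applies to one of
  these two matrices.\<close>

lemma w_S:
  assumes "a * d - b * c = 1"
  shows "w c d (- a) (- b) = S * w a b c d"
  using assms
proof (induction "nat (\<bar>a\<bar> + \<bar>c\<bar>)" arbitrary: a b c d rule: less_induct)
  case less
  have IH: "w c' d' (- a') (- b') = S * w a' b' c' d'"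
    if "a' * d' - b' * c' = 1" "\<bar>a'\<bar> + \<bar>c'\<bar> < \<bar>a\<bar> + \<bar>c\<bar>" for a' b' c' d'
    using less.hyps[OF _ that(1)] that(2) by simp
  have neg: "w c d (- a) (- b) = S * w a b c d" if "w (- a) (- b) (- c) (- d) = S * w c d (- a) (- b)"
  proof -
    have "z * w a b c d = S * w c d (- a) (- b)" using w_neg[OF less.prems] that by simp
    then show ?thesis by (simp add: mult.assoc group_left_cancel)
  qed
  have zz: "z * (z * g) = g" for g using S4 by (simp add: mult.assoc[symmetric])
  consider "a = 0" | "a \<noteq> 0" "c = 0 \<or> 0 < a \<and> c < 0 \<and> - c < a \<or> a < 0 \<and> 0 < c \<and> c < - a"
    | "0 < a \<and> 0 < c \<or> a < 0 \<and> c < 0" "\<bar>c\<bar> \<le> \<bar>a\<bar>"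
    | "0 < c \<and> 0 < - a \<or> c < 0 \<and> - a < 0" "\<bar>- a\<bar> \<le> \<bar>c\<bar>"
    | "c \<noteq> 0" "0 < a \<and> a < c \<or> c < a \<and> a < 0"
    by linarith
  then show ?case
  proof cases
    case 1
    then have bc: "b * c = - 1" using less.prems by simp
    then have "c dvd 1" by (metis dvd_minus_iff dvd_triv_right)
    then have "c = 1 \<or> c = -1" by auto
    then show ?thesis
    proof
      assume c: "c = 1"
      then have "b = -1" using bc by simp
      then show ?thesis using 1 c zz by (simp add: modular_word.simps[of S T] mult.assoc)
    next
      assume c: "c = -1"
      then have "b = 1" using bc by simp
      then show ?thesis using 1 c by (simp add: modular_word.simps[of S T] mult.assoc)
    qed
  next
    case 2
    have q: "c div (- a) = 0"
      using 2 by (auto intro: div_pos_pos_trivial simp: div_neg_neg_trivial)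
    then have m: "c mod (- a) = c" by (metis div_mult_mod_eq add_0 mult_zero_left)
    show ?thesis using 2(1) by (subst modular_word.simps) (simp add: q m)
  next
    case 3
    show ?thesis by (rule w_S_step[OF less.prems 3 IH])
  next
    case 4
    have "c * (- b) - d * (- a) = 1" using less.prems by (simp add: algebra_simps)
    from w_S_step[OF this 4 IH] have "w (- a) (- b) (- c) (- d) = S * w c d (- a) (- b)"
      by (simp add: add.commute)
    then show ?thesis by (rule neg)
  next
    case 5
    have q: "(- a) div (- c) = 0"
      using 5 by (auto intro: div_pos_pos_trivial simp: div_neg_neg_trivial)
    then have m: "(- a) mod (- c) = - a" by (metis div_mult_mod_eq add_0 mult_zero_left)
    have "w (- a) (- b) (- c) (- d) = S * w c d (- a) (- b)"
      using 5(1) q m by (subst modular_word.simps) simp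
    then show ?thesis by (rule neg)
  qed
qed

text \<open>Induction on the left factor by row operations: each of them multiplies the word on the
  left by a fixed element and acts on the product matrix in the same way.\<close>

lemma w_hom:
  assumes "a * d - b * c = 1" "a' * d' - b' * c' = 1"
  shows "w a b c d * w a' b' c' d' = w (a * a' + b * c') (a * b' + b * d') (c * a' + d * c') (c * b' + d * d')"
  using assms(1)
proof (rule SL2_induct)
  show "w 1 0 0 1 * w a' b' c' d'
    = w (1 * a' + 0 * c') (1 * b' + 0 * d') (0 * a' + 1 * c') (0 * b' + 1 * d')"
    by (simp add: modular_word.simps[of S T 1 0 0])
next
  have wS': "inverse S * w a b c d = w (- c) (- d) a b" if det: "a * d - b * c = 1" for a b c d
  proof -
    have "(- c) * b - (- d) * a = 1" using det by (simp add: algebra_simps)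
    from w_S[OF this] show ?thesis by simp
  qed
  have wT': "w (a - c) (b - d) c d = inverse T * w a b c d" if "a * d - b * c = 1" for a b c d
    using w_T[of "a - c" d "b - d" c] that by (simp add: algebra_simps)
  have wY: "w a b (c + a) (d + b) = S * (inverse T * (inverse S * w a b c d))"
    and wY': "w a b (c - a) (d - b) = S * (T * (inverse S * w a b c d))"
    if det: "a * d - b * c = 1" for a b c d
  proof -
    have 1: "(- c) * b - (- d) * a = 1" using det by (simp add: algebra_simps)
    have 2: "(- c - a) * b - (- d - b) * a = 1" using det by (simp add: algebra_simps)
    have 3: "(- c + a) * b - (- d + b) * a = 1" using det by (simp add: algebra_simps)
    show "w a b (c + a) (d + b) = S * (inverse T * (inverse S * w a b c d))"
      using w_S[OF 2] wT'[OF 1] wS'[OF det] by (simp add: add.commute)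
    show "w a b (c - a) (d - b) = S * (T * (inverse S * w a b c d))"
      using w_S[OF 3] w_T[OF 1] wS'[OF det] by simp
  qed
  fix a b c d :: int
  assume det: "a * d - b * c = 1" and IH: "w a b c d * w a' b' c' d'
    = w (a * a' + b * c') (a * b' + b * d') (c * a' + d * c') (c * b' + d * d')"
  have "(a * a' + b * c') * (c * b' + d * d') - (a * b' + b * d') * (c * a' + d * c')
      = (a * d - b * c) * (a' * d' - b' * c')"
    by (simp add: algebra_simps)
  then have det': "(a * a' + b * c') * (c * b' + d * d') - (a * b' + b * d') * (c * a' + d * c') = 1"
    using det assms(2) by simp
  have dist: "(i + k) * x + (j + l) * y = (i * x + j * y) + (k * x + l * y)"
    "(i - k) * x + (j - l) * y = (i * x + j * y) - (k * x + l * y)" for i j k l x y :: int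
    by (simp_all add: algebra_simps)
  show "w (a + c) (b + d) c d * w a' b' c' d' = w ((a + c) * a' + (b + d) * c')
      ((a + c) * b' + (b + d) * d') (c * a' + d * c') (c * b' + d * d')"
    by (simp only: dist w_T[OF det'] w_T[OF det] mult.assoc IH)
  show "w (a - c) (b - d) c d * w a' b' c' d' = w ((a - c) * a' + (b - d) * c')
      ((a - c) * b' + (b - d) * d') (c * a' + d * c') (c * b' + d * d')"
    by (simp only: dist wT'[OF det'] wT'[OF det] mult.assoc IH)
  show "w a b (c + a) (d + b) * w a' b' c' d' = w (a * a' + b * c')
      (a * b' + b * d') ((c + a) * a' + (d + b) * c') ((c + a) * b' + (d + b) * d')"
    by (simp only: dist wY[OF det'] wY[OF det] mult.assoc IH)
  show "w a b (c - a) (d - b) * w a' b' c' d' = w (a * a' + b * c')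
      (a * b' + b * d') ((c - a) * a' + (d - b) * c') ((c - a) * b' + (d - b) * d')"
    by (simp only: dist wY'[OF det'] wY'[OF det] mult.assoc IH)
qed

lemma w_T_1: "w 1 1 0 1 = T" and w_S_1: "w 0 1 (- 1) 0 = S"
  by (simp_all add: modular_word.simps[of S T])

end

sublocale modular_pair \<subseteq> SL2_hom "modular_word S T"
  by unfold_locales (rule w_hom)

section \<open>Centrality of the image of \<open>\<Gamma>(N)\<close>\<close>

lemma power_one_plus_2:
  fixes v :: int
  shows "\<exists>R. (1 + v) ^ n = 1 + int n * v + v ^ 2 * R"
proof (induction n)
  case 0
  show ?case by (intro exI[of _ 0]) simp
next
  case (Suc n)
  then obtain R where "(1 + v) ^ n = 1 + int n * v + v ^ 2 * R" ..
  then have "(1 + v) ^ Suc n = 1 + int (Suc n) * v + v ^ 2 * (R + int n + v * R)"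
    by (simp add: algebra_simps power2_eq_square)
  then show ?case ..
qed

lemma power_one_plus_3:
  fixes v :: int
  shows "\<exists>R. (1 + v) ^ n = 1 + int n * v + int (n choose 2) * v ^ 2 + v ^ 3 * R"
proof (induction n)
  case 0
  show ?case by (intro exI[of _ 0]) simp
next
  case (Suc n)
  then obtain R where R: "(1 + v) ^ n = 1 + int n * v + int (n choose 2) * v ^ 2 + v ^ 3 * R" ..
  have "Suc n choose 2 = n + (n choose 2)" by (simp add: numeral_2_eq_2)
  then have "(1 + v) ^ Suc n = 1 + int (Suc n) * v + int (Suc n choose 2) * v ^ 2
      + v ^ 3 * (R + int (n choose 2) + v * R)"
    by (simp add: R algebra_simps power2_eq_square power3_eq_cube)
  then show ?case ..
qed

text \<open>Lifting the exponent: for odd \<open>\<alpha>\<close> the coefficient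
  \<open>\<alpha> choose 2\<close> is a multiple of \<open>\<alpha>\<close>, and
  \<open>\<alpha> dvd u\<close> takes care of the cubic term, so the new unit part is
  \<open>z\<close> modulo \<open>\<alpha>\<close>.\<close>

lemma power_lift_step:
  fixes u z N :: int and \<alpha> :: nat
  assumes "odd \<alpha>" "int \<alpha> dvd u" "coprime z \<alpha>"
  obtains z' where "(1 + N * u * z) ^ \<alpha> = 1 + N * (u * \<alpha>) * z'" "coprime z' \<alpha>"
proof -
  obtain \<beta> where \<beta>: "\<alpha> = 2 * \<beta> + 1" using assms(1) by (auto elim: oddE)
  have "\<alpha> choose 2 = \<alpha> * \<beta>"
    by (simp add: \<beta> choose_two)
  moreover obtain R where "(1 + N * u * z) ^ \<alpha>
      = 1 + int \<alpha> * (N * u * z) + int (\<alpha> choose 2) * (N * u * z) ^ 2 + (N * u * z) ^ 3 * R"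
    using power_one_plus_3 by blast
  moreover obtain u' where u': "u = int \<alpha> * u'" using assms(2) ..
  ultimately have "(1 + N * u * z) ^ \<alpha>
      = 1 + N * (u * \<alpha>) * (z + int \<alpha> * (\<beta> * N * u' * z ^ 2 + N ^ 2 * u' ^ 2 * z ^ 3 * R))"
    by (simp add: algebra_simps power2_eq_square power3_eq_cube)
  moreover have "coprime (z + int \<alpha> * (\<beta> * N * u' * z ^ 2 + N ^ 2 * u' ^ 2 * z ^ 3 * R)) \<alpha>"
    using assms(3) by (metis coprime_iff_gcd_eq_1 gcd.commute gcd_add_mult mult.commute add.commute)
  ultimately show ?thesis using that by blast
qed

lemma split_off_radical:
  fixes m a :: int
  assumes "m > 0" "a \<noteq> 0"
  obtains u z i where "m = u * z" "u > 0" "u dvd a ^ i" "coprime z a"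
proof -
  have "\<exists>u z i. m = u * z \<and> u > 0 \<and> u dvd a ^ i \<and> coprime z a"
    using assms(1)
  proof (induction "nat m" arbitrary: m rule: less_induct)
    case less
    show ?case
    proof (cases "coprime m a")
      case True
      then show ?thesis by (intro exI[of _ 1] exI[of _ m] exI[of _ 0]) simp
    next
      case False
      define g where "g = gcd m a"
      obtain k where k: "m = g * k" using gcd_dvd1 unfolding g_def by blast
      have "g \<noteq> 1" "g > 0" using False assms(2) by (auto simp: g_def coprime_iff_gcd_eq_1)
      then have g: "g > 1" by simp
      then have "k > 0" using k less.prems by (simp add: zero_less_mult_iff)
      moreover have "k < m" using g \<open>k > 0\<close> k by simp
      ultimately obtain u z i where "k = u * z" "u > 0" "u dvd a ^ i" "coprime z a"
        using less.hyps[of k] by auto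
      moreover have "g dvd a" by (simp add: g_def)
      ultimately have "m = g * u * z \<and> g * u > 0 \<and> g * u dvd a ^ Suc i \<and> coprime z a"
        using k g by (auto intro: mult_dvd_mono)
      then show ?thesis by blast
    qed
  qed
  then show ?thesis using that by blast
qed

lemma euler_theorem_int:
  fixes a m :: int
  assumes "coprime a m" "m \<noteq> 0"
  shows "[a ^ totient (nat \<bar>m\<bar>) = 1] (mod m)"
proof -
  define n b where "n = nat \<bar>m\<bar>" and "b = nat (a mod \<bar>m\<bar>)"
  have n: "int n = \<bar>m\<bar>" and b: "int b = a mod \<bar>m\<bar>" using assms(2) by (simp_all add: n_def b_def)
  have "coprime (a mod \<bar>m\<bar>) \<bar>m\<bar>"
    by (subst coprime_mod_left_iff) (use assms in auto)
  then have "coprime (int b) (int n)" by (simp only: n b)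
  then have "[b ^ totient n = 1] (mod n)" by (intro euler_theorem) (simp only: coprime_int_iff)
  then have "[int (b ^ totient n) = int 1] (mod int n)" by (simp only: cong_int_iff)
  then have "[(a mod \<bar>m\<bar>) ^ totient n = 1] (mod m)" by (simp add: n b)
  moreover have "[(a mod \<bar>m\<bar>) ^ totient n = a ^ totient n] (mod m)"
    by (intro cong_pow) (simp add: cong_iff_dvd_diff dvd_diff_commute minus_mod_eq_mult_div)
  ultimately show ?thesis unfolding n_def by (metis cong_sym cong_trans)
qed

text \<open>Raising \<open>a\<close> to a high power removes all Wieferich-type obstructions: the powers of \<open>p\<close>
  then meet every residue class of \<open>1 + N a\<^sup>J \<int>\<close> modulo \<open>N a\<^sup>2\<^sup>J\<close>.\<close>

lemma power_eq_one_plus: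
  fixes N a p :: int
  assumes "N > 0" "p > 1" "odd a" "coprime p a" "coprime p N"
  obtains J0 where "\<And>J. J \<ge> J0 \<Longrightarrow> \<exists>K z. p ^ K = 1 + N * a ^ J * z \<and> coprime z a"
proof -
  define \<alpha> where "\<alpha> = nat \<bar>a\<bar>"
  have a: "odd \<alpha>" "\<alpha> > 0" using assms(3) by (auto simp: \<alpha>_def even_nat_iff)
  have \<alpha>: "int \<alpha> = \<bar>a\<bar>" by (simp add: \<alpha>_def)
  have cop: "coprime z (int \<alpha>) \<longleftrightarrow> coprime z a" for z by (simp add: \<alpha>)
  define n where "n = nat (N * \<bar>a\<bar>)"
  have n: "int n = N * \<bar>a\<bar>" "n > 0" using assms(1) a by (auto simp: n_def \<alpha>_def)
  have "[p ^ totient n = 1] (mod (N * \<bar>a\<bar>))"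

    using euler_theorem_int[of p "N * \<bar>a\<bar>"] assms by (auto simp: n_def abs_mult)
  then have "N * \<bar>a\<bar> dvd p ^ totient n - 1" by (simp add: cong_iff_dvd_diff)
  then obtain m where m: "p ^ totient n = 1 + N * (int \<alpha> * m)"
    by (auto simp: \<alpha> dvd_def algebra_simps)
  have "totient n > 0" using n(2) by simp
  then have "p ^ totient n > 1" using assms(2) by simp
  then have "N * (int \<alpha> * m) > 0" using m by simp
  then have "int \<alpha> * m > 0" using assms(1) by (simp add: zero_less_mult_iff)
  then obtain u z i where u: "int \<alpha> * m = u * z" "u > 0" "u dvd int \<alpha> ^ i" "coprime z (int \<alpha>)"
    using split_off_radical[of "int \<alpha> * m" "int \<alpha>"] a by auto
  have \<alpha>u: "int \<alpha> dvd u" using u(1,4) by (metis coprime_commute coprime_dvd_mult_left_iff dvd_triv_left)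
  have *: "\<exists>K z. p ^ K = 1 + N * (u * int \<alpha> ^ j) * z \<and> coprime z (int \<alpha>)" for j
  proof (induction j)
    case 0
    then show ?case using m u by (intro exI[of _ "totient n"] exI[of _ z]) (simp add: mult.assoc)
  next
    case (Suc j)
    then obtain K z where K: "p ^ K = 1 + N * (u * int \<alpha> ^ j) * z" "coprime z (int \<alpha>)" by blast
    obtain z' where "(1 + N * (u * int \<alpha> ^ j) * z) ^ \<alpha> = 1 + N * (u * int \<alpha> ^ j * \<alpha>) * z'"
      "coprime z' \<alpha>"
      using power_lift_step[OF a(1) _ K(2), of "u * int \<alpha> ^ j" N] \<alpha>u by auto
    then have "p ^ (K * \<alpha>) = 1 + N * (u * int \<alpha> ^ Suc j) * z' \<and> coprime z' \<alpha>"
      by (simp add: power_mult K algebra_simps)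
    then show ?case by blast
  qed
  \<comment> \<open>The modulus still contains \<open>u\<close>, which need not be a power of
    \<open>\<alpha>\<close>. Raising to the power \<open>v = \<alpha> ^ i / u\<close> completes
    \<open>u\<close> to \<open>\<alpha> ^ i\<close>; the further \<open>i + 1\<close> factors keep
    the quadratic term one power of \<open>\<alpha>\<close> higher than the linear one.\<close>
  obtain v where v: "int \<alpha> ^ i = u * v" using u(3) ..
  have "v > 0" using v u(2) a by (metis of_nat_0_less_iff zero_less_mult_pos zero_less_power)
  obtain K z1 where K: "p ^ K = 1 + N * (u * int \<alpha> ^ (i + 1)) * z1" "coprime z1 (int \<alpha>)"
    using *[of "i + 1"] by blast
  define J0 where "J0 = i + (i + 1)"
  have J0_base: "\<exists>K z. p ^ K = 1 + N * int \<alpha> ^ J0 * z \<and> coprime z (int \<alpha>)"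
  proof -
    define V where "V = N * (u * int \<alpha> ^ (i + 1)) * z1"
    obtain R where "(1 + V) ^ nat v = 1 + int (nat v) * V + V ^ 2 * R"
      using power_one_plus_2 by blast
    then have "p ^ (K * nat v) = 1 + v * V + V ^ 2 * R"
      using \<open>v > 0\<close> by (simp add: power_mult K V_def)
    also have "v * V = N * int \<alpha> ^ J0 * z1"
      by (simp add: V_def J0_def power_add v algebra_simps)
    also have "V ^ 2 * R = N * int \<alpha> ^ J0 * (int \<alpha> * (N * u ^ 2 * z1 ^ 2 * R))"
      by (simp add: V_def J0_def power_add power2_eq_square algebra_simps)
    also have "1 + N * int \<alpha> ^ J0 * z1 + N * int \<alpha> ^ J0 * (int \<alpha> * (N * u ^ 2 * z1 ^ 2 * R))
        = 1 + N * int \<alpha> ^ J0 * (z1 + int \<alpha> * (N * u ^ 2 * z1 ^ 2 * R))"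
      by (simp add: algebra_simps)
    finally have "p ^ (K * nat v) = 1 + N * int \<alpha> ^ J0 * (z1 + int \<alpha> * (N * u ^ 2 * z1 ^ 2 * R))" .
    moreover have "coprime (z1 + int \<alpha> * (N * u ^ 2 * z1 ^ 2 * R)) (int \<alpha>)"
      using K(2) by (metis coprime_iff_gcd_eq_1 gcd.commute gcd_add_mult mult.commute add.commute)
    ultimately show ?thesis by (intro exI conjI)
  qed
  have "\<exists>K z. p ^ K = 1 + N * int \<alpha> ^ J * z \<and> coprime z (int \<alpha>)" if "J \<ge> J0" for J
    using that
  proof (induction J rule: dec_induct)
    case base
    show ?case by (rule J0_base)
  next
    case (step J)
    then obtain K z where K: "p ^ K = 1 + N * int \<alpha> ^ J * z" "coprime z (int \<alpha>)" by blast
    have "J \<noteq> 0" using step by (simp add: J0_def)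
    then have "int \<alpha> dvd int \<alpha> ^ J" by simp
    then obtain z' where "(1 + N * int \<alpha> ^ J * z) ^ \<alpha> = 1 + N * (int \<alpha> ^ J * \<alpha>) * z'" "coprime z' \<alpha>"
      using power_lift_step[OF a(1) _ K(2)] by blast
    then have "p ^ (K * \<alpha>) = 1 + N * int \<alpha> ^ Suc J * z' \<and> coprime z' \<alpha>"
      by (simp add: power_mult K algebra_simps)
    then show ?case by blast
  qed
  moreover have "\<exists>z'. N * int \<alpha> ^ J * z = N * a ^ J * z' \<and> (coprime z (int \<alpha>) \<longrightarrow> coprime z' a)" for J z
  proof -
    have "int \<alpha> ^ J = a ^ J \<or> int \<alpha> ^ J = - (a ^ J)"
      by (metis \<alpha> abs_if power_minus_even power_minus_odd)
    then show ?thesis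
      by (elim disjE) (auto simp: cop intro: exI[of _ z] exI[of _ "- z"])
  qed
  ultimately have "\<exists>K z. p ^ K = 1 + N * a ^ J * z \<and> coprime z a" if "J \<ge> J0" for J
    using that by metis
  then show ?thesis by (rule that)
qed

lemma shift_coprime_6:
  fixes a m :: int
  assumes "coprime a m"
  obtains t where "odd (a + t * m)" "\<not> 3 dvd a + t * m"
proof -
  have 2: "odd a \<or> odd m" using assms by (metis coprime_common_divisor odd_one)
  have 3: "\<not> 3 dvd a \<or> \<not> 3 dvd m"
    using assms coprime_common_divisor[of a m 3] by auto
  define e f :: int where "e = (if odd a then 0 else 1)" and "f = (if 3 dvd a then 1 else 0)"
  \<comment> \<open>\<open>3 * e + 4 * f\<close> is \<open>e\<close> modulo 2 and \<open>f\<close>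
    modulo 3.\<close>
  have "a + (3 * e + 4 * f) * m = (a + e * m) + 2 * ((e + 2 * f) * m)"
    by (simp add: algebra_simps)
  then have "odd (a + (3 * e + 4 * f) * m) \<longleftrightarrow> odd (a + e * m)" by simp
  also have "\<dots>" using 2 by (auto simp: e_def)
  finally have "odd (a + (3 * e + 4 * f) * m)" .
  moreover have "a + (3 * e + 4 * f) * m = (a + f * m) + (e + f) * m * 3"
    by (simp add: algebra_simps)
  then have "3 dvd a + (3 * e + 4 * f) * m \<longleftrightarrow> 3 dvd a + f * m"
    by (metis dvd_add_times_triv_right_iff)
  moreover have "\<not> 3 dvd a + f * m" using 3 by (auto simp: f_def dvd_add_right_iff)
  ultimately show ?thesis using that by blast
qed

section \<open>Consequences of the invariance of the kernel under conjugation by diag(p, 1)\<close>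

text \<open>\<open>kernel\<close> is all that is kept of the Galois action: the matrix with rows (a,
  p b) and (c, d) is the conjugate by diag(p, 1) of the one with rows (a, b) and (p c, d).\<close>

locale congruence_tower = SL2_hom r for r :: "int \<Rightarrow> int \<Rightarrow> int \<Rightarrow> int \<Rightarrow> 'g::group_mult" +
  fixes N p :: int
  assumes N_pos: "N > 0" and p: "p = 2 \<or> p = 3" and p_N: "coprime p N"
    and X_N: "X N = 1"
    and kernel: "a * d - b * (p * c) = 1 \<Longrightarrow> r a b (p * c) d = 1 \<longleftrightarrow> r a (p * b) c d = 1"
begin

lemma kernel_power:
  "a * d - b * (p ^ k * c) = 1 \<Longrightarrow> r a b (p ^ k * c) d = 1 \<longleftrightarrow> r a (p ^ k * b) c d = 1"
proof (induction k arbitrary: b c)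
  case (Suc k)
  have "r a b (p ^ Suc k * c) d = 1 \<longleftrightarrow> r a (p * b) (p ^ k * c) d = 1"
    using kernel[of a d b "p ^ k * c"] Suc.prems by (simp add: mult.assoc)
  also have "\<dots> \<longleftrightarrow> r a (p ^ k * (p * b)) c d = 1"
    using Suc.IH[of "p * b" c] Suc.prems by (simp add: algebra_simps)
  finally show ?case by (simp add: algebra_simps)
qed simp

lemma X_N_mult [simp]: "X (N * i) = 1" and X_N_mult' [simp]: "X (i * N) = 1"
proof -
  have "X (0 + i * N) = 1"
    by (rule int_shift_induct[where P = "\<lambda>i _. X i = 1" and v = 0])
      (use X_N X_add[of _ N] X_add[of "_ - N" N] in auto)
  then show "X (N * i) = 1" "X (i * N) = 1" by (simp_all add: mult.commute)
qed

lemma Y_N_mult [simp]: "Y (N * i) = 1" and Y_N_mult' [simp]: "Y (i * N) = 1"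
proof -
  have "J * Y (N * i) = J * 1" using J_Y[of "N * i"] X_N_mult[of "- i"] by simp
  then show "Y (N * i) = 1" "Y (i * N) = 1" by (simp_all only: group_left_cancel mult.commute)
qed

lemma X_cong: "[i = j] (mod N) \<Longrightarrow> X i = X j"
  using X_add[of j "i - j"] by (auto simp: cong_iff_dvd_diff)

lemma Y_cong: "[i = j] (mod N) \<Longrightarrow> Y i = Y j"
  using Y_add[of j "i - j"] by (auto simp: cong_iff_dvd_diff)

lemma X_eq_1: "N dvd i \<Longrightarrow> X i = 1" and Y_eq_1: "N dvd i \<Longrightarrow> Y i = 1"
  by auto

text \<open>The lower left entry of the quotient of the two matrices is divisible by
  \<open>p ^ k\<close>, so \<open>kernel_power\<close> allows this factor to be moved to the upper
  right entry. The moved matrix is \<open>X (- b1) * Y (c2 - c1) * X b2\<close>, whose three factors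
  are trivial.\<close>

lemma prime_power_row_unique:
  assumes "p ^ k * d1 - b1 * c1 = 1" "p ^ k * d2 - b2 * c2 = 1"
    and "N dvd b1" "N dvd c1" "N dvd b2" "N dvd c2"
  shows "r (p ^ k) b1 c1 d1 = r (p ^ k) b2 c2 d2"
proof -
  have det1: "d1 * p ^ k - (- b1) * (- c1) = 1" using assms(1) by (simp add: mult.commute)
  have "inverse (r (p ^ k) b1 c1 d1) * r (p ^ k) b2 c2 d2
      = r (d1 * p ^ k - b1 * c2) (d1 * b2 - b1 * d2) (p ^ k * (c2 - c1)) (p ^ k * d2 - c1 * b2)"
    by (simp add: hom_inverse[OF assms(1)] hom[OF det1 assms(2)] algebra_simps)
  moreover have "\<dots> = 1"
  proof (subst kernel_power)
    have "(d1 * p ^ k - b1 * c2) * (p ^ k * d2 - c1 * b2) - (d1 * b2 - b1 * d2) * (p ^ k * (c2 - c1))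
        = (p ^ k * d1 - b1 * c1) * (p ^ k * d2 - b2 * c2)"
      by (simp add: algebra_simps)
    then show "(d1 * p ^ k - b1 * c2) * (p ^ k * d2 - c1 * b2)
        - (d1 * b2 - b1 * d2) * (p ^ k * (c2 - c1)) = 1"
      using assms(1,2) by simp
    have e: "p ^ k * d1 = 1 + b1 * c1" "p ^ k * d2 = 1 + b2 * c2" using assms(1,2) by simp_all
    have "r (d1 * p ^ k - b1 * c2) (p ^ k * (d1 * b2 - b1 * d2)) (c2 - c1) (p ^ k * d2 - c1 * b2)
        = X (- b1) * Y (c2 - c1) * X b2"
    proof -
      have "X (- b1) * Y (c2 - c1) * X b2 = r (1 - b1 * (c2 - c1)) (- b1 + b2 * (1 - b1 * (c2 - c1)))
          (c2 - c1) (1 + b2 * (c2 - c1))"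
        by (simp add: X_def Y_def hom algebra_simps)
      also have "1 - b1 * (c2 - c1) = d1 * p ^ k - b1 * c2"
        using e by (simp add: algebra_simps)
      also have "- b1 + b2 * (d1 * p ^ k - b1 * c2) = p ^ k * (d1 * b2 - b1 * d2)"
      proof -
        have "p ^ k * (d1 * b2 - b1 * d2) = (p ^ k * d1) * b2 - b1 * (p ^ k * d2)"
          by (simp add: algebra_simps)
        moreover have "- b1 + b2 * (d1 * p ^ k - b1 * c2) = - b1 + b2 * (p ^ k * d1) - b1 * b2 * c2"
          by (simp add: algebra_simps)
        ultimately show ?thesis by (simp only: e) (simp add: algebra_simps)
      qed
      also have "1 + b2 * (c2 - c1) = p ^ k * d2 - c1 * b2"
        using e by (simp add: algebra_simps)
      finally show ?thesis by simp
    qed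
    also have "\<dots> = 1"
      using assms(3-6) by (simp add: X_eq_1 Y_eq_1)
    finally show "r (d1 * p ^ k - b1 * c2) (p ^ k * (d1 * b2 - b1 * d2)) (c2 - c1)
      (p ^ k * d2 - c1 * b2) = 1" .
  qed
  ultimately show ?thesis by (metis group_eq_iff)
qed

text \<open>One matrix with this upper left entry suffices: for \<open>p ^ k = 1 + j * N\<close> the
  conjugate \<open>Y (- j) * X N * Y j\<close> has it.\<close>

lemma prime_power_row_trivial:
  assumes "p ^ k * d - b * c = 1" "N dvd b" "N dvd c" "[p ^ k = 1] (mod N)"
  shows "r (p ^ k) b c d = 1"
proof -
  obtain j where j: "p ^ k = 1 + j * N"
    using assms(4) by (auto simp: cong_iff_dvd_diff dvd_def algebra_simps)
  have "r (p ^ k) b c d = r (p ^ k) N (- j * j * N) (1 - j * N)"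
    by (rule prime_power_row_unique) (use assms j in \<open>auto simp: algebra_simps\<close>)
  also have "\<dots> = Y (- j) * X N * Y j"
    by (simp add: X_def Y_def hom algebra_simps j)
  also have "\<dots> = 1" by (simp add: X_N flip: Y_add)
  finally show ?thesis .
qed

text \<open>Conjugating \<open>X 1\<close> by the matrix and multiplying by
  \<open>X (- (a ^ 2))\<close> gives a matrix with upper left entry \<open>1 - a * c\<close>; it is
  killed because this entry is a power of \<open>p\<close>.\<close>

lemma torus_X_base:
  assumes "a * d - b * c = 1" "N dvd c" "1 - a * c = p ^ k"
  shows "r a b c d * X 1 = X (a ^ 2) * r a b c d"
proof -
  have det: "d * a - (- b) * (- c) = 1" using assms(1) by (simp add: mult.commute)
  have "r a b c d * X 1 * inverse (r a b c d) * X (- (a ^ 2))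
      = r (p ^ k) (a ^ 3 * c) (- (c ^ 2)) (1 + a * c + a ^ 2 * c ^ 2)"
  proof -
    have d1: "a * (d + c) - (b + a) * c = 1" using assms(1) by (simp add: algebra_simps)
    have "r a b c d * X 1 * inverse (r a b c d)
       = r (a * d - (b + a) * c) (- a * b + (b + a) * a) (c * d - (d + c) * c) (- c * b + (d + c) * a)"
      unfolding hom_inverse[OF assms(1)] r_X[OF assms(1)]
      by (simp add: hom[OF d1 det])
    also have "a * d - (b + a) * c = 1 - a * c" using assms(1) by (simp add: algebra_simps)
    also have "- c * b + (d + c) * a = 1 + a * c" using assms(1) by (simp add: algebra_simps)
    also have "- a * b + (b + a) * a = a ^ 2" by (simp add: algebra_simps power2_eq_square)
    also have "c * d - (d + c) * c = - (c ^ 2)" by (simp add: algebra_simps power2_eq_square)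
    finally have "r a b c d * X 1 * inverse (r a b c d) = r (1 - a * c) (a ^ 2) (- (c ^ 2)) (1 + a * c)" .
    moreover have "(1 - a * c) * (1 + a * c) - a ^ 2 * (- (c ^ 2)) = 1"
      by (simp add: algebra_simps power2_eq_square)
    ultimately show ?thesis
      by (simp add: r_X assms(3) [symmetric]) (simp add: algebra_simps power2_eq_square power3_eq_cube)
  qed
  also have "\<dots> = 1"
  proof (rule prime_power_row_trivial)
    have "(1 - a * c) * (1 + a * c + a ^ 2 * c ^ 2) - a ^ 3 * c * - (c ^ 2) = 1"
      by (simp add: algebra_simps power2_eq_square power3_eq_cube)
    then show "p ^ k * (1 + a * c + a ^ 2 * c ^ 2) - a ^ 3 * c * - (c ^ 2) = 1"
      using assms(3) by simp
    show "[p ^ k = 1] (mod N)"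
      using assms(2) by (simp add: cong_iff_dvd_diff flip: assms(3))
  qed (use assms(2) in \<open>auto simp: power2_eq_square\<close>)
  finally have "r a b c d * X 1 * inverse (r a b c d) = inverse (X (- (a ^ 2)))"
    by (metis inverse_eqI')
  also have "inverse (X (- (a ^ 2))) = X (a ^ 2)"
    by (rule inverse_eqI) (simp flip: X_add)
  finally show ?thesis
    by (metis inverse_mult_self mult.assoc mult_1_right)
qed

text \<open>Factors \<open>Y\<close> of multiples of \<open>N\<close> on either side do not change
  the image. On the right they turn \<open>a\<close> into \<open>a ^ J\<close>; on the left they
  then shift the lower left entry by multiples of \<open>N * a ^ J\<close>, until 1 minus the
  product of the entries of the first column is a power of \<open>p\<close>.\<close>

lemma torus_X_coprime:
  assumes "a * d - b * c = 1" "N dvd b" "N dvd c" "b \<noteq> 0" "odd a" "\<not> 3 dvd a"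
  shows "r a b c d * X 1 = X (a ^ 2) * r a b c d"
proof -
  have pa: "coprime p a"
    using p assms(5,6) by (auto intro: prime_imp_coprime[of "3::int"] simp: prime_int_numeral_eq)
  have "p > 1" using p by auto
  obtain J0 where J0: "\<And>J. J \<ge> J0 \<Longrightarrow> \<exists>K z. p ^ K = 1 + N * a ^ J * z \<and> coprime z a"
    using power_eq_one_plus[OF N_pos \<open>p > 1\<close> assms(5) pa p_N] by metis
  define n where "n = nat \<bar>N * b\<bar>"
  have n: "int n = \<bar>N * b\<bar>" by (simp add: n_def)
  \<comment> \<open>\<open>J\<close> is 1 modulo the totient, so \<open>a ^ J\<close> is
    \<open>a\<close> modulo \<open>N * b\<close>, and it is large enough for
    \<open>J0\<close>.\<close>
  define J where "J = 1 + J0 * totient n"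
  have "n > 0" using N_pos assms(4) by (simp add: n_def)
  then have "J \<ge> J0" by (simp add: J_def) (metis One_nat_def Suc_leI le_SucI mult.commute mult_le_mono1 nat_mult_1 totient_gt_0_iff zero_less_iff_neq_zero gr0I le_add1 mult_1 trans_le_add2)
  have "coprime a (N * b)"
  proof -
    have "coprime a b" using assms(1) by (metis coprime_iff_gcd_eq_1 coprime_def dvd_diff dvd_mult2 dvd_mult)
    moreover have "coprime a N" using \<open>coprime a b\<close> assms(2) by (meson coprime_divisors dvd_refl)
    ultimately show ?thesis by simp
  qed
  have "[a ^ totient n = 1] (mod (N * b))"
    unfolding n_def by (rule euler_theorem_int) (use \<open>coprime a (N * b)\<close> N_pos assms(4) in auto)
  then have "[(a ^ totient n) ^ J0 * a = 1 ^ J0 * a] (mod (N * b))"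
    by (intro cong_mult cong_pow cong_refl)
  then have "[a ^ J = a] (mod (N * b))"
    by (simp add: J_def power_mult power_add mult.commute flip: power_mult)
  then obtain k where k: "a ^ J = a + N * k * b"
    by (auto simp: cong_iff_dvd_diff dvd_def algebra_simps)
  define c1 where "c1 = c + N * k * d"
  have A1: "r (a ^ J) b c1 d = r a b c d"
    using r_Y[OF assms(1), of "N * k"] by (simp add: k c1_def mult.assoc)
  have det1: "a ^ J * d - b * c1 = 1"
    using assms(1) by (simp add: k c1_def algebra_simps)
  have "N dvd c1" using assms(3) by (simp add: c1_def)
  then obtain c' where c': "c1 = N * c'" ..
  obtain K z where K: "p ^ K = 1 + N * a ^ J * z" "coprime z a" using J0[OF \<open>J \<ge> J0\<close>] by blast
  \<comment> \<open>The linear term \<open>m * N * a ^ J * z\<close> of \<open>p ^ (K * m)\<close>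
    has to agree with \<open>- N * a ^ J * c'\<close> modulo \<open>N * a ^ (2 * J)\<close>. This
    can be solved for \<open>m\<close> because \<open>z\<close> is a unit modulo \<open>a\<close>;
    the remaining multiple is absorbed by \<open>t\<close>.\<close>
  obtain m where m: "a ^ J dvd int m * z + c'"
  proof -
    have "a ^ J \<noteq> 0" using assms(5) by auto
    obtain x where "[z * x = 1] (mod a ^ J)"
      using cong_solve_coprime_int[of z "a ^ J"] K(2) by (auto simp: coprime_power_right_iff)
    then have "[z * (x * (- c')) = - c'] (mod a ^ J)"
      using cong_scalar_right[of "z * x" 1 "a ^ J" "- c'"] by (simp add: mult.assoc)
    moreover have "[(x * (- c')) mod \<bar>a ^ J\<bar> = x * (- c')] (mod \<bar>a ^ J\<bar>)"
      unfolding cong_def by (rule mod_mod_trivial)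
    then have "[(x * (- c')) mod \<bar>a ^ J\<bar> = x * (- c')] (mod a ^ J)"
      by (rule cong_dvd_modulus) simp
    then have "[z * ((x * (- c')) mod \<bar>a ^ J\<bar>) = z * (x * (- c'))] (mod a ^ J)"
      by (rule cong_scalar_left)
    ultimately have "[z * ((x * (- c')) mod \<bar>a ^ J\<bar>) = - c'] (mod a ^ J)" by (rule cong_trans[rotated])
    then have "a ^ J dvd int (nat ((x * (- c')) mod \<bar>a ^ J\<bar>)) * z + c'"
      using \<open>a ^ J \<noteq> 0\<close> by (simp add: cong_iff_dvd_diff mult.commute)
    then show ?thesis by (rule that)
  qed
  obtain R where R: "p ^ (K * m) = 1 + int m * (N * a ^ J * z) + (N * a ^ J * z) ^ 2 * R"
    unfolding power_mult K using power_one_plus_2 by blast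
  obtain q where q: "int m * z + c' = a ^ J * q" using m ..
  define t where "t = - q - N * z ^ 2 * R"
  have "1 - a ^ J * (c1 + N * t * a ^ J) = p ^ (K * m)"
  proof -
    have "int m * (N * a ^ J * z) = N * a ^ J * (int m * z)" by simp
    also have "int m * z = a ^ J * q - c'" using q by simp
    finally have "int m * (N * a ^ J * z) = N * a ^ J * (a ^ J * q - c')" .
    then show ?thesis unfolding R by (simp add: t_def c' algebra_simps power2_eq_square)
  qed
  moreover have "a ^ J * (d + N * t * b) - b * (c1 + N * t * a ^ J) = 1"
    using det1 by (simp add: algebra_simps)
  moreover have "N dvd c1 + N * t * a ^ J" by (simp add: c')
  ultimately have "r (a ^ J) b (c1 + N * t * a ^ J) (d + N * t * b) * X 1
      = X ((a ^ J) ^ 2) * r (a ^ J) b (c1 + N * t * a ^ J) (d + N * t * b)"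
    by (intro torus_X_base)
  moreover have "r (a ^ J) b (c1 + N * t * a ^ J) (d + N * t * b) = r a b c d"
    using Y_r[OF det1, of "N * t"] by (simp add: A1 mult.assoc)
  moreover have "X ((a ^ J) ^ 2) = X (a ^ 2)"
    by (intro X_cong cong_pow) (simp add: k cong_iff_dvd_diff)
  ultimately show ?thesis by simp
qed

lemma torus_X_1:
  assumes "a * d - b * c = 1" "N dvd b" "N dvd c"
  shows "r a b c d * X 1 = X (a ^ 2) * r a b c d"
proof -
  define b1 d1 where "b1 = (if b = 0 then N * a else b)" and "d1 = (if b = 0 then d + N * c else d)"
  have det1: "a * d1 - b1 * c = 1" using assms(1) by (auto simp: b1_def d1_def algebra_simps)
  have r1: "r a b1 c d1 = r a b c d"
    using r_X[OF assms(1), of N] X_N by (auto simp: b1_def d1_def)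
  have b1: "N dvd b1" "b1 \<noteq> 0" using assms N_pos by (auto simp: b1_def)
  have "coprime a b1" using det1 by (metis coprime_iff_gcd_eq_1 coprime_def dvd_diff dvd_mult2 dvd_mult)
  moreover have "coprime a N" using \<open>coprime a b1\<close> b1(1) by (meson coprime_divisors dvd_refl)
  ultimately obtain t where t: "odd (a + t * (N * b1))" "\<not> 3 dvd a + t * (N * b1)"
    using shift_coprime_6[of a "N * b1"] by auto
  have "a + t * (N * b1) = a + N * t * b1" by simp
  note t = t[unfolded this]
  have det2: "(a + N * t * b1) * d1 - b1 * (c + N * t * d1) = 1"
    using det1 by (simp add: algebra_simps)
  have r2: "r (a + N * t * b1) b1 (c + N * t * d1) d1 = r a b c d"
    using r_Y[OF det1, of "N * t"] r1 by (simp add: mult.assoc)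
  have "r a b c d * X 1 = X ((a + N * t * b1) ^ 2) * r a b c d"
    using torus_X_coprime[OF det2 b1(1) _ b1(2) t] assms(3) r2 by (simp add: mult.assoc)
  also have "X ((a + N * t * b1) ^ 2) = X (a ^ 2)"
    by (intro X_cong cong_pow) (simp add: cong_iff_dvd_diff)
  finally show ?thesis .
qed

lemma commute_shift:
  fixes V :: "int \<Rightarrow> 'g" and g :: 'g
  assumes V_add: "\<And>i j. V (i + j) = V i * V j" and g: "g * V 1 = V m * g"
  shows "g * V s = V (m * s) * g"
proof (induction s rule: int_induct[where k = 0])
  {
    case base
    have "V 0 * V 0 = V 0 * 1" using V_add[of 0 0] by simp
    then have "V 0 = 1" by (simp only: group_left_cancel)
    then show ?case by simp
  next
    case (step1 i)
    have "g * V (i + 1) = g * V i * V 1" by (simp add: V_add mult.assoc)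
    also have "\<dots> = V (m * i) * (V m * g)" by (simp add: step1 mult.assoc g)
    also have "\<dots> = V (m * (i + 1)) * g" by (simp add: distrib_left V_add mult.assoc)
    finally show ?case .
  next
    case (step2 i)
    have "g * V (i - 1) * V 1 = V (m * i) * g" using step2 V_add[of "i - 1" 1] by (simp add: mult.assoc)
    also have "\<dots> = V (m * (i - 1)) * (V m * g)"
      using V_add[of "m * (i - 1)" m] by (simp add: algebra_simps)
    also have "\<dots> = V (m * (i - 1)) * g * V 1" by (simp add: g mult.assoc)
    finally show ?case by (simp only: group_right_cancel)
  }
qed

lemma torus_X:
  assumes "a * d - b * c = 1" "N dvd b" "N dvd c"
  shows "r a b c d * X s = X (a ^ 2 * s) * r a b c d"
  using commute_shift[of X, OF X_add torus_X_1[OF assms]] .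

text \<open>Conjugation by \<open>J\<close> exchanges the two unipotent subgroups and the two
  diagonal entries.\<close>

lemma torus_Y:
  assumes "a * d - b * c = 1" "N dvd b" "N dvd c"
  shows "r a b c d * Y s = Y (d ^ 2 * s) * r a b c d"
proof -
  have det: "d * a - (- c) * (- b) = 1" using assms(1) by (simp add: mult.commute)
  have JA: "J * r a b c d = r d (- c) (- b) a * J"
    using assms(1) det by (simp add: J_def hom)
  have "J * (r a b c d * Y s) = r d (- c) (- b) a * (J * Y s)" by (simp add: JA flip: mult.assoc)
  also have "\<dots> = r d (- c) (- b) a * X (- s) * J" by (simp add: J_Y mult.assoc)
  also have "\<dots> = X (d ^ 2 * (- s)) * (r d (- c) (- b) a * J)"
    using torus_X[OF det, of "- s"] assms(2,3) by (simp add: mult.assoc)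
  also have "\<dots> = J * (Y (d ^ 2 * s) * r a b c d)"
    by (simp add: JA [symmetric] J_Y flip: mult.assoc)
  finally show ?thesis by (simp only: group_left_cancel)
qed

end

section \<open>Torus factors and rigidity\<close>

text \<open>Ideal membership with a certificate: the multipliers \<open>A\<close> and
  \<open>B\<close> given at each use express the difference through the hypotheses, and a ring
  identity checks them.\<close>

lemma cong_combination:
  fixes n :: int
  assumes "[h1 = k1] (mod n)" "[h2 = k2] (mod n)" "e1 - e2 = A * (h1 - k1) + B * (h2 - k2)"
  shows "[e1 = e2] (mod n)"
  unfolding cong_iff_dvd_diff assms(3)
  by (intro dvd_add dvd_mult) (use assms(1,2) in \<open>simp_all add: cong_iff_dvd_diff\<close>)

text \<open>\<open>x\<close> and \<open>y\<close> are the images of the upper and lower unipotent matrices modulo \<open>Q\<close>, and \<open>F u\<close> is the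
  set of images of the matrices congruent to \<open>diag(u, 1/u)\<close>. Centrality of \<open>F 1\<close> replaces its
  triviality, which is what has to be proved in the end.\<close>

locale torus_system =
  fixes x y :: "int \<Rightarrow> 'g::group_mult" and Q :: int and F :: "int \<Rightarrow> 'g set"
  assumes x_add: "x (i + j) = x i * x j" and y_add: "y (i + j) = y i * y j"
    and x_cong: "[i = j] (mod Q) \<Longrightarrow> x i = x j" and y_cong: "[i = j] (mod Q) \<Longrightarrow> y i = y j"
    and F_x: "f \<in> F u \<Longrightarrow> f * x s = x (u ^ 2 * s) * f"
    and F_y: "f \<in> F u \<Longrightarrow> f * y (u ^ 2 * s) = y s * f"
    and F_cong: "f \<in> F u \<Longrightarrow> [u = v] (mod Q) \<Longrightarrow> f \<in> F v"
    and F_mult: "f \<in> F u \<Longrightarrow> f' \<in> F v \<Longrightarrow> f * f' \<in> F (u * v)"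
    and F_inverse: "f \<in> F u \<Longrightarrow> [u * w = 1] (mod Q) \<Longrightarrow> inverse f \<in> F w"
    and F_central: "c \<in> F 1 \<Longrightarrow> f \<in> F u \<Longrightarrow> c * f = f * c"
    and F_word: "[(1 + b * t) * w = 1] (mod Q) \<Longrightarrow>
      y (- (t * w)) * x b * y t * x (- (b * w)) \<in> F (1 + b * t)"
begin

text \<open>For a unit \<open>u = 1 + b t\<close> with inverse \<open>w\<close> this is the torus factor of \<open>x b * y t\<close> in the
  big cell; rigidity says that it depends on \<open>u\<close> only.\<close>

definition K where "K b t w = y (- (t * w)) * x b * y t * x (- (b * w))"

definition rigid where
  "rigid \<longleftrightarrow> (\<forall>b t b' t' w. [(1 + b * t) * w = 1] (mod Q) \<longrightarrow> [b * t = b' * t'] (mod Q) \<longrightarrow>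
     K b t w = K b' t' w)"

lemma x_0 [simp]: "x 0 = 1" and y_0 [simp]: "y 0 = 1"
proof -
  have "x 0 * x 0 = x 0 * 1" using x_add[of 0 0] by simp
  then show "x 0 = 1" by (simp only: group_left_cancel)
  have "y 0 * y 0 = y 0 * 1" using y_add[of 0 0] by simp
  then show "y 0 = 1" by (simp only: group_left_cancel)
qed

lemma x_minus: "x (- i) = inverse (x i)" and y_minus: "y (- i) = inverse (y i)"
  using x_add[of i "- i"] y_add[of i "- i"] by (simp_all add: inverse_eqI)

lemma K_cong:
  "[b = b'] (mod Q) \<Longrightarrow> [t = t'] (mod Q) \<Longrightarrow> [w = w'] (mod Q) \<Longrightarrow> K b t w = K b' t' w'"
  unfolding K_def
  by (intro arg_cong2[where f = "(*)"] x_cong y_cong cong_mult cong_minus_minus_iff[THEN iffD2])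

lemma K_mem: "[(1 + b * t) * w = 1] (mod Q) \<Longrightarrow> K b t w \<in> F (1 + b * t)"
  unfolding K_def by (rule F_word)

lemma x_y: "x b * y t = y (t * w) * (K b t w * x (b * w))"
  by (simp add: K_def x_minus y_minus mult.assoc)

lemma x_F:
  assumes "f \<in> F u" "[u * w = 1] (mod Q)"
  shows "x s * f = f * x (w ^ 2 * s)"
proof -
  have "f * x (w ^ 2 * s) = x (u ^ 2 * (w ^ 2 * s)) * f" by (rule F_x[OF assms(1)])
  also have "x (u ^ 2 * (w ^ 2 * s)) = x s"
    by (rule x_cong, rule cong_combination[OF assms(2) cong_refl[of 0], of _ _ "(u * w + 1) * s" 0])
      (simp add: algebra_simps power2_eq_square)
  finally show ?thesis by simp
qed

lemma F_y':
  assumes "f \<in> F u" "[u * w = 1] (mod Q)"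
  shows "f * y s = y (w ^ 2 * s) * f"
proof -
  have "f * y (u ^ 2 * (w ^ 2 * s)) = y (w ^ 2 * s) * f" by (rule F_y[OF assms(1)])
  also have "y (u ^ 2 * (w ^ 2 * s)) = y s"
    by (rule y_cong, rule cong_combination[OF assms(2) cong_refl[of 0], of _ _ "(u * w + 1) * s" 0])
      (simp add: algebra_simps power2_eq_square)
  finally show ?thesis .
qed

text \<open>The product \<open>x b * y t * y t'\<close> is brought into big cell form at once and
  one \<open>y\<close> at a time; after the torus factor has been moved past the second
  \<open>y\<close>, the outer factors agree and cancel. \<open>K_add_left\<close> is the mirror
  image, starting from \<open>x b' * x b * y t\<close>.\<close>

lemma K_add_right:
  assumes w: "[(1 + b * t) * w = 1] (mod Q)" and w': "[(1 + b * w * t') * w' = 1] (mod Q)"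
  shows "K b (t + t') (w * w') = K b t w * K (b * w) t' w'"
proof -
  have "y ((t + t') * (w * w')) * (K b (t + t') (w * w') * x (b * (w * w')))
      = x b * y t * y t'"
    by (simp only: x_y[symmetric] y_add mult.assoc)
  also have "\<dots> = y (t * w) * (K b t w * (x (b * w) * y t'))"
    by (simp only: x_y[of b t w] mult.assoc)
  also have "\<dots> = y (t * w) * (K b t w * y (t' * w') * (K (b * w) t' w' * x (b * w * w')))"
    by (simp only: x_y[of "b * w" t' w'] mult.assoc)
  also have "\<dots> = y (t * w) * y (w ^ 2 * (t' * w')) * (K b t w * K (b * w) t' w' * x (b * w * w'))"
    by (simp only: F_y'[OF K_mem[OF w] w] mult.assoc)
  also have "y (t * w) * y (w ^ 2 * (t' * w')) = y ((t + t') * (w * w'))"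
    unfolding y_add[symmetric]
    by (rule y_cong, rule cong_combination[OF w w', of _ _ "t' * w * w'" "- (t * w)"])
      (simp add: algebra_simps power2_eq_square)
  finally have "K b (t + t') (w * w') * x (b * (w * w'))
      = (K b t w * K (b * w) t' w') * x (b * (w * w'))"
    by (simp only: group_left_cancel mult.assoc)
  then show ?thesis by (simp only: group_right_cancel)
qed

lemma K_add_left:
  assumes w: "[(1 + b * t) * w = 1] (mod Q)" and w': "[(1 + b' * (t * w)) * w' = 1] (mod Q)"
  shows "K (b + b') t (w * w') = K b' (t * w) w' * K b t w"
proof -
  have "y (t * (w * w')) * (K (b + b') t (w * w') * x ((b + b') * (w * w')))
      = x b' * (x b * y t)"
    by (simp only: x_y[symmetric] add.commute[of b] x_add mult.assoc)
  also have "\<dots> = x b' * y (t * w) * (K b t w * x (b * w))"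
    by (simp only: x_y[of b t w] mult.assoc)
  also have "\<dots> = y (t * w * w') * (K b' (t * w) w' * (x (b' * w') * K b t w * x (b * w)))"
    by (simp only: x_y[of b' "t * w" w'] mult.assoc)
  also have "\<dots> = y (t * w * w') * (K b' (t * w) w' * (K b t w * (x (w ^ 2 * (b' * w')) * x (b * w))))"
    by (simp only: x_F[OF K_mem[OF w] w] mult.assoc)
  also have "x (w ^ 2 * (b' * w')) * x (b * w) = x ((b + b') * (w * w'))"
    unfolding x_add[symmetric]
    by (rule x_cong, rule cong_combination[OF w w', of _ _ "b' * w * w'" "- (b * w)"])
      (simp add: algebra_simps power2_eq_square)
  finally have "K (b + b') t (w * w') * x ((b + b') * (w * w'))
      = (K b' (t * w) w' * K b t w) * x ((b + b') * (w * w'))"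
    by (simp only: group_left_cancel mult.assoc)
  then show ?thesis by (simp only: group_right_cancel)
qed

text \<open>The torus scales \<open>b\<close> by a square and \<open>t\<close> by its inverse, which
  preserves \<open>b * t\<close>. All insensitivity to squares below comes from here.\<close>

lemma K_conjugate:
  assumes "f \<in> F v" "[v * v' = 1] (mod Q)"
  shows "f * K b t w = K (v ^ 2 * b) (v' ^ 2 * t) w * f"
proof -
  note fx = F_x[OF assms(1)] and fy = F_y'[OF assms]
  have fx': "f * (x s * g) = x (v ^ 2 * s) * (f * g)" for s g
    using fx by (simp only: mult.assoc[symmetric])
  have fy': "f * (y s * g) = y (v' ^ 2 * s) * (f * g)" for s g
    using fy by (simp only: mult.assoc[symmetric])
  show ?thesis by (simp add: K_def mult.assoc fx' fy' fx)
qed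

lemma one_mem_F: "1 \<in> F 1"
  using K_mem[of 0 0 1] by (simp add: K_def)

lemma F_nonempty:
  assumes "[u * w = 1] (mod Q)"
  obtains b t where "K b t w \<in> F u" "[(1 + b * t) * w = 1] (mod Q)"
  using that[of 1 "u - 1"] K_mem[of 1 "u - 1" w] assms by simp

lemma F_eq:
  assumes "f \<in> F u" "f' \<in> F u" "[u * w = 1] (mod Q)"
  obtains c where "c \<in> F 1" "f' = f * c"
proof
  have "inverse f * f' \<in> F (w * u)" by (rule F_mult[OF F_inverse[OF assms(1,3)] assms(2)])
  then show "inverse f * f' \<in> F 1" by (rule F_cong) (use assms(3) in \<open>simp add: mult.commute\<close>)
qed simp

text \<open>Conjugation by \<open>f\<close> multiplies the parameters of a word by
  \<open>e ^ 2 = 1\<close>, so it fixes the word; \<open>f'\<close> differs from a word by a central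
  factor.\<close>

lemma involution_commute:
  assumes e: "[e * e = 1] (mod Q)" "f \<in> F e" and u: "[u * w = 1] (mod Q)" "f' \<in> F u"
  shows "f * f' = f' * f"
proof -
  obtain b t where b: "K b t w \<in> F u" "[(1 + b * t) * w = 1] (mod Q)" using F_nonempty[OF u(1)] .
  obtain c where c: "c \<in> F 1" "f' = K b t w * c" using F_eq[OF b(1) u(2) u(1)] .
  have "[e ^ 2 * s = s] (mod Q)" for s
    using cong_scalar_right[OF e(1), of s] by (simp add: power2_eq_square)
  then have "f * K b t w = K b t w * f"
    unfolding K_conjugate[OF e(2,1)] by (intro arg_cong2[where f = "(*)"] K_cong) auto
  then show ?thesis unfolding c(2) by (rule commute_mult'[OF _ F_central[OF c(1) e(2), symmetric]])
qed

lemma F_power: "f \<in> F u \<Longrightarrow> f ^ i \<in> F (u ^ i)"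
  by (induction i) (auto intro: one_mem_F F_mult)

text \<open>Up to a central factor every torus element is a product of one over an involution, which
  commutes by \<open>involution_commute\<close>, and a power of a single element
  \<open>k\<close>.\<close>

lemma F_commute_generated:
  assumes g: "[g * g' = 1] (mod Q)"
    and gen: "\<And>u. coprime u Q \<Longrightarrow> \<exists>e i. [e * e = 1] (mod Q) \<and> [u = e * g ^ i] (mod Q)"
    and u: "coprime u Q" "f \<in> F u" and v: "coprime v Q" "f' \<in> F v"
  shows "f * f' = f' * f"
proof -
  obtain k where k: "k \<in> F g" using F_nonempty[OF g] by blast
  have *: "h * f = f * h" if hf: "h * k = k * h" "h \<in> F v" "coprime v Q" "coprime u Q" "f \<in> F u" for h f u v
  proof -
    obtain v' where v': "[v * v' = 1] (mod Q)" using hf(3) cong_solve_coprime_int by blast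
    obtain u' where u': "[u * u' = 1] (mod Q)" using hf(4) cong_solve_coprime_int by blast
    obtain e i where e: "[e * e = 1] (mod Q)" "[u = e * g ^ i] (mod Q)" using gen[OF hf(4)] by blast
    obtain l where l: "l \<in> F e" using F_nonempty[OF e(1)] by blast
    have "l * k ^ i \<in> F u" by (rule F_cong[OF F_mult[OF l F_power[OF k]] cong_sym[OF e(2)]])
    then obtain c where c: "c \<in> F 1" "f = l * k ^ i * c" using F_eq[OF _ hf(5) u'] by blast
    have 1: "h * k ^ i = k ^ i * h"
    proof (induction i)
      case (Suc i)
      show ?case unfolding power_Suc by (rule commute_mult'[OF hf(1) Suc])
    qed simp
    have 2: "h * l = l * h" using involution_commute[OF e(1) l v' hf(2)] by simp
    have 3: "h * c = c * h" using F_central[OF c(1) hf(2)] by simp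
    show ?thesis unfolding c(2) by (rule commute_mult'[OF commute_mult'[OF 2 1] 3])
  qed
  have "coprime g Q" using g by (metis coprime_iff_invertible_int)
  have "k * f = f * k" by (rule *[OF refl k \<open>coprime g Q\<close> u])
  then show ?thesis using *[OF _ u(2,1) v] by simp
qed

end

section \<open>Torus factors as functions of a unit\<close>

locale torus_system_commute = torus_system +
  assumes F_commute: "coprime u Q \<Longrightarrow> coprime v Q \<Longrightarrow> f \<in> F u \<Longrightarrow> f' \<in> F v \<Longrightarrow> f * f' = f' * f"
begin

definition iv where "iv u = (SOME w. [u * w = 1] (mod Q))"

lemma iv: "coprime u Q \<Longrightarrow> [u * iv u = 1] (mod Q)"
  unfolding iv_def by (rule someI_ex) (rule cong_solve_coprime_int)

lemma iv_unique: "[u * w = 1] (mod Q) \<Longrightarrow> [iv u = w] (mod Q)"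
proof -
  assume w: "[u * w = 1] (mod Q)"
  then have "coprime u Q" by (metis coprime_iff_invertible_int)
  from cong_combination[OF iv[OF this] w, of "iv u" w w "- iv u"]
  show ?thesis by (simp add: algebra_simps)
qed

lemma coprime_inverse: "[u * w = 1] (mod Q) \<Longrightarrow> coprime u Q \<and> coprime w Q"
  by (metis coprime_iff_invertible_int mult.commute)

lemma coprime_iv: "coprime u Q \<Longrightarrow> coprime (iv u) Q"
  using iv coprime_inverse by blast

text \<open>The torus factor with prescribed unit \<open>u = 1 + b * t\<close>, that is,
  \<open>t = (u - 1) / b\<close>. Rigidity for unit \<open>b\<close> means independence of the first
  argument.\<close>

definition h where "h b u = K b ((u - 1) * iv b) (iv u)"

lemma h_eq_K:
  assumes "coprime b Q" "[(1 + b * t) * w = 1] (mod Q)"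
  shows "h b (1 + b * t) = K b t w"
  unfolding h_def
proof (rule K_cong)
  show "[(1 + b * t - 1) * iv b = t] (mod Q)"
    by (rule cong_combination[OF iv[OF assms(1)] cong_refl[of 0], of _ _ t 0]) (simp add: algebra_simps)
qed (simp_all add: iv_unique assms)

lemma h_word:
  assumes "coprime b Q" "coprime u Q"
  shows "[(1 + b * ((u - 1) * iv b)) * iv u = 1] (mod Q)"
  by (rule cong_combination[OF iv[OF assms(1)] iv[OF assms(2)], of _ _ "(u - 1) * iv u" 1])
    (simp add: algebra_simps)

lemma h_mem:
  assumes "coprime b Q" "coprime u Q"
  shows "h b u \<in> F u"
  unfolding h_def
proof (rule F_cong[OF K_mem[OF h_word[OF assms]]])
  show "[1 + b * ((u - 1) * iv b) = u] (mod Q)"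
    by (rule cong_combination[OF iv[OF assms(1)] cong_refl[of 0], of _ _ "u - 1" 0]) (simp add: algebra_simps)
qed

lemma h_commute: "coprime b Q \<Longrightarrow> coprime u Q \<Longrightarrow> coprime c Q \<Longrightarrow> coprime v Q \<Longrightarrow>
    h b u * h c v = h c v * h b u"
  by (rule F_commute[OF _ _ h_mem h_mem])

lemma iv_cong: "[u = v] (mod Q) \<Longrightarrow> coprime v Q \<Longrightarrow> [iv u = iv v] (mod Q)"
  by (rule iv_unique) (metis cong_scalar_right cong_trans iv)

lemma h_cong:
  assumes "[b = c] (mod Q)" "[u = v] (mod Q)" "coprime c Q" "coprime v Q"
  shows "h b u = h c v"
  unfolding h_def by (intro K_cong cong_mult cong_diff iv_cong assms cong_refl)

text \<open>A torus element over \<open>v\<close> commutes with \<open>h b u\<close>, but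
  conjugation by it also multiplies \<open>b\<close> by \<open>v ^ 2\<close>.\<close>

lemma h_square_left:
  assumes "coprime v Q" "coprime b Q" "coprime u Q"
  shows "h (v ^ 2 * b) u = h b u"
proof -
  obtain f where f: "f \<in> F v" using F_nonempty[OF iv[OF assms(1)]] by blast
  have "h b u * f = f * h b u" by (rule F_commute[OF assms(3,1) h_mem[OF assms(2,3)] f])
  also have "\<dots> = K (v ^ 2 * b) ((iv v) ^ 2 * ((u - 1) * iv b)) (iv u) * f"
    unfolding h_def by (rule K_conjugate[OF f iv[OF assms(1)]])
  also have "K (v ^ 2 * b) ((iv v) ^ 2 * ((u - 1) * iv b)) (iv u) = h (v ^ 2 * b) u"
    unfolding h_def
  proof (rule K_cong)
    have "[iv (v ^ 2 * b) = (iv v) ^ 2 * iv b] (mod Q)"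
      by (rule iv_unique, rule cong_combination[OF iv[OF assms(1)] iv[OF assms(2)],
            of _ _ "(v * iv v + 1) * (b * iv b)" 1])
        (simp add: algebra_simps power2_eq_square)
    from cong_scalar_left[OF cong_sym[OF this], of "u - 1"]
    show "[(iv v) ^ 2 * ((u - 1) * iv b) = (u - 1) * iv (v ^ 2 * b)] (mod Q)"
      by (simp add: algebra_simps)
  qed simp_all
  finally show ?thesis by (simp only: group_right_cancel)
qed

text \<open>\<open>K_add_right\<close> after substituting \<open>t = (u - 1) / b\<close>. The change
  of the first argument to \<open>b / u\<close> is what separates \<open>h\<close> from a
  homomorphism in the unit.\<close>

lemma h_mult:
  assumes "coprime b Q" "coprime u Q" "coprime v Q"
  shows "h b (u * v) = h b u * h (b * iv u) v"
proof -
  have i1: "[iv (b * iv u) = u * iv b] (mod Q)"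
    by (rule iv_unique, rule cong_combination[OF iv[OF assms(1)] iv[OF assms(2)],
          of _ _ "u * iv u" 1]) (simp add: algebra_simps)
  have w': "[(1 + b * iv u * ((v - 1) * u * iv b)) * iv v = 1] (mod Q)"
  proof -
    have "[1 + b * iv u * ((v - 1) * u * iv b) = v] (mod Q)"
      by (rule cong_combination[OF iv[OF assms(1)] iv[OF assms(2)], of _ _ "(v - 1) * (u * iv u)" "v - 1"])
        (simp add: algebra_simps)
    from cong_scalar_right[OF this, of "iv v"] iv[OF assms(3)] show ?thesis by (rule cong_trans)
  qed
  have "h b (u * v) = K b ((u - 1) * iv b + (v - 1) * u * iv b) (iv u * iv v)"
    unfolding h_def
  proof (rule K_cong)
    show "[iv (u * v) = iv u * iv v] (mod Q)"
      by (rule iv_unique, rule cong_combination[OF iv[OF assms(2)] iv[OF assms(3)],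
            of _ _ "v * iv v" 1]) (simp add: algebra_simps)
  qed (simp_all add: algebra_simps)
  also have "\<dots> = h b u * K (b * iv u) ((v - 1) * u * iv b) (iv v)"
    unfolding h_def by (rule K_add_right[OF h_word[OF assms(1,2)] w'])
  also have "K (b * iv u) ((v - 1) * u * iv b) (iv v) = h (b * iv u) v"
    unfolding h_def
    by (rule K_cong) (use cong_scalar_left[OF cong_sym[OF i1], of "v - 1"] in \<open>simp_all add: mult.assoc\<close>)
  finally show ?thesis .
qed

text \<open>Expand \<open>h c (u * v ^ 2)\<close> by \<open>h_mult\<close> in both orders, with
  \<open>u = c / b\<close>. The factor with \<open>u\<close> does not see the square that enters its
  first argument, so it cancels.\<close>

lemma h_square_right:
  assumes "coprime b Q" "coprime c Q" "coprime v Q"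
  shows "h b (v ^ 2) = h c (v ^ 2)"
proof -
  define u where "u = c * iv b"
  have u: "coprime u Q" using assms by (simp add: u_def coprime_iv)
  have v2: "coprime (v ^ 2) Q" using assms(3) by simp
  have "h c u * h (c * iv u) (v ^ 2) = h c (u * v ^ 2)" by (simp only: h_mult[OF assms(2) u v2])
  also have "\<dots> = h c (v ^ 2) * h (c * iv (v ^ 2)) u"
    by (simp only: h_mult[OF assms(2) v2 u] mult.commute[of u])
  also have "h (c * iv (v ^ 2)) u = h ((iv v) ^ 2 * c) u"
  proof (rule h_cong)
    have "[iv (v ^ 2) = (iv v) ^ 2] (mod Q)"
      by (rule iv_unique, rule cong_combination[OF iv[OF assms(3)] cong_refl[of 0], of _ _ "v * iv v + 1" 0])
        (simp add: algebra_simps power2_eq_square)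
    from cong_scalar_left[OF this, of c] show "[c * iv (v ^ 2) = (iv v) ^ 2 * c] (mod Q)"
      by (simp add: mult.commute)
  qed (use assms u in \<open>simp_all add: coprime_iv\<close>)
  also have "\<dots> = h c u" by (rule h_square_left) (use assms u in \<open>simp_all add: coprime_iv\<close>)
  also have "h c (v ^ 2) * h c u = h c u * h c (v ^ 2)" by (rule h_commute[OF assms(2) v2 assms(2) u])
  finally have "h (c * iv u) (v ^ 2) = h c (v ^ 2)" by (simp only: group_left_cancel)
  moreover have "h (c * iv u) (v ^ 2) = h b (v ^ 2)"
  proof (rule h_cong)
    have "[iv u = b * iv c] (mod Q)"
      unfolding u_def by (rule iv_unique, rule cong_combination[OF iv[OF assms(1)] iv[OF assms(2)],
          of _ _ "c * iv c" 1]) (simp add: algebra_simps)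
    then have "[c * iv u = c * (b * iv c)] (mod Q)" by (rule cong_scalar_left)
    also have "[c * (b * iv c) = b] (mod Q)"
      by (rule cong_combination[OF iv[OF assms(2)] cong_refl[of 0], of _ _ b 0]) (simp add: algebra_simps)
    finally show "[c * iv u = b] (mod Q)" .
  qed (use assms v2 in simp_all)
  ultimately show ?thesis by simp
qed

definition unit_rigid where
  "unit_rigid \<longleftrightarrow> (\<forall>b u. coprime b Q \<longrightarrow> coprime u Q \<longrightarrow> h b u = h 1 u)"

text \<open>Squares can be stripped off both arguments, so it is enough to check pairs of
  representatives of the units modulo squares.\<close>

lemma unit_rigidI:
  assumes "\<And>u. coprime u Q \<Longrightarrow> \<exists>\<rho> v. \<rho> \<in> R \<and> coprime \<rho> Q \<and> coprime v Q \<and> [u = \<rho> * v ^ 2] (mod Q)"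
    and "\<And>\<rho> \<beta>. \<rho> \<in> R \<Longrightarrow> \<beta> \<in> R \<Longrightarrow> coprime \<rho> Q \<Longrightarrow> coprime \<beta> Q \<Longrightarrow> h \<beta> \<rho> = h 1 \<rho>"
  shows unit_rigid
  unfolding unit_rigid_def
proof (intro allI impI)
  fix b u assume b: "coprime b Q" and u: "coprime u Q"
  obtain \<rho> v where \<rho>: "\<rho> \<in> R" "coprime \<rho> Q" "coprime v Q" "[u = \<rho> * v ^ 2] (mod Q)"
    using assms(1)[OF u] by blast
  obtain \<beta> s where \<beta>: "\<beta> \<in> R" "coprime \<beta> Q" "coprime s Q" "[b = \<beta> * s ^ 2] (mod Q)"
    using assms(1)[OF b] by blast
  have v2: "coprime (v ^ 2) Q" using \<rho> by simp
  have "h c u = h c \<rho> * h 1 (v ^ 2)" if "coprime c Q" for c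
  proof -
    have "h c u = h c (\<rho> * v ^ 2)" by (rule h_cong) (use that \<rho> in simp_all)
    also have "\<dots> = h c \<rho> * h (c * iv \<rho>) (v ^ 2)" by (rule h_mult[OF that \<rho>(2) v2])
    also have "h (c * iv \<rho>) (v ^ 2) = h 1 (v ^ 2)"
      by (rule h_square_right) (use that \<rho> in \<open>simp_all add: coprime_iv\<close>)
    finally show ?thesis .
  qed
  moreover have "h b \<rho> = h 1 \<rho>"
  proof -
    have "h b \<rho> = h (s ^ 2 * \<beta>) \<rho>" by (rule h_cong) (use \<beta> \<rho> in \<open>simp_all add: mult.commute\<close>)
    also have "\<dots> = h \<beta> \<rho>" by (rule h_square_left) (use \<beta> \<rho> in simp_all)
    also have "\<dots> = h 1 \<rho>" by (rule assms(2)) (use \<beta> \<rho> in simp_all)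
    finally show ?thesis .
  qed
  ultimately show "h b u = h 1 u" using b by simp
qed

end

section \<open>Quadratic residues and generators of unit groups\<close>

lemma Legendre_values: "Legendre a p \<in> {-1, 0, 1}"
  by (simp add: Legendre_def)

lemma Legendre_eq_0_iff: "Legendre a p = 0 \<longleftrightarrow> p dvd a"
  by (simp add: Legendre_def cong_0_iff)

lemma Legendre_cong:
  assumes "[a = b] (mod p)"
  shows "Legendre a p = Legendre b p"
proof -
  have "[a = 0] (mod p) \<longleftrightarrow> [b = 0] (mod p)" using assms by (auto simp: cong_def)
  moreover have "[y ^ 2 = a] (mod p) \<longleftrightarrow> [y ^ 2 = b] (mod p)" for y
    using assms by (auto simp: cong_def)
  ultimately show ?thesis by (simp add: Legendre_def QuadRes_def)
qed

text \<open>Euler's criterion gives the identity modulo \<open>q\<close>; both sides are at most 1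
  in absolute value and \<open>q\<close> exceeds 2.\<close>

lemma Legendre_mult:
  assumes "prime q" "2 < q"
  shows "Legendre (a * b) (int q) = Legendre a (int q) * Legendre b (int q)"
proof -
  have "[Legendre a (int q) * Legendre b (int q)
      = a ^ ((q - 1) div 2) * b ^ ((q - 1) div 2)] (mod int q)"
    by (rule cong_mult[OF euler_criterion[OF assms] euler_criterion[OF assms]])
  moreover have "[Legendre (a * b) (int q) = (a * b) ^ ((q - 1) div 2)] (mod int q)"
    by (rule euler_criterion[OF assms])
  ultimately have "[Legendre (a * b) (int q) = Legendre a (int q) * Legendre b (int q)] (mod int q)"
    by (simp only: power_mult_distrib cong_def)
  then have dvd: "int q dvd Legendre (a * b) (int q) - Legendre a (int q) * Legendre b (int q)"
    by (simp add: cong_iff_dvd_diff)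
  have "\<bar>Legendre (a * b) (int q) - Legendre a (int q) * Legendre b (int q)\<bar> \<le> 2"
    using Legendre_values[of "a * b" "int q"] Legendre_values[of a "int q"] Legendre_values[of b "int q"]
    by auto
  then have "\<bar>Legendre (a * b) (int q) - Legendre a (int q) * Legendre b (int q)\<bar> < int q"
    using assms(2) by linarith
  with dvd have "Legendre (a * b) (int q) - Legendre a (int q) * Legendre b (int q) = 0"
    by (metis abs_of_nat dvd_imp_le_int not_le)
  then show ?thesis by simp
qed

lemma Legendre_square:
  assumes "coprime v p" "\<not> is_unit p"
  shows "Legendre (v ^ 2) p = 1"
proof -
  have "\<not> p dvd v ^ 2"
  proof
    assume "p dvd v ^ 2"
    then have "is_unit p" using assms(1) by (intro coprime_common_divisor[of "v ^ 2" p]) simp_all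
    then show False using assms(2) by simp
  qed
  then show ?thesis unfolding Legendre_def QuadRes_def cong_0_iff by (auto intro: cong_refl)
qed

lemma Legendre_minus_1_cases:
  assumes "prime q" "2 < q"
  shows "Legendre (-1) (int q) = 1 \<or> Legendre (-1) (int q) = -1"
  using Legendre_values[of "-1" "int q"] Legendre_eq_0_iff[of "-1" "int q"] assms by auto

text \<open>A primitive root is a nonresidue by Euler's criterion.\<close>

lemma nonresidue_exists:
  assumes "prime q" "2 < q"
  obtains n where "n > 0" "Legendre (int n) (int q) = -1"
proof -
  obtain g where g: "residue_primroot q g" using prime_primitive_root_exists[OF _ assms(1)] assms(2) by auto
  have o: "ord q g = q - 1" using g assms(1) by (simp add: residue_primroot_def totient_prime)
  have q: "0 < (q - 1) div 2" "(q - 1) div 2 < q - 1" using assms(2) by auto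
  have "\<not> [g ^ ((q - 1) div 2) = 1] (mod q)"
    unfolding ord_divides o using q nat_dvd_not_less by blast
  then have "\<not> [int (g ^ ((q - 1) div 2)) = int 1] (mod int q)" by (simp only: cong_int_iff not_False_eq_True)
  then have "Legendre (int g) (int q) \<noteq> 1"
    using euler_criterion[OF assms, of "int g"] by (auto dest: cong_sym)
  moreover have "coprime q g" using g by (simp add: residue_primroot_def)
  then have "\<not> int q dvd int g"
    using assms coprime_common_divisor[of q g q] by (auto simp: int_dvd_int_iff)
  ultimately have "Legendre (int g) (int q) = -1"
    using Legendre_values[of "int g" "int q"] Legendre_eq_0_iff[of "int g" "int q"] by auto
  moreover have "g > 0" using \<open>\<not> int q dvd int g\<close> by (cases "g = 0") auto
  ultimately show ?thesis using that by blast
qed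

text \<open>The least nonresidue gives \<open>u\<close>. For \<open>u'\<close>: if \<open>-1\<close> is a residue, take \<open>1/u\<close>; otherwise two
  consecutive residues exist among \<open>1, 2\<close>, \<open>4, 5\<close>, \<open>9, 10\<close> and one changes signs.\<close>

lemma nonresidue_pattern:
  assumes "prime q" "5 \<le> q"
  obtains u u' where "Legendre u (int q) = -1" "Legendre (u - 1) (int q) = 1"
    "Legendre u' (int q) = -1" "Legendre (u' - 1) (int q) = -1"
proof -
  let ?L = "\<lambda>a. Legendre a (int q)"
  have q: "prime q" "2 < q" using assms by auto
  have L1: "?L (v ^ 2) = 1" if "\<not> int q dvd v" for v
    using that Legendre_square[of v "int q"] q prime_imp_coprime[of "int q" v]
    by (simp add: coprime_commute)
  have small: "\<not> int q dvd v" if "0 < v" "v < int q" for v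
    using that zdvd_not_zless by blast
  have one: "?L 1 = 1" using L1[of 1] q by simp
  define n where "n = (LEAST n. n > 0 \<and> ?L (int n) = -1)"
  have n: "n > 0 \<and> ?L (int n) = -1"
    unfolding n_def by (rule LeastI_ex) (use nonresidue_exists[OF q] in blast)
  then have "n \<noteq> 1" using one by auto
  then have n2: "n \<ge> 2" using n by simp
  have "\<not> (n - 1 > 0 \<and> ?L (int (n - 1)) = -1)"
    using not_less_Least[of "n - 1" "\<lambda>n. n > 0 \<and> ?L (int n) = -1"] n2 unfolding n_def[symmetric] by simp
  then have "?L (int (n - 1)) \<noteq> -1" using n2 by simp
  moreover have "\<not> int q dvd int (n - 1)"
  proof
    assume "int q dvd int (n - 1)"
    then have "[int n = 1] (mod int q)" using n2 by (simp add: cong_iff_dvd_diff of_nat_diff)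
    from Legendre_cong[OF this] n one show False by simp
  qed
  ultimately have un: "?L (int n) = -1" "?L (int n - 1) = 1"
    using n n2 Legendre_values[of "int (n - 1)" "int q"] Legendre_eq_0_iff[of "int (n - 1)" "int q"]
    by (auto simp: of_nat_diff)
  have "\<exists>u'. ?L u' = -1 \<and> ?L (u' - 1) = -1"
  proof (cases "?L (-1) = 1")
    case True
    have "\<not> int q dvd int n" using n Legendre_eq_0_iff[of "int n" "int q"] by simp
    then have "coprime (int n) (int q)" using q prime_imp_coprime[of "int q" "int n"]
      by (simp add: coprime_commute)
    then obtain v where v: "[int n * v = 1] (mod int q)" using cong_solve_coprime_int by blast
    have "?L (int n) * ?L v = 1" using Legendre_cong[OF v] one by (simp add: Legendre_mult[OF q])
    then have v1: "?L v = -1" using un by simp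
    have "[int n * (v - 1) = - 1 * (int n - 1)] (mod int q)"
      using v by (simp add: cong_iff_dvd_diff algebra_simps)
    from Legendre_cong[OF this] have "?L (int n) * ?L (v - 1) = ?L (-1) * ?L (int n - 1)"
      by (simp only: Legendre_mult[OF q])
    then have "?L (v - 1) = -1" using un True by simp
    then show ?thesis using v1 by blast
  next
    case False
    then have m: "?L (-1) = -1" using Legendre_minus_1_cases[OF q] by simp
    have "q \<noteq> 5"
    proof
      assume "q = 5"
      then have "[2 ^ 2 = -1] (mod int q)" by (simp add: cong_iff_dvd_diff)
      then have "?L (2 ^ 2) = ?L (-1)" by (rule Legendre_cong)
      then show False using L1[of 2] small[of 2] q m by simp
    qed
    moreover have "q \<noteq> 6" using prime_odd_nat[of q] q by auto
    ultimately have q7: "q \<ge> 7" using assms(2) by linarith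
    have "?L (2 ^ 2) = 1" "?L (3 ^ 2) = 1" using q7 by (intro L1 small; simp)+
    then have sq: "?L 4 = 1" "?L 9 = 1" by simp_all
    have nz: "?L 2 \<noteq> 0" "?L 5 \<noteq> 0" using small[of 2] small[of 5] q7 by (simp_all add: Legendre_eq_0_iff)
    have "?L (2 * 5) = ?L 2 * ?L 5" by (rule Legendre_mult[OF q])
    then have "\<exists>r. ?L r = 1 \<and> ?L (r + 1) = 1"
      using one sq nz Legendre_values[of 2 "int q"] Legendre_values[of 5 "int q"]
      by (intro exI[of _ "if ?L 2 = 1 then 1 else if ?L 5 = 1 then 4 else 9"]) auto
    then obtain r where r: "?L r = 1" "?L (r + 1) = 1" by blast
    have "?L (- 1 * r) = -1" "?L (- 1 * (r + 1)) = -1"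
      unfolding Legendre_mult[OF q] r m by simp_all
    moreover have "- 1 * (r + 1) = - 1 * r - 1" by simp
    ultimately have "?L (- 1 * r) = -1 \<and> ?L (- 1 * r - 1) = -1" by (simp only: conj_absorb)
    then show ?thesis ..
  qed
  then obtain u' where "?L u' = -1" "?L (u' - 1) = -1" by blast
  then show ?thesis by (rule that[OF un])
qed

lemma square_lift:
  fixes q u s :: int
  assumes q: "prime q" "odd q" and "coprime u q" "[s ^ 2 = u] (mod q)"
  shows "\<exists>v. coprime v q \<and> [u = v ^ 2] (mod q ^ n)"
proof (induction n)
  case 0
  have "coprime (s ^ 2) q" using assms(3) cong_imp_coprime[OF cong_sym[OF assms(4)]] by simp
  then show ?case by (intro exI[of _ s]) simp
next
  case (Suc n)
  show ?case
  proof (cases "n = 0")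
    case True
    have "coprime (s ^ 2) q" using assms(3) cong_imp_coprime[OF cong_sym[OF assms(4)]] by simp
    then show ?thesis using True assms(4) by (intro exI[of _ s]) (simp add: cong_sym)
  next
    case False
    obtain v where v: "coprime v q" "[u = v ^ 2] (mod q ^ n)" using Suc by blast
    obtain k where k: "u = v ^ 2 + q ^ n * k"
      using v(2) by (auto simp: cong_iff_dvd_diff dvd_def algebra_simps)
    have "coprime (2 * v) q" using q v(1) by (simp add: coprime_commute prime_imp_coprime)
    then obtain w where w: "[2 * v * w = 1] (mod q)" using cong_solve_coprime_int by blast
    then obtain j where j: "2 * v * w = 1 + q * j"
      by (auto simp: cong_iff_dvd_diff dvd_def algebra_simps)
    \<comment> \<open>Newton step: \<open>k = (u - v ^ 2) / q ^ n\<close>, and \<open>w\<close>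
      inverts \<open>2 * v\<close> modulo \<open>q\<close>.\<close>
    define v' where "v' = v + q ^ n * (w * k)"
    obtain n' where n': "n = Suc n'" using False not0_implies_Suc by blast
    have "v' ^ 2 = v ^ 2 + q ^ n * k * (2 * v * w) + q ^ n * q ^ n * (w * k) ^ 2"
      by (simp add: v'_def power2_eq_square algebra_simps)
    also have "\<dots> = u + q ^ Suc n * (k * j + q ^ n' * (w * k) ^ 2)"
      unfolding j k by (simp add: n' algebra_simps)
    finally have "[v' ^ 2 = u] (mod q ^ Suc n)" by (simp add: cong_iff_dvd_diff)
    moreover have "coprime v' q"
    proof -
      have "[v' = v] (mod q)" by (simp add: v'_def n' cong_iff_dvd_diff)
      then show ?thesis using v(1) by (metis cong_imp_coprime cong_sym)
    qed
    ultimately show ?thesis by (meson cong_sym)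
  qed
qed

lemma Legendre_1_square:
  assumes "prime q" "2 < q" "Legendre u (int q) = 1"
  shows "\<exists>v. coprime v (int q ^ n) \<and> [u = v ^ 2] (mod int q ^ n)"
proof -
  have "\<not> int q dvd u" using assms(3) Legendre_eq_0_iff[of u "int q"] by simp
  then have "coprime u (int q)"
    using assms(1) prime_imp_coprime[of "int q" u] by (simp add: coprime_commute)
  moreover obtain s where "[s ^ 2 = u] (mod int q)"
    using assms(3) by (auto simp: Legendre_def QuadRes_def split: if_splits)
  moreover have "odd (int q)" using assms prime_odd_nat by auto
  ultimately obtain v where "coprime v (int q)" "[u = v ^ 2] (mod int q ^ n)"
    using square_lift[of "int q" u s n] assms(1) by auto
  then show ?thesis by (intro exI[of _ v]) simp
qed

lemma odd_prime_power_generator: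
  assumes "prime q" "2 < q"
  obtains g g' :: int where "[g * g' = 1] (mod int q ^ n)"
    "\<And>u. coprime u (int q ^ n) \<Longrightarrow> \<exists>i. [u = g ^ i] (mod int q ^ n)"
proof (cases "n = 0")
  case True
  then show ?thesis using that[of 1 1] by simp
next
  case False
  define m where "m = q ^ n"
  have "odd q" using assms prime_odd_nat by blast
  then obtain g where g: "residue_primroot m g"
    using residue_primroot_odd_prime_power_exists[OF assms(1)] False unfolding m_def by blast
  have m1: "m > 1" using False assms(2) unfolding m_def by (intro one_less_power) simp_all
  have m: "int m = int q ^ n" by (simp add: m_def)
  have "coprime (int g) (int m)" using g by (simp add: residue_primroot_def coprime_commute)
  then obtain g' where g': "[int g * g' = 1] (mod int m)" using cong_solve_coprime_int by blast
  have "\<exists>i. [u = int g ^ i] (mod int m)" if u: "coprime u (int m)" for u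
  proof -
    define t where "t = nat (u mod int m)"
    have t: "int t = u mod int m" using m1 by (simp add: t_def)
    have "coprime (u mod int m) (int m)" using u m1 by (subst coprime_mod_left_iff) auto
    then have ct: "coprime t m" by (simp flip: t)
    have "int t < int m" unfolding t by (rule pos_mod_bound) (use m1 in simp)
    then have "t < m" by simp
    moreover have "t \<noteq> 0" using ct m1 by (cases "t = 0") auto
    ultimately have "t \<in> totatives m" using ct by (simp add: totatives_def)
    then obtain i where "t = g ^ i mod m"
      using residue_primroot_is_generator[OF m1 g] by (auto simp: bij_betw_def image_def)
    then have "[t = g ^ i] (mod m)" by (simp add: cong_def)
    then have "[int t = int (g ^ i)] (mod int m)" by (simp only: cong_int_iff)
    then have "[u mod int m = int g ^ i] (mod int m)" by (simp add: t)
    then show ?thesis by (auto simp: cong_def)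
  qed
  then show ?thesis using that g' unfolding m by blast
qed

text \<open>The exact power of 2 matters in \<open>two_power_generator\<close>: multiplying an odd
  residue by this power of 3 flips precisely its next binary digit.\<close>

lemma three_power: "\<exists>c::int. 3 ^ (2 ^ (k + 1)) = 1 + 2 ^ (k + 3) * c \<and> odd c"
proof (induction k)
  case 0
  show ?case by (intro exI[of _ 1]) simp
next
  case (Suc k)
  then obtain c :: int where c: "3 ^ (2 ^ (k + 1)) = 1 + 2 ^ (k + 3) * c" "odd c" by blast
  have "(3::int) ^ (2 ^ (Suc k + 1)) = (3 ^ (2 ^ (k + 1))) ^ 2"
    by (simp add: power_mult [symmetric] mult.commute)
  also have "\<dots> = 1 + 2 ^ (Suc k + 3) * (c + 2 ^ (k + 2) * c ^ 2)"
    unfolding c by (simp add: power2_eq_square power_add algebra_simps)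
  finally show ?case using c(2) by (intro exI[of _ "c + 2 ^ (k + 2) * c ^ 2"]) simp
qed

lemma two_power_generator:
  fixes u :: int
  assumes "odd u"
  shows "\<exists>e i. e \<in> {1, -1} \<and> [u = e * 3 ^ i] (mod 2 ^ n)"
proof -
  have "\<exists>e i. e \<in> {1, -1} \<and> [u = e * 3 ^ i] (mod 2 ^ (n + 3))" for n
  proof (induction n)
    case 0
    have "u mod 8 = 1 \<or> u mod 8 = 3 \<or> u mod 8 = 5 \<or> u mod 8 = 7" using assms by presburger
    then have "[u = 1 * 3 ^ 0] (mod 8) \<or> [u = 1 * 3 ^ 1] (mod 8) \<or> [u = -1 * 3 ^ 1] (mod 8) \<or> [u = -1 * 3 ^ 0] (mod 8)"
      by (auto simp: cong_def)
    then show ?case by (simp, blast)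
  next
    case (Suc n)
    then obtain e i where e: "e \<in> {1, -1}" "[u = e * 3 ^ i] (mod 2 ^ (n + 3))" by blast
    obtain k where k: "u = e * 3 ^ i + 2 ^ (n + 3) * k"
      using e(2) by (auto simp: cong_iff_dvd_diff dvd_def algebra_simps)
    obtain c :: int where c: "3 ^ (2 ^ (n + 1)) = 1 + 2 ^ (n + 3) * c" "odd c" using three_power by blast
    have even: "2 ^ (Suc n + 3) dvd 2 ^ (n + 3) * j" if "even j" for j :: int
    proof -
      have "(2::int) ^ (Suc n + 3) = 2 ^ (n + 3) * 2" by (simp add: power_add)
      then show ?thesis using that by (simp only: mult_dvd_mono dvd_refl)
    qed
    show ?case
    proof (cases "even k")
      case True
      then show ?thesis using e(1) k even
        by (intro exI[of _ e] exI[of _ i]) (simp add: cong_iff_dvd_diff)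
    next
      case False
      have "u - e * 3 ^ (i + 2 ^ (n + 1)) = 2 ^ (n + 3) * (k - e * 3 ^ i * c)"
        unfolding power_add[of 3 i] c k by (simp add: algebra_simps)
      moreover have "even (k - e * 3 ^ i * c)" using False c(2) e(1) by auto
      ultimately have "2 ^ (Suc n + 3) dvd u - e * 3 ^ (i + 2 ^ (n + 1))"
        using even by metis
      then show ?thesis using e(1) unfolding cong_iff_dvd_diff by blast
    qed
  qed
  then obtain e i where e: "e \<in> {1, -1}" "[u = e * 3 ^ i] (mod 2 ^ (n + 3))" by blast
  have "[u = e * 3 ^ i] (mod 2 ^ n)"
    by (rule cong_dvd_modulus[OF e(2)]) (simp add: le_imp_power_dvd)
  then show ?thesis using e(1) by blast
qed

section \<open>Rigidity modulo prime powers\<close>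

lemma coprime_prime_power_iff:
  assumes "prime q" "n > 0"
  shows "coprime u (int q ^ n) \<longleftrightarrow> \<not> int q dvd u"
  using assms prime_imp_coprime[of "int q" u] not_coprimeI[of "int q" u "int q"]
  by (auto simp: coprime_commute)

text \<open>The four values represent the odd residues up to squares modulo any power of 2, and each
  is its own inverse modulo 8.\<close>

lemma odd_mod_8:
  fixes u :: int
  assumes "odd u"
  obtains \<rho> where "\<rho> \<in> {1, 3, -3, -1}" "(u * \<rho>) mod 8 = 1"
proof -
  have *: "(u * \<rho>) mod 8 = (u mod 8 * \<rho>) mod 8" for \<rho> by (simp add: mod_mult_left_eq)
  have "u mod 8 = 1 \<or> u mod 8 = 3 \<or> u mod 8 = 5 \<or> u mod 8 = 7" using assms by presburger
  then show ?thesis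
    using *[of 1] *[of 3] *[of "-3"] *[of "-1"] that[of 1] that[of 3] that[of "-3"] that[of "-1"]
    by (elim disjE) simp_all
qed

context torus_system_commute
begin

lemma coprime_cong: "[u = v] (mod Q) \<Longrightarrow> coprime u Q \<longleftrightarrow> coprime v Q"
  by (metis cong_imp_coprime cong_sym)

lemma unit_rigidD: "unit_rigid \<Longrightarrow> coprime b Q \<Longrightarrow> coprime u Q \<Longrightarrow> h b u = h 1 u"
  unfolding unit_rigid_def by blast

lemma h_hom:
  assumes unit_rigid "coprime u Q" "coprime v Q"
  shows "h 1 (u * v) = h 1 u * h 1 v"
  using h_mult[of 1 u v] unit_rigidD[OF assms(1), of "iv u" v] assms by (simp add: coprime_iv)

text \<open>When \<open>b\<close> itself is not a unit it can still be a sum of two units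
  \<open>c\<close> and \<open>b - c\<close>; \<open>K_add_left\<close> then leaves two factors
  covered by \<open>unit_rigid\<close>.\<close>

lemma K_split:
  assumes unit_rigid and w: "[(1 + b * t) * w = 1] (mod Q)"
    and "coprime c Q" "coprime (b - c) Q" "coprime (1 + c * t) Q"
  shows "K b t w = h 1 (1 + b * t)"
proof -
  define w1 where "w1 = iv (1 + c * t)"
  have w1: "[(1 + c * t) * w1 = 1] (mod Q)" unfolding w1_def by (rule iv[OF assms(5)])
  define w2 where "w2 = w * (1 + c * t)"
  have w2: "[(1 + (b - c) * (t * w1)) * w2 = 1] (mod Q)"
    unfolding w2_def
    by (rule cong_combination[OF w1 w, of _ _ "b * t * w - c * t * w" 1]) (simp add: algebra_simps)
  have u2: "coprime (1 + (b - c) * (t * w1)) Q" using coprime_inverse[OF w2] by simp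
  have "[w1 * w2 = w] (mod Q)"
    unfolding w2_def
    by (rule cong_combination[OF w1 cong_refl[of 0], of _ _ w 0]) (simp add: algebra_simps)
  then have "K b t w = K (c + (b - c)) t (w1 * w2)"
    by (intro K_cong) (simp_all add: cong_sym)
  also have "\<dots> = K (b - c) (t * w1) w2 * K c t w1" by (rule K_add_left[OF w1 w2])
  also have "K (b - c) (t * w1) w2 = h 1 (1 + (b - c) * (t * w1))"
    using h_eq_K[OF assms(4) w2] unit_rigidD[OF assms(1,4) u2] by simp
  also have "K c t w1 = h 1 (1 + c * t)"
    using h_eq_K[OF assms(3) w1] unit_rigidD[OF assms(1,3,5)] by simp
  also have "h 1 (1 + (b - c) * (t * w1)) * h 1 (1 + c * t)
      = h 1 ((1 + (b - c) * (t * w1)) * (1 + c * t))"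
    by (rule h_hom[OF assms(1) u2 assms(5), symmetric])
  also have "\<dots> = h 1 (1 + b * t)"
  proof (rule h_cong[OF cong_refl])
    show "[(1 + (b - c) * (t * w1)) * (1 + c * t) = 1 + b * t] (mod Q)"
      by (rule cong_combination[OF w1 cong_refl[of 0], of _ _ "b * t - c * t" 0])
        (simp add: algebra_simps)
  qed (use coprime_inverse[OF w] in simp_all)
  finally show ?thesis .
qed

lemma K_unit:
  assumes unit_rigid "[(1 + b * t) * w = 1] (mod Q)" "coprime b Q"
  shows "K b t w = h 1 (1 + b * t)"
  using h_eq_K[OF assms(3,2)] unit_rigidD[OF assms(1,3)] coprime_inverse[OF assms(2)] by simp

lemma rigidI:
  assumes "\<And>b t w. [(1 + b * t) * w = 1] (mod Q) \<Longrightarrow> K b t w = h 1 (1 + b * t)"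
  shows rigid
  unfolding rigid_def
proof (intro allI impI)
  fix b t b' t' w assume w: "[(1 + b * t) * w = 1] (mod Q)" and bt: "[b * t = b' * t'] (mod Q)"
  have eq: "[1 + b' * t' = 1 + b * t] (mod Q)" by (rule cong_add[OF cong_refl cong_sym[OF bt]])
  from cong_trans[OF cong_scalar_right[OF eq] w] have w': "[(1 + b' * t') * w = 1] (mod Q)" .
  have "h 1 (1 + b' * t') = h 1 (1 + b * t)"
    by (rule h_cong) (use eq coprime_inverse[OF w] in simp_all)
  then show "K b t w = K b' t' w" using assms[OF w] assms[OF w'] by simp
qed

lemma rigid_odd_prime_power:
  assumes unit_rigid "prime q" "2 < q" "Q = int q ^ n" "n > 0"
  shows rigid
proof (rule rigidI)
  fix b t w assume w: "[(1 + b * t) * w = 1] (mod Q)"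
  have Q: "coprime u Q \<longleftrightarrow> \<not> int q dvd u" for u
    using assms(2,4,5) by (simp add: coprime_prime_power_iff del: coprime_power_right_iff)
  show "K b t w = h 1 (1 + b * t)"
  proof (cases "coprime b Q")
    case True
    then show ?thesis by (rule K_unit[OF assms(1) w])
  next
    case False
    then have qb: "int q dvd b" by (simp add: Q)
    \<comment> \<open>At least one of \<open>1 + t\<close> and \<open>1 - t\<close> is a unit
      because \<open>q > 2\<close>, and \<open>b - c\<close> is a unit because \<open>q\<close>
      divides \<open>b\<close>.\<close>
    define c :: int where "c = (if int q dvd 1 + t then -1 else 1)"
    have c1: "\<not> int q dvd c" using assms(3) by (simp add: c_def)
    have "\<not> int q dvd 1 + c * t"
    proof (cases "int q dvd 1 + t")
      case True
      have "\<not> int q dvd 1 - t"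
      proof
        assume "int q dvd 1 - t"
        from dvd_add[OF this True] have "int q dvd 2" by simp
        then show False using assms(3) zdvd_not_zless[of 2 "int q"] by simp
      qed
      then show ?thesis using True by (simp add: c_def)
    qed (simp add: c_def)
    moreover have "\<not> int q dvd b - c" using qb c1 dvd_diff_right_iff[OF qb] by simp
    ultimately show ?thesis using K_split[OF assms(1) w] c1 by (simp add: Q)
  qed
qed

text \<open>With \<open>v = s ^ 2\<close> and \<open>b = (v - 1) * u / (u - 1)\<close> one has
  \<open>1 + b = (u * v - 1) / (u - 1)\<close>, and \<open>K (1 + b) (u - 1)\<close> belongs to the
  unit \<open>u * v\<close>. By \<open>h_mult\<close> it is \<open>h (1 + b) u\<close> times a
  factor of the square \<open>v\<close>; splitting the first argument as \<open>1 + b\<close>, it is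
  \<open>h 1 u\<close> up to such a factor. The square factors agree by
  \<open>h_square_right\<close> and cancel.\<close>

lemma h_ratio:
  assumes "coprime u Q" "coprime s Q" "coprime (u - 1) Q" "coprime (s ^ 2 - 1) Q" "coprime (u * s ^ 2 - 1) Q"
  shows "h ((u * s ^ 2 - 1) * iv (u - 1)) u = h 1 u"
proof -
  define v r w w' where "v = s ^ 2" and "r = iv (u - 1)" and "w = iv u" and "w' = iv v"
  have v: "coprime v Q" "coprime (v - 1) Q" "coprime (u * v - 1) Q" using assms by (simp_all add: v_def)
  have r: "[(u - 1) * r = 1] (mod Q)" unfolding r_def by (rule iv[OF assms(3)])
  have w: "[u * w = 1] (mod Q)" unfolding w_def by (rule iv[OF assms(1)])
  have w': "[v * w' = 1] (mod Q)" unfolding w'_def by (rule iv[OF v(1)])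
  have rw: "coprime r Q" "coprime w Q" using coprime_inverse[OF r] coprime_inverse[OF w] by simp_all
  define b where "b = (v - 1) * u * r"
  have b: "coprime b Q" using v rw assms(1) by (simp add: b_def)
  have e1: "[1 + b * ((u - 1) * w) = v] (mod Q)"
    unfolding b_def by (rule cong_combination[OF r w, of _ _ "- u * w + u * v * w" "- 1 + v"])
      (simp add: algebra_simps)
  from cong_trans[OF cong_scalar_right[OF e1] w'] have 1: "[(1 + b * ((u - 1) * w)) * w' = 1] (mod Q)" .
  have e2: "[1 + (1 + b) * (u - 1) = u * v] (mod Q)"
    unfolding b_def by (rule cong_combination[OF r w, of _ _ "- u + u * v" 0])
      (simp add: algebra_simps)
  have ww: "[(u * v) * (w * w') = 1] (mod Q)"
    by (rule cong_combination[OF w w', of _ _ "v * w'" 1]) (simp add: algebra_simps)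
  from cong_trans[OF cong_scalar_right[OF e2] ww] have 2: "[(1 + (1 + b) * (u - 1)) * (w * w') = 1] (mod Q)" .
  have e3: "[1 + b = (u * v - 1) * r] (mod Q)"
    unfolding b_def by (rule cong_combination[OF r w, of _ _ "- 1" 0]) (simp add: algebra_simps)
  have c: "coprime (1 + b) Q" using e3 v(3) rw by (simp add: coprime_cong)
  have "h (1 + b) u * h 1 v = h (1 + b) u * h ((1 + b) * w) v"
    using h_square_right[of 1 "(1 + b) * w" s] c rw assms(2) by (simp add: v_def)
  also have "\<dots> = h (1 + b) (u * v)" unfolding w_def by (rule h_mult[OF c assms(1) v(1), symmetric])
  also have "\<dots> = h (1 + b) (1 + (1 + b) * (u - 1))"
    using e2 c assms(1) v(1) by (intro h_cong) (simp_all add: cong_sym coprime_cong)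
  also have "\<dots> = K (1 + b) (u - 1) (w * w')" by (rule h_eq_K[OF c 2])
  also have "\<dots> = K b ((u - 1) * w) w' * K 1 (u - 1) w"
    by (rule K_add_left[OF _ 1]) (use w in simp)
  also have "K 1 (u - 1) w = h 1 u" using h_eq_K[of 1 "u - 1" w] w by simp
  also have "K b ((u - 1) * w) w' = h b (1 + b * ((u - 1) * w))" by (rule h_eq_K[OF b 1, symmetric])
  also have "\<dots> = h b v" by (rule h_cong[OF cong_refl e1 b v(1)])
  also have "\<dots> = h 1 v" unfolding v_def by (rule h_square_right[OF b _ assms(2)]) simp
  also have "h 1 v * h 1 u = h 1 u * h 1 v" by (rule h_commute) (use v assms in simp_all)
  finally have "h (1 + b) u = h 1 u" by (simp only: group_right_cancel)
  moreover have "h (1 + b) u = h ((u * s ^ 2 - 1) * iv (u - 1)) u"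
    by (rule h_cong[OF e3[unfolded v_def r_def] cong_refl]) (use assms in \<open>simp_all add: coprime_iv\<close>)
  ultimately show ?thesis by simp
qed

lemma same_Legendre_square:
  assumes "prime q" "2 < q" "Q = int q ^ n" "n > 0"
    and "Legendre u (int q) = Legendre v (int q)" "coprime u Q" "coprime v Q"
  shows "\<exists>s. coprime s Q \<and> [u = v * s ^ 2] (mod Q)"
proof -
  have "\<not> int q dvd v" using assms(1,3,4,7) by (simp add: coprime_prime_power_iff del: coprime_power_right_iff)
  then have "Legendre u (int q) * Legendre v (int q) = 1"
    using Legendre_values[of v "int q"] Legendre_eq_0_iff[of v "int q"] by (auto simp: assms(5))
  then have "Legendre (u * v) (int q) = 1" by (simp add: Legendre_mult[OF assms(1,2)])
  then obtain r where r: "coprime r Q" "[u * v = r ^ 2] (mod Q)"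
    using Legendre_1_square[OF assms(1,2)] assms(3) by blast
  have "[u = v * (r * iv v) ^ 2] (mod Q)"
    by (rule cong_combination[OF r(2) iv[OF assms(7)], of _ _ "iv v" "- u - iv v * r * r"])
      (simp add: algebra_simps power2_eq_square)
  then show ?thesis using r(1) assms(7) by (intro exI[of _ "r * iv v"]) (simp add: coprime_iv)
qed

lemma h_1_right: "coprime b Q \<Longrightarrow> h b 1 = h 1 1"
  using h_square_right[of b 1 1] by simp

text \<open>With \<open>u' = u * s ^ 2\<close> the pattern makes
  \<open>c = (u * s ^ 2 - 1) / (u - 1)\<close> a nonresidue, hence \<open>u\<close> up to a square.
  So \<open>h_ratio\<close> gives \<open>h u u = h 1 u\<close>, the one nontrivial case for the
  representatives 1 and \<open>u\<close>.\<close>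

lemma unit_rigid_ge_5:
  assumes q: "prime q" "5 \<le> q" and Q: "Q = int q ^ n" "n > 0"
  shows unit_rigid
proof -
  let ?L = "\<lambda>a. Legendre a (int q)"
  have q2: "2 < q" using q by simp
  have unit: "coprime u Q \<longleftrightarrow> \<not> int q dvd u" for u
    using q(1) Q by (simp add: coprime_prime_power_iff del: coprime_power_right_iff)
  have unitL: "coprime u Q" if "?L u = 1 \<or> ?L u = -1" for u
  proof -
    have "?L u \<noteq> 0" using that by linarith
    then show ?thesis by (simp only: unit Legendre_eq_0_iff not_False_eq_True)
  qed
  obtain u u' where u: "?L u = -1" "?L (u - 1) = 1" "?L u' = -1" "?L (u' - 1) = -1"
    using nonresidue_pattern[OF q] .
  have cu: "coprime u Q" "coprime (u - 1) Q" "coprime u' Q" "coprime (u' - 1) Q"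
    using u by (auto intro: unitL)
  obtain s where s: "coprime s Q" "[u' = u * s ^ 2] (mod Q)"
    using same_Legendre_square[OF q(1) q2 Q, of u' u] u cu by auto
  have "int q dvd Q" using Q by simp
  note s' = cong_dvd_modulus[OF s(2) this]
  have us: "?L (u * s ^ 2 - 1) = -1"
    using Legendre_cong[OF cong_diff[OF s' cong_refl[of 1]]] u by simp
  have "\<not> int q dvd s ^ 2 - 1"
  proof
    assume "int q dvd s ^ 2 - 1"
    then have "int q dvd u * (s ^ 2 - 1)" by simp
    then have "[u * s ^ 2 - 1 = u - 1] (mod int q)" by (simp add: cong_iff_dvd_diff algebra_simps)
    from Legendre_cong[OF this] us u show False by simp
  qed
  then have s1: "coprime (s ^ 2 - 1) Q" by (simp add: unit)
  define c where "c = (u * s ^ 2 - 1) * iv (u - 1)"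
  have hc: "h c u = h 1 u"
    unfolding c_def by (rule h_ratio) (use cu s s1 us in \<open>auto intro: unitL\<close>)
  have "?L (u - 1) * ?L (iv (u - 1)) = 1"
  proof -
    have "[(u - 1) * iv (u - 1) = 1] (mod int q)"
      by (rule cong_dvd_modulus[OF iv[OF cu(2)] \<open>int q dvd Q\<close>])
    from Legendre_cong[OF this] show ?thesis
      using Legendre_square[of 1 "int q"] q by (simp add: Legendre_mult[OF q(1) q2])
  qed
  then have "?L c = -1" using u us by (simp add: c_def Legendre_mult[OF q(1) q2])
  then obtain r where r: "coprime r Q" "[u = c * r ^ 2] (mod Q)"
    using same_Legendre_square[OF q(1) q2 Q, of u c] u cu unitL by auto
  have cc: "coprime c Q" using \<open>?L c = -1\<close> by (auto intro: unitL)
  have "h u u = h (r ^ 2 * c) u" by (rule h_cong) (use r cc cu in \<open>simp_all add: mult.commute\<close>)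
  also have "\<dots> = h 1 u" using h_square_left[OF r(1) cc cu(1)] hc by simp
  finally have uu: "h u u = h 1 u" .
  show ?thesis
  proof (rule unit_rigidI[where R = "{1, u}"])
    fix v assume v: "coprime v Q"
    have L1: "?L 1 = 1" using Legendre_square[of 1 "int q"] q by simp
    have "?L v = 1 \<or> ?L v = -1"
      using Legendre_values[of v "int q"] Legendre_eq_0_iff[of v "int q"] v unit by auto
    then have "?L v = ?L 1 \<or> ?L v = ?L u" using u L1 by simp
    then show "\<exists>\<rho> s. \<rho> \<in> {1, u} \<and> coprime \<rho> Q \<and> coprime s Q \<and> [v = \<rho> * s ^ 2] (mod Q)"
      using same_Legendre_square[OF q(1) q2 Q _ v, of 1] same_Legendre_square[OF q(1) q2 Q _ v, of u] cu(1)
      by (metis coprime_1_left insertCI)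
  qed (use uu cu(1) h_1_right[OF cu(1)] in auto)
qed

text \<open>Every unit square is 1 modulo 3, so \<open>h_ratio\<close> never applies. The
  representatives are 1 and -1, and the assumed equality of two words for -1 is the case
  \<open>h (- 1) (- 1)\<close>.\<close>

lemma unit_rigid_3:
  assumes "Q = 3 ^ n" "n > 0" and "K (-1) 2 (-1) = K 1 (-2) (-1)"
  shows unit_rigid
proof (rule unit_rigidI[where R = "{1, -1}"])
  have Q: "prime (3::nat)" "2 < (3::nat)" "Q = int 3 ^ n" "n > 0" using assms by simp_all
  have m1: "h (-1) (-1) = h 1 (-1)"
    using h_eq_K[of "-1" 2 "-1"] h_eq_K[of 1 "-2" "-1"] assms(3) by simp
  show "h \<beta> \<rho> = h 1 \<rho>" if "\<rho> \<in> {1, -1}" "\<beta> \<in> {1, -1}" "coprime \<rho> Q" "coprime \<beta> Q" for \<rho> \<beta>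
    using that m1 h_1_right[of "-1"] by auto
  fix v assume v: "coprime v Q"
  have L: "Legendre 1 3 = 1" "Legendre (-1) 3 = -1"
  proof -
    show "Legendre 1 3 = 1" using Legendre_square[of 1 3] by simp
    have "\<not> QuadRes 3 (-1)"
    proof
      assume "QuadRes 3 (-1)"
      then obtain y :: int where "(y ^ 2) mod 3 = 2" by (auto simp: QuadRes_def cong_def)
      moreover have "y mod 3 = 0 \<or> y mod 3 = 1 \<or> y mod 3 = 2" by presburger
      then have "(y ^ 2) mod 3 = 0 \<or> (y ^ 2) mod 3 = 1" by (auto simp: power_mod[symmetric, of y])
      ultimately show False by simp
    qed
    then show "Legendre (-1) 3 = -1" by (simp add: Legendre_def cong_0_iff)
  qed
  have "\<not> int 3 dvd v" using v unfolding Q(3) by (simp only: coprime_prime_power_iff[OF Q(1,4)] simp_thms)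
  then have "\<not> 3 dvd v" by simp
  then have "Legendre v 3 = Legendre 1 3 \<or> Legendre v 3 = Legendre (-1) 3"
    using Legendre_values[of v 3] Legendre_eq_0_iff[of v 3] L by auto
  then show "\<exists>\<rho> s. \<rho> \<in> {1, -1} \<and> coprime \<rho> Q \<and> coprime s Q \<and> [v = \<rho> * s ^ 2] (mod Q)"
    using same_Legendre_square[OF Q _ v, of 1] same_Legendre_square[OF Q _ v, of "-1"]
    by (metis coprime_1_left coprime_minus_left_iff insertCI of_nat_numeral)
qed

lemma h_class_right:
  assumes "[u = \<rho> * s ^ 2] (mod Q)" "coprime b Q" "coprime \<rho> Q" "coprime s Q"
  shows "h b u = h b \<rho> * h 1 (s ^ 2)"
proof -
  have "h b u = h b (\<rho> * s ^ 2)" by (rule h_cong) (use assms in simp_all)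
  also have "\<dots> = h b \<rho> * h (b * iv \<rho>) (s ^ 2)" by (rule h_mult) (use assms in simp_all)
  also have "h (b * iv \<rho>) (s ^ 2) = h 1 (s ^ 2)"
    by (rule h_square_right) (use assms in \<open>simp_all add: coprime_iv\<close>)
  finally show ?thesis .
qed

lemma h_class_left:
  assumes "[b = \<beta> * s ^ 2] (mod Q)" "coprime u Q" "coprime \<beta> Q" "coprime s Q"
  shows "h b u = h \<beta> u"
proof -
  have "h b u = h (s ^ 2 * \<beta>) u" by (rule h_cong) (use assms in \<open>simp_all add: mult.commute\<close>)
  also have "\<dots> = h \<beta> u" by (rule h_square_left) (use assms in simp_all)
  finally show ?thesis .
qed

text \<open>With \<open>v\<close> written as plus or minus a power of 3, the residue modulo 8 forces
  the positive sign and an even exponent.\<close>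

lemma square_mod_8:
  assumes Q: "Q = 2 ^ n" and "v mod 8 = 1"
  shows "\<exists>s. coprime s Q \<and> [v = s ^ 2] (mod Q)"
proof -
  have "odd v" using assms(2) by presburger
  then obtain e i where e: "e \<in> {1, -1}" "[v = e * 3 ^ i] (mod 2 ^ (n + 3))"
    using two_power_generator by blast
  have "[v = e * 3 ^ i] (mod 2 ^ 3)"
    by (rule cong_dvd_modulus[OF e(2)], rule le_imp_power_dvd) simp
  then have m: "(e * 3 ^ i) mod 8 = 1" using assms(2) by (simp add: cong_def)
  obtain j where j: "i = 2 * j \<or> i = 2 * j + 1" by (metis evenE oddE)
  have "(9::int) ^ j mod 8 = (9 mod 8) ^ j mod 8" by (rule power_mod[symmetric])
  then have "(9::int) ^ j mod 8 = 1" by simp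
  then obtain k where k: "(9::int) ^ j = 1 + 8 * k" by (metis add.commute mult_div_mod_eq)
  have "e = 1 \<and> i = 2 * j"
    using j
  proof
    assume i: "i = 2 * j"
    have "(e * (1 + 8 * k)) mod 8 = 1" using m k by (simp add: i power_mult)
    then show ?thesis using e(1) i by auto presburger
  next
    assume i: "i = 2 * j + 1"
    have "(e * (3 * (1 + 8 * k))) mod 8 = 1" using m k by (simp add: i power_mult)
    then show ?thesis using e(1) by auto presburger+
  qed
  then have "[v = (3 ^ j) ^ 2] (mod 2 ^ (n + 3))" using e(2) by (simp add: power_mult mult.commute)
  then have "[v = (3 ^ j) ^ 2] (mod Q)"
    unfolding Q by (rule cong_dvd_modulus, intro le_imp_power_dvd) simp
  moreover have "coprime ((3::int) ^ j) Q" unfolding Q by simp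
  ultimately show ?thesis by blast
qed

text \<open>If \<open>l * k * \<rho> = r ^ 2\<close>, then
  \<open>l / k = \<rho> * (r / (k * \<rho>)) ^ 2\<close>; the residue modulo 8 provides
  \<open>r\<close>.\<close>

lemma fraction_class:
  assumes Q: "Q = 2 ^ n" and "[\<alpha> = l * iv k] (mod Q)" "odd k" "odd \<rho>" "(l * k * \<rho>) mod 8 = 1"
  shows "\<exists>s. coprime s Q \<and> [\<alpha> = \<rho> * s ^ 2] (mod Q)"
proof -
  have c: "coprime k Q" "coprime \<rho> Q" using assms(3,4) by (simp_all add: Q)
  obtain r where r: "coprime r Q" "[l * k * \<rho> = r ^ 2] (mod Q)"
    using square_mod_8[OF Q assms(5)] by blast
  have "[\<rho> * (r * (iv \<rho> * iv k)) ^ 2 = \<rho> * (iv \<rho> * iv k) ^ 2 * (l * k * \<rho>)] (mod Q)"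
    using cong_scalar_left[OF cong_sym[OF r(2)], of "\<rho> * (iv \<rho> * iv k) ^ 2"]
    by (simp add: power_mult_distrib mult_ac)
  also have "[\<rho> * (iv \<rho> * iv k) ^ 2 * (l * k * \<rho>) = l * iv k] (mod Q)"
    by (rule cong_combination[OF iv[OF c(2)] iv[OF c(1)], of _ _
          "l * k * iv k * iv k * (\<rho> * iv \<rho> + 1)" "l * iv k"])
      (simp add: algebra_simps power2_eq_square)
  also have "[l * iv k = \<alpha>] (mod Q)" by (rule cong_sym[OF assms(2)])
  finally have "[\<alpha> = \<rho> * (r * (iv \<rho> * iv k)) ^ 2] (mod Q)" by (rule cong_sym)
  then show ?thesis using r(1) c by (intro exI[of _ "r * (iv \<rho> * iv k)"]) (simp add: coprime_iv)
qed

text \<open>Differences of odd numbers are even, so \<open>h_ratio\<close> is void.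
  \<open>K1\<close> and \<open>K3\<close> settle the first argument -1; commutativity then settles
  the second argument -1 and shows that the sign of the first argument is immaterial. What remains
  is \<open>h 3 3 = h 1 3\<close>, obtained by evaluating \<open>h 1 7\<close> in two ways.\<close>

lemma unit_rigid_2:
  assumes Q: "Q = 2 ^ n" "n > 0" and K1: "K (-1) 2 (-1) = K 1 (-2) (-1)"
    and K3: "\<And>w. [3 * w = 1] (mod Q) \<Longrightarrow> K 1 2 w = K (-1) (-2) w"
  shows unit_rigid
proof -
  have unit: "coprime u Q \<longleftrightarrow> odd u" for u using Q by simp
  have sq_class: "\<exists>s. coprime s Q \<and> [u = \<rho> * s ^ 2] (mod Q)" if "(u * \<rho>) mod 8 = 1" for u \<rho>
  proof -
    have "odd \<rho>" using that by (metis even_mult_iff even_numeral dvd_mod_iff mod_0_imp_dvd odd_one dvd_trans even_mod_2_iff)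
    moreover have "[u = u * iv 1] (mod Q)" using iv[of 1] cong_scalar_left[OF cong_sym, of "iv 1" 1 Q u] by simp
    ultimately show ?thesis using fraction_class[OF Q(1), of u u 1 \<rho>] that by simp
  qed
  have iv1: "[iv (-1) = -1] (mod Q)" by (rule iv_unique) simp
  have c3: "[3 * iv 3 = 1] (mod Q)" and c5: "[5 * iv 5 = 1] (mod Q)" and c7: "[7 * iv 7 = 1] (mod Q)"
    by (rule iv; simp add: Q)+
  have u1: "coprime 1 Q" "coprime (-1) Q" "coprime 3 Q" "coprime 5 Q" "coprime 7 Q" "coprime (-3) Q"
    by (simp_all add: Q)
  have m1: "h (-1) (-1) = h 1 (-1)"
    using h_eq_K[of "-1" 2 "-1"] h_eq_K[of 1 "-2" "-1"] K1 by simp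
  have m3: "h (-1) 3 = h 1 3"
    using h_eq_K[of "-1" "-2" "iv 3"] h_eq_K[of 1 2 "iv 3"] K3[OF c3] c3 by simp
  have m_left: "h (b * iv (-1)) u = h (- b) u" if "odd b" "odd u" for b u
    by (rule h_cong) (use cong_scalar_left[OF iv1, of b] that in \<open>simp_all add: unit\<close>)
  have neg: "h b (- u) = h b (-1) * h (- b) u" if "odd b" "odd u" for b u
    using h_mult[of b "-1" u] m_left[OF that] that by (simp add: unit)
  have neg': "h b (- u) = h b u * h (b * iv u) (-1)" if "odd b" "odd u" for b u
    using h_mult[of b u "-1"] that by (simp add: unit)
  have A0: "h (-1) u = h 1 u" if u: "odd u" for u
  proof -
    have m: "h (-1) (-3) = h 1 (-3)"
      using neg[of "-1" 3] neg[of 1 3] m1 m3 by simp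
    obtain \<rho> where \<rho>: "\<rho> \<in> {1, 3, -3, -1}" "(u * \<rho>) mod 8 = 1" using odd_mod_8[OF u] .
    obtain s where s: "coprime s Q" "[u = \<rho> * s ^ 2] (mod Q)" using sq_class[OF \<rho>(2)] by blast
    have "coprime \<rho> Q" using \<rho>(1) u1 by auto
    then have "h b u = h b \<rho> * h 1 (s ^ 2)" if "coprime b Q" for b
      using h_class_right[OF s(2) that _ s(1)] by simp
    moreover have "h (-1) \<rho> = h 1 \<rho>" using \<rho>(1) m m1 m3 h_1_right[of "-1"] by auto
    ultimately show ?thesis using u1 by simp
  qed
  \<comment> \<open>\<open>h 1 (- 1 / b)\<close> is expanded with the factor -1 pulled out on the
    left and on the right.\<close>
  have A1: "h b (-1) = h 1 (-1)" if b: "odd b" for b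
  proof -
    have ib: "odd (iv b)" using coprime_iv[of b] b by (simp add: unit)
    have "[iv b * b = 1] (mod Q)" using iv[of b] b by (simp add: unit mult.commute)
    then have iib: "[iv (iv b) = b] (mod Q)" by (rule iv_unique)
    have "h 1 (iv b) * h 1 (-1) = h 1 (-1) * h 1 (iv b)" by (rule h_commute) (use ib in \<open>simp_all add: unit\<close>)
    also have "\<dots> = h 1 (- iv b)" using neg[of 1 "iv b"] A0[OF ib] ib by simp
    also have "\<dots> = h 1 (iv b) * h (iv (iv b)) (-1)" using neg'[of 1 "iv b"] ib by simp
    also have "h (iv (iv b)) (-1) = h b (-1)" by (rule h_cong) (use iib b in \<open>simp_all add: unit\<close>)
    finally show ?thesis by (simp only: group_left_cancel)
  qed
  have A2: "h (- b) u = h b u" if "odd b" "odd u" for b u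
  proof -
    have "h 1 (-1) * h (- b) u = h b u * h (b * iv u) (-1)"
      using neg[OF that] neg'[OF that] A1[OF that(1)] by simp
    also have "h (b * iv u) (-1) = h 1 (-1)"
      by (rule A1) (use that coprime_iv[of u] in \<open>simp add: unit\<close>)
    also have "h b u * h 1 (-1) = h 1 (-1) * h b u" by (rule h_commute) (use that in \<open>simp_all add: unit\<close>)
    finally show ?thesis by (simp only: group_left_cancel)
  qed
  have A3: "h b u = h 1 u" if "[u = (-1) * s ^ 2] (mod Q)" "coprime s Q" "odd b" for b u s
    using h_class_right[OF that(1) _ _ that(2), of b] h_class_right[OF that(1) _ _ that(2), of 1] A1[OF that(3)] that(3)
    by (simp add: unit)
  \<comment> \<open>\<open>\<alpha> = 5 / 3\<close> and \<open>\<beta> = 7 / 5\<close> are the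
    quotients of the successive units 3, 5, 7 that belong to the first arguments 1, 2, 3 and
    \<open>t = 2\<close>.\<close>
  define \<alpha> \<beta> where "\<alpha> = 1 + 2 * iv 3" and "\<beta> = 1 + 2 * iv 5"
  have \<alpha>: "[\<alpha> = 5 * iv 3] (mod Q)" and \<beta>: "[\<beta> = 7 * iv 5] (mod Q)"
    unfolding \<alpha>_def \<beta>_def
    by (rule cong_combination[OF c3 c5, of _ _ "- 1" 0]; simp)
      (rule cong_combination[OF c5 c7, of _ _ "- 1" 0]; simp)
  have odd: "odd \<alpha>" "odd \<beta>" by (simp_all add: \<alpha>_def \<beta>_def)
  obtain s where s: "coprime s Q" "[\<alpha> = -1 * s ^ 2] (mod Q)"
    using fraction_class[OF Q(1) \<alpha>, of "-1"] by auto
  obtain s' where s': "coprime s' Q" "[\<beta> = 3 * s' ^ 2] (mod Q)"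
    using fraction_class[OF Q(1) \<beta>, of 3] by auto
  obtain s7 where s7: "coprime s7 Q" "[7 = -1 * s7 ^ 2] (mod Q)" using sq_class[of 7 "-1"] by auto
  have w1: "[\<alpha> * (3 * iv 5) = 1] (mod Q)"
    unfolding \<alpha>_def by (rule cong_combination[OF c3 c5, of _ _ "2 * iv 5" 1]) (simp add: algebra_simps)
  have w2: "[iv 3 * (3 * iv 5) = iv 5] (mod Q)"
    by (rule cong_combination[OF c3 c5, of _ _ "iv 5" 0]) (simp add: algebra_simps)
  have w3: "[\<beta> * (5 * iv 7) = 1] (mod Q)"
    unfolding \<beta>_def by (rule cong_combination[OF c5 c7, of _ _ "2 * iv 7" 1]) (simp add: algebra_simps)
  have w4: "[iv 5 * (5 * iv 7) = iv 7] (mod Q)"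
    by (rule cong_combination[OF c5 c7, of _ _ "iv 7" 0]) (simp add: algebra_simps)
  \<comment> \<open>Since 7 lies in the square class of -1, the first argument may be changed to 3,
    which is then peeled off one unit at a time.\<close>
  have "h 1 7 = h 3 7" using A3[OF s7(2,1), of 3] by simp
  also have "\<dots> = K (2 + 1) 2 (iv 5 * (5 * iv 7))"
    using h_eq_K[of 3 2 "iv 7"] u1 c7 K_cong[OF cong_refl[of 3] cong_refl[of 2] w4] by simp
  also have "\<dots> = K 1 (2 * iv 5) (5 * iv 7) * K (1 + 1) 2 (iv 5)"
    using K_add_left[of 2 2 "iv 5" 1 "5 * iv 7"] c5 w3 by (simp add: \<beta>_def)
  also have "K (1 + 1) 2 (iv 5) = K (1 + 1) 2 (iv 3 * (3 * iv 5))"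
    by (rule K_cong[OF cong_refl cong_refl cong_sym[OF w2]])
  also have "\<dots> = K 1 (2 * iv 3) (3 * iv 5) * K 1 2 (iv 3)"
    using K_add_left[of 1 2 "iv 3" 1 "3 * iv 5"] c3 w1 by (simp add: \<alpha>_def)
  also have "K 1 (2 * iv 5) (5 * iv 7) = h 1 \<beta>"
    using h_eq_K[of 1 "2 * iv 5" "5 * iv 7"] w3 by (simp add: \<beta>_def)
  also have "K 1 (2 * iv 3) (3 * iv 5) = h 1 \<alpha>"
    using h_eq_K[of 1 "2 * iv 3" "3 * iv 5"] w1 by (simp add: \<alpha>_def)
  also have "K 1 2 (iv 3) = h 1 3" using h_eq_K[of 1 2 "iv 3"] c3 by simp
  finally have 1: "h 1 7 = h 1 \<beta> * (h 1 \<alpha> * h 1 3)" .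
  \<comment> \<open>Second evaluation: \<open>7 = 3 * \<alpha> * \<beta>\<close> by
    \<open>h_mult\<close>. The comparison leaves \<open>h \<gamma> \<beta> = h 1 \<beta>\<close>,
    where \<open>\<gamma> = 1 / 5\<close> lies in the class of -3 and \<open>\<beta>\<close> in that
    of 3.\<close>
  define \<gamma> where "\<gamma> = iv 3 * iv \<alpha>"
  have c\<alpha>: "coprime \<alpha> Q" "coprime \<beta> Q" "coprime (iv 3) Q" using odd coprime_iv[OF u1(3)] unfolding unit by - assumption+
  have \<gamma>: "[\<gamma> = 1 * iv 5] (mod Q)"
  proof -
    have "[iv \<alpha> = 3 * iv 5] (mod Q)" by (rule iv_unique[OF w1])
    from cong_trans[OF cong_scalar_left[OF this, of "iv 3"] w2] show ?thesis by (simp add: \<gamma>_def)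
  qed
  obtain s5 where s5: "coprime s5 Q" "[\<gamma> = -3 * s5 ^ 2] (mod Q)"
    using fraction_class[OF Q(1) \<gamma>, of "-3"] by auto
  have c\<gamma>: "coprime \<gamma> Q" unfolding \<gamma>_def using c\<alpha> by (simp add: coprime_iv)
  have "[3 * (\<alpha> * \<beta>) = 7] (mod Q)"
  proof -
    have "[3 * (\<alpha> * \<beta>) = 3 * (5 * iv 3 * (7 * iv 5))] (mod Q)"
      by (intro cong_mult cong_refl \<alpha> \<beta>)
    also have "[3 * (5 * iv 3 * (7 * iv 5)) = 7] (mod Q)"
      by (rule cong_combination[OF c3 c5, of _ _ "35 * iv 5" 7]) (simp add: algebra_simps)
    finally show ?thesis .
  qed
  then have "h 1 7 = h 1 (3 * (\<alpha> * \<beta>))" using c\<alpha> u1 by (intro h_cong) (simp_all add: cong_sym)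
  also have "\<dots> = h 1 3 * h (iv 3) (\<alpha> * \<beta>)" using h_mult[of 1 3 "\<alpha> * \<beta>"] c\<alpha> u1 by simp
  also have "h (iv 3) (\<alpha> * \<beta>) = h (iv 3) \<alpha> * h \<gamma> \<beta>" using h_mult[OF c\<alpha>(3,1,2)] by (simp add: \<gamma>_def)
  also have "h (iv 3) \<alpha> = h 1 \<alpha>" using A3[OF s(2,1), of "iv 3"] c\<alpha>(3) by (simp add: unit)
  finally have 2: "h 1 7 = h 1 3 * (h 1 \<alpha> * h \<gamma> \<beta>)" .
  have "h 1 \<beta> * (h 1 \<alpha> * h 1 3) = h 1 3 * (h 1 \<alpha> * h 1 \<beta>)"
    using h_commute[OF u1(1) c\<alpha>(2) u1(1) c\<alpha>(1)] h_commute[OF u1(1) c\<alpha>(2) u1(1) u1(3)]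
      h_commute[OF u1(1) c\<alpha>(1) u1(1) u1(3)] by (metis mult.assoc)
  then have "h \<gamma> \<beta> = h 1 \<beta>" using 1 2 by (simp only: group_left_cancel)
  moreover have "h c \<beta> = h c 3 * h 1 (s' ^ 2)" if "coprime c Q" for c
    by (rule h_class_right[OF s'(2) that _ s'(1)]) (rule u1)
  ultimately have "h \<gamma> 3 = h 1 3" using c\<gamma> by (simp add: group_right_cancel)
  moreover have "h \<gamma> 3 = h (-3) 3" by (rule h_class_left[OF s5(2) _ _ s5(1)]) (rule u1)+
  ultimately have m3': "h (-3) 3 = h 1 3" "h 3 3 = h 1 3" using A2[of 3 3] by simp_all
  show ?thesis
  proof (rule unit_rigidI[where R = "{1, 3, -3, -1}"])
    fix u assume "coprime u Q"
    then obtain \<rho> where \<rho>: "\<rho> \<in> {1, 3, -3, -1}" "(u * \<rho>) mod 8 = 1"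
      using odd_mod_8 unfolding unit by blast
    then have "coprime \<rho> Q" using u1 by auto
    then show "\<exists>\<rho> v. \<rho> \<in> {1, 3, -3, -1} \<and> coprime \<rho> Q \<and> coprime v Q \<and> [u = \<rho> * v ^ 2] (mod Q)"
      using sq_class[OF \<rho>(2)] \<rho>(1) by blast
  next
    fix \<rho> b :: int assume \<rho>: "\<rho> \<in> {1, 3, -3, -1}" and b: "b \<in> {1, 3, -3, -1}" "coprime b Q"
    then have "odd b" by (simp add: unit)
    have h3: "h b 3 = h 1 3" using b m3 m3' by auto
    have "h b (-3) = h 1 (-3)"
      using neg[of b 3] neg[of 1 3] A1[OF \<open>odd b\<close>] A2[of b 3] A2[of 1 3] h3 \<open>odd b\<close> by simp
    then show "h b \<rho> = h 1 \<rho>" using \<rho> h3 A1[OF \<open>odd b\<close>] h_1_right[OF b(2)] by auto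
  qed
qed

text \<open>For even \<open>b\<close> and odd \<open>t\<close> no \<open>c\<close> fits
  \<open>K_split\<close>, since \<open>c\<close> and \<open>1 + c * t\<close> cannot both be odd.
  Instead \<open>\<mu>\<close>, inversion followed by conjugation with \<open>j\<close>, exchanges
  \<open>b\<close> and \<open>t\<close>. It fixes \<open>h 1 u\<close>: if \<open>u\<close> is 1
  modulo 4, write \<open>u = 1 + 2 * (2 * k)\<close> with both factors even; for -1 use
  \<open>K1\<close>; the rest follows by multiplicativity.\<close>

lemma rigid_2:
  assumes unit_rigid and Q: "Q = 2 ^ n" "n > 0" and K1: "K (-2) 1 (-1) = K 1 (-2) (-1)"
    and jx: "\<And>i. j * x i = y (- i) * j" and jy: "\<And>i. j * y i = x (- i) * j"
  shows rigid
proof (rule rigidI)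
  have unit: "coprime u Q \<longleftrightarrow> odd u" for u using Q by simp
  have J: "j * K b t w = inverse (K t b w) * j" for b t w
  proof -
    have jx': "j * (x i * g) = y (- i) * (j * g)" and jy': "j * (y i * g) = x (- i) * (j * g)" for i g
      using jx jy by (simp_all only: mult.assoc[symmetric])
    show ?thesis
      by (simp add: K_def mult.assoc jx jx' jy jy' group_inverse_mult flip: x_minus y_minus)
  qed
  define \<mu> where "\<mu> g = inverse j * inverse g * j" for g
  have \<mu>_mult: "\<mu> (g * g') = \<mu> g' * \<mu> g" for g g'
    by (simp add: \<mu>_def group_inverse_mult mult.assoc)
  have J': "K b t w = \<mu> (K t b w)" for b t w
  proof -
    have "j * K b t w = j * \<mu> (K t b w)" unfolding J by (simp add: \<mu>_def mult.assoc)
    then show ?thesis by (simp only: group_left_cancel)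
  qed
  have even: "K b t w = h 1 (1 + b * t)" if "[(1 + b * t) * w = 1] (mod Q)" "even b" "even t" for b t w
    by (rule K_split[OF assms(1) that(1), of 1]) (use that in \<open>simp_all add: unit\<close>)
  have \<mu>1: "\<mu> (h 1 u) = h 1 u" if u: "odd u" "u mod 4 = 1" for u
  proof -
    obtain k where k: "u = 1 + 2 * (2 * k)"
      using u(2) by (metis add.commute mult.assoc mult_div_mod_eq mult_2 numeral_Bit0 mult_2_right)
    have w: "[(1 + 2 * (2 * k)) * iv u = 1] (mod Q)" using iv[of u] u(1) unfolding k[symmetric] by (simp add: unit)
    then have w': "[(1 + (2 * k) * 2) * iv u = 1] (mod Q)" by (simp add: mult.commute)
    have "K 2 (2 * k) (iv u) = h 1 u" "K (2 * k) 2 (iv u) = h 1 u"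
      using even[OF w] even[OF w'] by (simp_all add: k mult.commute)
    then show ?thesis using J'[of 2 "2 * k" "iv u"] by simp
  qed
  have \<mu>m: "\<mu> (h 1 (-1)) = h 1 (-1)"
    using J'[of "-2" 1 "-1"] h_eq_K[of 1 "-2" "-1"] K1 by simp
  have \<mu>: "\<mu> (h 1 u) = h 1 u" if u: "odd u" for u
  proof (cases "u mod 4 = 1")
    case False
    then have "(- u) mod 4 = 1" using u by presburger
    then have "\<mu> (h 1 (- u)) = h 1 (- u)" using u by (intro \<mu>1) simp_all
    moreover have "h 1 u = h 1 (-1) * h 1 (- u)"
      using h_hom[OF assms(1), of "-1" "- u"] u by (simp add: unit)
    moreover have "h 1 (-1) * h 1 (- u) = h 1 (- u) * h 1 (-1)"
      by (rule h_commute) (use u in \<open>simp_all add: unit\<close>)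
    ultimately show ?thesis using \<mu>m by (simp add: \<mu>_mult)
  qed (use \<mu>1 u in blast)
  fix b t w assume w: "[(1 + b * t) * w = 1] (mod Q)"
  then have u: "odd (1 + b * t)" using coprime_inverse unit by blast
  consider "odd b" | "even b" "even t" | "even b" "odd t" by blast
  then show "K b t w = h 1 (1 + b * t)"
  proof cases
    case 1
    then show ?thesis using K_unit[OF assms(1) w] by (simp add: unit)
  next
    case 2
    then show ?thesis by (rule even[OF w])
  next
    case 3
    have "[(1 + t * b) * w = 1] (mod Q)" using w by (simp add: mult.commute)
    then have "K t b w = h 1 (1 + t * b)" using K_unit[OF assms(1)] 3 by (simp add: unit)
    then show ?thesis using J'[of b t w] \<mu>[OF u] by (simp add: mult.commute)
  qed
qed

end

section \<open>Rigidity modulo \<open>N\<close>\<close>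

context congruence_tower
begin

definition torus where
  "torus u = {r a b c d |a b c d. a * d - b * c = 1 \<and> N dvd b \<and> N dvd c \<and> [a = u] (mod N)}"

lemma torusI:
  "a * d - b * c = 1 \<Longrightarrow> N dvd b \<Longrightarrow> N dvd c \<Longrightarrow> [a = u] (mod N) \<Longrightarrow> r a b c d \<in> torus u"
  unfolding torus_def by blast

lemma torusE:
  assumes "f \<in> torus u"
  obtains a b c d where "f = r a b c d" "a * d - b * c = 1" "N dvd b" "N dvd c"
    "[a = u] (mod N)" "[a * d = 1] (mod N)"
proof -
  obtain a b c d where *: "f = r a b c d" "a * d - b * c = 1" "N dvd b" "N dvd c" "[a = u] (mod N)"
    using assms unfolding torus_def by blast
  have "N dvd b * c" using *(3) by simp
  moreover have "a * d - 1 = b * c" using *(2) by simp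
  ultimately have "[a * d = 1] (mod N)" by (simp add: cong_iff_dvd_diff)
  then show ?thesis using that * by blast
qed

lemma torus_cong: "f \<in> torus u \<Longrightarrow> [u = v] (mod N) \<Longrightarrow> f \<in> torus v"
  by (elim torusE) (metis torusI cong_trans)

lemma torus_X_shift: "f \<in> torus u \<Longrightarrow> f * X s = X (u ^ 2 * s) * f"
proof (elim torusE)
  fix a b c d assume f: "f = r a b c d" "a * d - b * c = 1" "N dvd b" "N dvd c" "[a = u] (mod N)"
  have "X (a ^ 2 * s) = X (u ^ 2 * s)" by (rule X_cong[OF cong_scalar_right[OF cong_pow[OF f(5)]]])
  then show "f * X s = X (u ^ 2 * s) * f" using torus_X[OF f(2-4), of s] f(1) by simp
qed

lemma torus_Y_shift:
  assumes "f \<in> torus u" "[u * v = 1] (mod N)"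
  shows "f * Y s = Y (v ^ 2 * s) * f"
  using assms(1)
proof (elim torusE)
  fix a b c d assume f: "f = r a b c d" "a * d - b * c = 1" "N dvd b" "N dvd c" "[a = u] (mod N)" "[a * d = 1] (mod N)"
  have "[u * d = 1] (mod N)" using cong_trans[OF cong_scalar_right[OF cong_sym[OF f(5)]] f(6)] .
  from cong_combination[OF this assms(2), of d v v "- d"] have "[d = v] (mod N)" by (simp add: algebra_simps)
  from cong_scalar_right[OF cong_pow[OF this], of 2 s] have "Y (d ^ 2 * s) = Y (v ^ 2 * s)" by (rule Y_cong)
  then show "f * Y s = Y (v ^ 2 * s) * f" using torus_Y[OF f(2-4), of s] f(1) by simp
qed

lemma torus_mult: "f \<in> torus u \<Longrightarrow> f' \<in> torus v \<Longrightarrow> f * f' \<in> torus (u * v)"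
proof (elim torusE)
  fix a b c d a' b' c' d'
  assume f: "f = r a b c d" "a * d - b * c = 1" "N dvd b" "N dvd c" "[a = u] (mod N)"
    and f': "f' = r a' b' c' d'" "a' * d' - b' * c' = 1" "N dvd b'" "N dvd c'" "[a' = v] (mod N)"
  have "(a * a' + b * c') * (c * b' + d * d') - (a * b' + b * d') * (c * a' + d * c')
      = (a * d - b * c) * (a' * d' - b' * c')"
    by (simp add: algebra_simps)
  moreover have "[a * a' + b * c' = u * v + 0] (mod N)"
    by (intro cong_add cong_mult f(5) f'(5)) (use f(3) in \<open>simp add: cong_0_iff\<close>)
  ultimately show "f * f' \<in> torus (u * v)"
    unfolding f(1) f'(1) hom[OF f(2) f'(2)] using f f' by (intro torusI) auto
qed

lemma torus_inverse:
  assumes "f \<in> torus u" "[u * w = 1] (mod N)"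
  shows "inverse f \<in> torus w"
  using assms(1)
proof (elim torusE)
  fix a b c d assume f: "f = r a b c d" "a * d - b * c = 1" "N dvd b" "N dvd c" "[a = u] (mod N)" "[a * d = 1] (mod N)"
  have "[u * d = 1] (mod N)" using cong_trans[OF cong_scalar_right[OF cong_sym[OF f(5)]] f(6)] .
  from cong_combination[OF this assms(2), of d w w "- d"] have "[d = w] (mod N)" by (simp add: algebra_simps)
  then show ?thesis unfolding f(1) hom_inverse[OF f(2)] using f by (intro torusI) (auto simp: mult.commute)
qed

lemma torus_1_commute:
  assumes "f \<in> torus 1" "a * d - b * c = 1"
  shows "f * r a b c d = r a b c d * f"
proof (rule commute_r[OF _ _ assms(2)])
  show "f * X 1 = X 1 * f" using torus_X_shift[OF assms(1), of 1] by simp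
  show "f * Y 1 = Y 1 * f" using torus_Y_shift[OF assms(1), of 1 1] by simp
qed

lemma torus_1_central: "c \<in> torus 1 \<Longrightarrow> f \<in> torus u \<Longrightarrow> c * f = f * c"
  by (elim torusE[of f]) (use torus_1_commute in blast)

definition Kw where "Kw b t w = Y (- (t * w)) * X b * Y t * X (- (b * w))"

lemma Kw_eq: "Kw b t w = r (1 + b * t) (b - b * w * (1 + b * t)) (t - t * w * (1 + b * t))
    (1 - b * w * t - t * w * (b - b * w * (1 + b * t)))"
  by (simp add: Kw_def X_def Y_def hom algebra_simps)

lemma Kw_det: "(1 + b * t) * (1 - b * w * t - t * w * (b - b * w * (1 + b * t)))
    - (b - b * w * (1 + b * t)) * (t - t * w * (1 + b * t)) = (1::int)"
  by (simp add: algebra_simps)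

lemma Kw_dvd:
  assumes "[(1 + b * t) * w = 1] (mod N)"
  shows "N dvd b - b * w * (1 + b * t)" "N dvd t - t * w * (1 + b * t)"
proof -
  have *: "N dvd (1 + b * t) * w - 1" using assms by (simp add: cong_iff_dvd_diff)
  have "b - b * w * (1 + b * t) = - b * ((1 + b * t) * w - 1)"
    "t - t * w * (1 + b * t) = - t * ((1 + b * t) * w - 1)" by (simp_all add: algebra_simps)
  then show "N dvd b - b * w * (1 + b * t)" "N dvd t - t * w * (1 + b * t)" using * by simp_all
qed

lemma Kw_torus: "[(1 + b * t) * w = 1] (mod N) \<Longrightarrow> Kw b t w \<in> torus (1 + b * t)"
  unfolding Kw_eq by (intro torusI Kw_det Kw_dvd cong_refl)

lemma Kw_cong:
  "[b = b'] (mod N) \<Longrightarrow> [t = t'] (mod N) \<Longrightarrow> [b * w = b' * w'] (mod N) \<Longrightarrow> [t * w = t' * w'] (mod N) \<Longrightarrow>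
    Kw b t w = Kw b' t' w'"
  unfolding Kw_def
  by (intro arg_cong2[where f = "(*)"] X_cong Y_cong cong_minus_minus_iff[THEN iffD2])

text \<open>Idempotency makes \<open>1 + e * (u - 1)\<close> multiplicative in \<open>u\<close>: it
  is the residue that equals \<open>u\<close> on the component selected by \<open>e\<close> and 1 on
  the complement.\<close>

lemma torus_system_idempotent:
  assumes e: "[e * e = e] (mod N)" and eQ: "N dvd e * Q"
  shows "torus_system (\<lambda>i. X (e * i)) (\<lambda>i. Y (e * i)) Q (\<lambda>u. torus (1 + e * (u - 1)))"
proof
  have eq: "[e * i = e * j] (mod N)" if "[i = j] (mod Q)" for i j
  proof -
    obtain k where "i - j = Q * k" using \<open>[i = j] (mod Q)\<close> by (auto simp: cong_iff_dvd_diff)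
    then have "e * i - e * j = e * Q * k" by (simp add: algebra_simps flip: right_diff_distrib)
    then show ?thesis using eQ by (simp add: cong_iff_dvd_diff)
  qed
  note comb = cong_combination[OF e]
  fix i j s u v b t w :: int and f f' :: 'g
  show "X (e * (i + j)) = X (e * i) * X (e * j)" "Y (e * (i + j)) = Y (e * i) * Y (e * j)"
    by (simp_all add: distrib_left X_add Y_add)
  show "X (e * i) = X (e * j)" "Y (e * i) = Y (e * j)" if "[i = j] (mod Q)"
    using eq[OF that] X_cong Y_cong by blast+
  show "f \<in> torus (1 + e * (v - 1))" if "f \<in> torus (1 + e * (u - 1))" "[u = v] (mod Q)"
    by (rule torus_cong[OF that(1)]) (intro cong_add cong_refl eq cong_diff that(2))
  show "f * X (e * s) = X (e * (u ^ 2 * s)) * f" if "f \<in> torus (1 + e * (u - 1))"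
  proof -
    have "[(1 + e * (u - 1)) ^ 2 * (e * s) = e * (u ^ 2 * s)] (mod N)"
      by (rule comb[OF cong_refl[of 0], of _ _ "- s + e * s - 2 * e * s * u + s * u * u + e * s * u * u" 0])
        (simp add: algebra_simps power2_eq_square)
    from X_cong[OF this] show ?thesis using torus_X_shift[OF that, of "e * s"] by simp
  qed
  show "f * f' \<in> torus (1 + e * (u * v - 1))"
    if "f \<in> torus (1 + e * (u - 1))" "f' \<in> torus (1 + e * (v - 1))"
    by (rule torus_cong[OF torus_mult[OF that]], rule comb[OF cong_refl[of 0], of _ _ "1 - u - v + u * v" 0])
      (simp add: algebra_simps)
  have inv: "[(1 + e * (u - 1)) * (1 + e * (w - 1)) = 1] (mod N)" if "[u * w = 1] (mod Q)" for u w
  proof -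
    have "[(1 + e * (u - 1)) * (1 + e * (w - 1)) = 1 + e * (u * w - 1)] (mod N)"
      by (rule comb[OF cong_refl[of 0], of _ _ "1 - u - w + u * w" 0]) (simp add: algebra_simps)
    also have "[1 + e * (u * w - 1) = 1 + e * (1 - 1)] (mod N)"
      by (intro cong_add cong_refl eq cong_diff that)
    finally show ?thesis by simp
  qed
  show "inverse f \<in> torus (1 + e * (w - 1))" if "f \<in> torus (1 + e * (u - 1))" "[u * w = 1] (mod Q)"
    by (rule torus_inverse[OF that(1) inv[OF that(2)]])
  show "c * f = f * c" if "c \<in> torus (1 + e * (1 - 1))" "f \<in> torus (1 + e * (u - 1))" for c
    using torus_1_central that by simp
  show "f * Y (e * (u ^ 2 * s)) = Y (e * s) * f" if f: "f \<in> torus (1 + e * (u - 1))"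
  proof -
    obtain d where d: "[(1 + e * (u - 1)) * d = 1] (mod N)"
      using f by (elim torusE) (metis cong_scalar_right cong_sym cong_trans)
    have "[d ^ 2 * (e * (u ^ 2 * s)) = e * s] (mod N)"
      by (rule comb[OF d, of _ _ "d * s - d * s * u + d * d * s * u - d * d * s * u * u" "e * s + d * e * s * u"])
        (simp add: algebra_simps power2_eq_square)
    from Y_cong[OF this] show ?thesis using torus_Y_shift[OF f d, of "e * (u ^ 2 * s)"] by simp
  qed
  show "Y (e * - (t * w)) * X (e * b) * Y (e * t) * X (e * - (b * w)) \<in> torus (1 + e * (1 + b * t - 1))"
    if w: "[(1 + b * t) * w = 1] (mod Q)"
  proof -
    define w' where "w' = 1 + e * (w - 1)"
    have bt: "[1 + e * b * (e * t) = 1 + e * (1 + b * t - 1)] (mod N)"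
      by (rule comb[OF cong_refl[of 0], of _ _ "b * t" 0]) (simp add: algebra_simps)
    have "[(1 + e * b * (e * t)) * w' = 1] (mod N)"
      using cong_trans[OF cong_scalar_right[OF bt] inv[OF w]] by (simp add: w'_def)
    then have "Kw (e * b) (e * t) w' \<in> torus (1 + e * b * (e * t))" by (rule Kw_torus)
    moreover have "Kw (e * b) (e * t) w' = Y (e * - (t * w)) * X (e * b) * Y (e * t) * X (e * - (b * w))"
    proof -
      have yt: "[- (e * t * w') = e * - (t * w)] (mod N)" and xb: "[- (e * b * w') = e * - (b * w)] (mod N)"
        unfolding w'_def
        by (rule comb[OF cong_refl[of 0], of _ _ "t - t * w" 0]; simp add: algebra_simps)
          (rule comb[OF cong_refl[of 0], of _ _ "b - b * w" 0]; simp add: algebra_simps)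
      show ?thesis unfolding Kw_def X_cong[OF xb] Y_cong[OF yt] ..
    qed
    ultimately show ?thesis using torus_cong[OF _ bt] by simp
  qed
qed

section \<open>Chinese remainder decomposition of the level\<close>

text \<open>\<open>Q\<close> is a unitary divisor of \<open>N\<close>, that is, coprime to
  \<open>N / Q\<close>, and \<open>e\<close> is the idempotent modulo \<open>N\<close> that selects
  this component.\<close>

definition unitary where
  "unitary Q e \<longleftrightarrow> Q > 0 \<and> (\<exists>Q'. N = Q * Q' \<and> coprime Q Q' \<and> [e = 1] (mod Q) \<and> [e = 0] (mod Q'))"

lemma unitaryD:
  assumes "unitary Q e"
  shows "Q > 0" "[e * e = e] (mod N)" "N dvd e * Q" "[e * i = e * j] (mod N) \<longleftrightarrow> [i = j] (mod Q)"
proof -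
  obtain Q' where Q: "Q > 0" "N = Q * Q'" "coprime Q Q'" "Q dvd e - 1" "Q' dvd e"
    using assms by (auto simp: unitary_def cong_iff_dvd_diff)
  show "Q > 0" by (rule Q)
  have "Q * Q' dvd (e - 1) * e" by (rule mult_dvd_mono[OF Q(4,5)])
  then show "[e * e = e] (mod N)" by (simp add: Q(2) cong_iff_dvd_diff algebra_simps)
  have "Q' * Q dvd e * Q" using Q(5) by simp
  then show "N dvd e * Q" by (simp add: Q(2) mult.commute)
  show "[e * i = e * j] (mod N) \<longleftrightarrow> [i = j] (mod Q)"
  proof
    assume "[e * i = e * j] (mod N)"
    then have "Q dvd e * i - e * j" unfolding Q(2) cong_iff_dvd_diff by (rule dvd_mult_left)
    then have "Q dvd (e - 1) * (i - j) - (e * i - e * j)" by (rule dvd_diff[OF dvd_mult2[OF Q(4)]])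
    then have "Q dvd - (i - j)" by (simp add: algebra_simps)
    then show "[i = j] (mod Q)" by (simp only: dvd_minus_iff cong_iff_dvd_diff)
  next
    assume "[i = j] (mod Q)"
    then have "Q * Q' dvd (i - j) * e" using Q(5) by (intro mult_dvd_mono) (simp_all add: cong_iff_dvd_diff)
    then show "[e * i = e * j] (mod N)" by (simp add: Q(2) cong_iff_dvd_diff algebra_simps)
  qed
qed

lemma unitary_split:
  assumes "unitary (Q1 * Q2) e" "coprime Q1 Q2" "Q1 > 0" "Q2 > 0"
  obtains e1 e2 where "unitary Q1 e1" "unitary Q2 e2" "[e1 + e2 = e] (mod N)" "[e1 * e2 = 0] (mod N)"
proof -
  obtain Q' where Q: "N = Q1 * Q2 * Q'" "coprime (Q1 * Q2) Q'" "[e = 1] (mod (Q1 * Q2))" "[e = 0] (mod Q')"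
    using assms(1) by (auto simp: unitary_def)
  have c: "coprime Q1 (Q2 * Q')" "coprime Q2 (Q1 * Q')" using Q(2) assms(2) by (simp_all add: coprime_commute)
  obtain e1 where e1: "[e1 = 1] (mod Q1)" "[e1 = 0] (mod (Q2 * Q'))"
    using binary_chinese_remainder_int[OF c(1)] by blast
  obtain e2 where e2: "[e2 = 1] (mod Q2)" "[e2 = 0] (mod (Q1 * Q'))"
    using binary_chinese_remainder_int[OF c(2)] by blast
  have u: "unitary Q1 e1" "unitary Q2 e2"
    using assms(3,4) e1 e2 c Q(1) unfolding unitary_def
    by (auto intro: exI[of _ "Q2 * Q'"] exI[of _ "Q1 * Q'"] simp: mult_ac)
  have d: "Q1 dvd e1 - 1" "Q2 dvd e1" "Q' dvd e1" "Q2 dvd e2 - 1" "Q1 dvd e2" "Q' dvd e2"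
    using e1 e2 by (auto simp: cong_iff_dvd_diff dest: dvd_mult_left dvd_mult_right)
  have de: "Q1 dvd e - 1" "Q2 dvd e - 1" "Q' dvd e"
    using Q(3,4) by (auto simp: cong_iff_dvd_diff dest: dvd_mult_left dvd_mult_right)
  have "Q1 dvd (e1 - 1) + e2 - (e - 1)" "Q2 dvd e1 + (e2 - 1) - (e - 1)" "Q' dvd e1 + e2 - e"
    by (intro dvd_diff dvd_add d de)+
  then have "Q1 dvd e1 + e2 - e" "Q2 dvd e1 + e2 - e" "Q' dvd e1 + e2 - e" by (simp_all add: algebra_simps)
  then have "N dvd e1 + e2 - e" unfolding Q(1) using Q(2) assms(2) by (intro divides_mult) simp_all
  then have s: "[e1 + e2 = e] (mod N)" by (simp add: cong_iff_dvd_diff)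
  have "(Q2 * Q') * (Q1 * Q') dvd e1 * e2" using e1 e2 by (intro mult_dvd_mono) (simp_all add: cong_0_iff)
  then have "N * Q' dvd e1 * e2" by (simp add: Q(1) mult_ac)
  then have "[e1 * e2 = 0] (mod N)" unfolding cong_0_iff by (rule dvd_mult_left)
  then show ?thesis using that u s by blast
qed

definition rigid_at where
  "rigid_at e \<longleftrightarrow> (\<forall>b t b' t' w. [e * ((1 + b * t) * w) = e] (mod N) \<longrightarrow> [e * (b * t) = e * (b' * t')] (mod N) \<longrightarrow>
     Kw (e * b) (e * t) w = Kw (e * b') (e * t') w)"

lemma rigid_atI:
  assumes u: "unitary Q e"
    and "torus_system.rigid (\<lambda>i. X (e * i)) (\<lambda>i. Y (e * i)) Q"
  shows "rigid_at e"
  unfolding rigid_at_def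
proof (intro allI impI)
  fix b t b' t' w assume *: "[e * ((1 + b * t) * w) = e] (mod N)" "[e * (b * t) = e * (b' * t')] (mod N)"
  interpret L: torus_system "\<lambda>i. X (e * i)" "\<lambda>i. Y (e * i)" Q "\<lambda>u. torus (1 + e * (u - 1))"
    by (rule torus_system_idempotent[OF unitaryD(2,3)[OF u]])
  have K: "L.K b t w = Kw (e * b) (e * t) w" for b t w
    by (simp add: L.K_def Kw_def mult.assoc)
  have "[(1 + b * t) * w = 1] (mod Q)" "[b * t = b' * t'] (mod Q)"
    using * unitaryD(4)[OF u] by (metis mult_1_right, metis)
  then show "Kw (e * b) (e * t) w = Kw (e * b') (e * t') w"
    using assms(2) unfolding L.rigid_def K by blast
qed

text \<open>The commutator \<open>\<kappa>\<close> lies in \<open>torus 1\<close>, so it is central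
  and therefore bimultiplicative. It is killed by \<open>Q1\<close> in the first argument and by
  \<open>Q2\<close> in the second; passing the factor \<open>Q2\<close> from one argument to the
  other and using coprimality makes it trivial.\<close>

lemma X_Y_commute:
  assumes u: "unitary Q1 e1" "unitary Q2 e2" and c: "coprime Q1 Q2" and e: "[e1 * e2 = 0] (mod N)"
  shows "X (e1 * i) * Y (e2 * j) = Y (e2 * j) * X (e1 * i)"
proof -
  define \<kappa> where "\<kappa> i j = Kw (e1 * i) (e2 * j) 1" for i j
  have \<kappa>: "\<kappa> i j = Y (- (e2 * j)) * X (e1 * i) * Y (e2 * j) * X (- (e1 * i))" for i j
    by (simp add: \<kappa>_def Kw_def)
  have Xi: "X (- i) = inverse (X i)" "Y (- i) = inverse (Y i)" for i
    using X_add[of i "- i"] Y_add[of i "- i"] by (simp_all add: inverse_eqI)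
  have z: "[e1 * i * (e2 * j) = 0] (mod N)" for i j
    using cong_scalar_right[OF e, of "i * j"] by (simp add: mult_ac)
  have cen: "\<kappa> i j \<in> torus 1" for i j
  proof -
    have one: "[1 + e1 * i * (e2 * j) = 1 + 0] (mod N)" by (rule cong_add[OF cong_refl z])
    show ?thesis unfolding \<kappa>_def
      by (rule torus_cong[OF Kw_torus]) (use one in simp_all)
  qed
  have com: "\<kappa> i j * X k = X k * \<kappa> i j" "\<kappa> i j * Y k = Y k * \<kappa> i j" for i j k
    using torus_1_commute[OF cen] by (simp_all add: X_def Y_def)
  have add1: "\<kappa> (i + i') j = \<kappa> i j * \<kappa> i' j" for i i' j
  proof -
    have 1: "X (e1 * (i + i')) = X (e1 * i) * X (e1 * i')"
      "X (- (e1 * (i + i'))) = X (- (e1 * i')) * X (- (e1 * i))"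
      by (simp_all add: algebra_simps flip: X_add)
    have "\<kappa> (i + i') j = Y (- (e2 * j)) * X (e1 * i) * Y (e2 * j) * (\<kappa> i' j * X (- (e1 * i)))"
      unfolding \<kappa> 1 Xi by (simp add: mult.assoc group_inverse_mult)
    also have "\<dots> = \<kappa> i j * \<kappa> i' j" unfolding com by (simp add: \<kappa> mult.assoc)
    finally show ?thesis .
  qed
  have add2: "\<kappa> i (j + j') = \<kappa> i j * \<kappa> i j'" for i j j'
  proof -
    have 1: "Y (e2 * (j + j')) = Y (e2 * j) * Y (e2 * j')"
      "Y (- (e2 * (j + j'))) = Y (- (e2 * j')) * Y (- (e2 * j))"
      by (simp_all add: algebra_simps flip: Y_add)
    have "\<kappa> i (j + j') = Y (- (e2 * j')) * \<kappa> i j * (X (e1 * i) * Y (e2 * j') * X (- (e1 * i)))"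
      unfolding \<kappa> 1 Xi by (simp add: mult.assoc group_inverse_mult)
    also have "\<dots> = \<kappa> i j * \<kappa> i j'" unfolding com[symmetric] by (simp add: \<kappa> mult.assoc)
    finally show ?thesis .
  qed
  have zero: "\<kappa> 0 j = 1" "\<kappa> i 0 = 1" for i j by (simp_all add: \<kappa> Xi)
  have p: "\<kappa> (int n * i) j = \<kappa> i j ^ n" "\<kappa> i (int n * j) = \<kappa> i j ^ n" for n i j
    by (induction n) (simp_all add: zero add1 add2 distrib_right)
  have Q1: "\<kappa> (Q1 * i) j = 1" for i j
  proof -
    have "N dvd e1 * Q1 * i" using unitaryD(3)[OF u(1)] by simp
    then show ?thesis by (simp add: \<kappa> Xi X_eq_1 mult.assoc)
  qed
  have Q2: "\<kappa> i (Q2 * j) = 1" for i j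
  proof -
    have "N dvd e2 * Q2 * j" using unitaryD(3)[OF u(2)] by simp
    then show ?thesis by (simp add: \<kappa> Xi Y_eq_1 mult.assoc)
  qed
  obtain v where v: "[Q2 * v = 1] (mod Q1)" using cong_solve_coprime_int c by (metis coprime_commute)
  then obtain k where k: "Q2 * v = 1 + Q1 * k" by (auto simp: cong_iff_dvd_diff dvd_def algebra_simps)
  have n2: "int (nat Q2) = Q2" using unitaryD(1)[OF u(2)] by simp
  have "\<kappa> (Q2 * (v * i)) j = \<kappa> (v * i) (Q2 * j)" using p(1)[of "nat Q2" "v * i" j] p(2)[of "v * i" "nat Q2" j] by (simp only: n2)
  then have "\<kappa> (Q2 * (v * i)) j = 1" using Q2 by simp
  moreover have "Q2 * (v * i) = i + Q1 * (k * i)"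
    unfolding mult.assoc[of Q2, symmetric] k by (simp add: algebra_simps)
  ultimately have "\<kappa> i j = 1" using Q1 by (simp add: add1)
  then have "inverse (Y (e2 * j)) * (X (e1 * i) * Y (e2 * j)) * inverse (X (e1 * i)) = 1"
    by (simp add: \<kappa> Xi mult.assoc)
  then show ?thesis by (metis group_inverse_inverse inverse_eqI inverse_eqI' mult.assoc mult_inverse_cancel_left)
qed

lemma Kw_split:
  assumes u: "unitary Q1 e1" "unitary Q2 e2" and c: "coprime Q1 Q2" and e: "[e1 * e2 = 0] (mod N)"
    and s: "[e1 + e2 = e] (mod N)"
  shows "Kw (e * b) (e * t) w = Kw (e1 * b) (e1 * t) w * Kw (e2 * b) (e2 * t) w"
proof -
  have XY: "X (e1 * i) * Y (e2 * j) = Y (e2 * j) * X (e1 * i)" for i j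
    by (rule X_Y_commute[OF u c e])
  have YX: "Y (e1 * i) * X (e2 * j) = X (e2 * j) * Y (e1 * i)" for i j
    using X_Y_commute[OF u(2,1), of j i] c e by (simp add: mult.commute coprime_commute)
  have XX: "X i * X j = X j * X i" and YY: "Y i * Y j = Y j * Y i" for i j
    by (simp_all add: add.commute flip: X_add Y_add)
  note l = cong_scalar_right[OF cong_sym[OF s]]
  have K: "Kw (e * b) (e * t) w = Kw ((e1 + e2) * b) ((e1 + e2) * t) w"
    using l[of b] l[of t] l[of "b * w"] l[of "t * w"] by (intro Kw_cong) (simp_all add: mult.assoc)
  define x1 y1 x2 y2 where "x1 i = X (e1 * i)" and "y1 i = Y (e1 * i)"
    and "x2 i = X (e2 * i)" and "y2 i = Y (e2 * i)" for i
  note defs = x1_def y1_def x2_def y2_def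
  have 1: "x1 i * y2 j = y2 j * x1 i" "y1 i * x2 j = x2 j * y1 i"
    "x1 i * x2 j = x2 j * x1 i" "y1 i * y2 j = y2 j * y1 i" for i j
    using XY YX XX YY unfolding defs by blast+
  then have 2: "x1 i * (y2 j * g) = y2 j * (x1 i * g)" "y1 i * (x2 j * g) = x2 j * (y1 i * g)"
    "x1 i * (x2 j * g) = x2 j * (x1 i * g)" "y1 i * (y2 j * g) = y2 j * (y1 i * g)" for i j g
    by (simp_all only: mult.assoc[symmetric])
  have split: "X ((e1 + e2) * i) = x1 i * x2 i" "Y ((e1 + e2) * i) = y1 i * y2 i" for i
    by (simp_all add: defs distrib_right flip: X_add Y_add)
  have m: "- (f * j * w) = f * (- (j * w))" for f j :: int by simp
  have "Kw ((e1 + e2) * b) ((e1 + e2) * t) w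
      = y1 (- (t * w)) * y2 (- (t * w)) * (x1 b * x2 b) * (y1 t * y2 t) * (x1 (- (b * w)) * x2 (- (b * w)))"
    unfolding Kw_def m split ..
  also have "\<dots> = (y1 (- (t * w)) * x1 b * y1 t * x1 (- (b * w))) * (y2 (- (t * w)) * x2 b * y2 t * x2 (- (b * w)))"
    by (simp only: mult.assoc 1 2)
  also have "\<dots> = Kw (e1 * b) (e1 * t) w * Kw (e2 * b) (e2 * t) w"
    unfolding Kw_def m defs ..
  finally show ?thesis unfolding K .
qed

lemma rigid_at_add:
  assumes u: "unitary Q1 e1" "unitary Q2 e2" and c: "coprime Q1 Q2" and e: "[e1 * e2 = 0] (mod N)"
    and s: "[e1 + e2 = e'] (mod N)" and r: "rigid_at e1" "rigid_at e2"
  shows "rigid_at e'"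
proof -
  have ee: "[e1 * e' = e1] (mod N)" "[e2 * e' = e2] (mod N)"
  proof -
    have "[e1 * e' = e1 * (e1 + e2)] (mod N)" by (rule cong_scalar_left[OF cong_sym[OF s]])
    also have "[e1 * (e1 + e2) = e1] (mod N)"
      by (rule cong_combination[OF unitaryD(2)[OF u(1)] e, of _ _ 1 1]) (simp add: algebra_simps)
    finally show "[e1 * e' = e1] (mod N)" .
    have "[e2 * e' = e2 * (e1 + e2)] (mod N)" by (rule cong_scalar_left[OF cong_sym[OF s]])
    also have "[e2 * (e1 + e2) = e2] (mod N)"
      by (rule cong_combination[OF unitaryD(2)[OF u(2)] e, of _ _ 1 1]) (simp add: algebra_simps)
    finally show "[e2 * e' = e2] (mod N)" .
  qed
  have red: "[a = b] (mod N)" if "[e' * a' = e' * b'] (mod N)" "[f * e' = f] (mod N)" "a = f * a'" "b = f * b'"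
    for a b a' b' f
  proof -
    have "[f * a' = f * e' * a'] (mod N)" by (rule cong_scalar_right[OF cong_sym[OF that(2)]])
    also have "[f * e' * a' = f * e' * b'] (mod N)" using cong_scalar_left[OF that(1), of f] by (simp add: mult.assoc)
    also have "[f * e' * b' = f * b'] (mod N)" by (rule cong_scalar_right[OF that(2)])
    finally show ?thesis by (simp add: that)
  qed
  show ?thesis
    unfolding rigid_at_def
  proof (intro allI impI)
    fix b t b' t' w
    assume *: "[e' * ((1 + b * t) * w) = e'] (mod N)" "[e' * (b * t) = e' * (b' * t')] (mod N)"
    then have **: "[e' * ((1 + b * t) * w) = e' * 1] (mod N)" by simp
    have "[e1 * ((1 + b * t) * w) = e1] (mod N)" "[e2 * ((1 + b * t) * w) = e2] (mod N)"
      by (rule red[OF ** ee(1)]; simp) (rule red[OF ** ee(2)]; simp)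
    moreover have "[e1 * (b * t) = e1 * (b' * t')] (mod N)" "[e2 * (b * t) = e2 * (b' * t')] (mod N)"
      by (rule red[OF *(2) ee(1)]; simp) (rule red[OF *(2) ee(2)]; simp)
    ultimately have "Kw (e1 * b) (e1 * t) w = Kw (e1 * b') (e1 * t') w"
      "Kw (e2 * b) (e2 * t) w = Kw (e2 * b') (e2 * t') w"
      using r unfolding rigid_at_def by blast+
    then show "Kw (e' * b) (e' * t) w = Kw (e' * b') (e' * t') w"
      unfolding Kw_split[OF u c e s] by simp
  qed
qed

end

lemma prime_power_cofactor:
  fixes m q :: nat
  assumes "m > 0" "prime q"
  obtains n R where "m = q ^ n * R" "\<not> q dvd R" "R > 0" "q dvd m \<Longrightarrow> n > 0 \<and> R < m"
proof -
  have "m \<noteq> 0" "\<not> is_unit q" using assms not_prime_unit by auto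
  then obtain R where R: "m = q ^ multiplicity q m * R" "\<not> q dvd R"
    by (rule multiplicity_decompose')
  have "R > 0" using R assms(1) by (cases "R = 0") auto
  moreover have "multiplicity q m > 0 \<and> R < m" if "q dvd m"
  proof -
    have n: "multiplicity q m > 0" using R that by (cases "multiplicity q m") auto
    then have "1 < q ^ multiplicity q m" using prime_gt_1_nat[OF assms(2)] by (intro one_less_power) auto
    then have "1 * R < q ^ multiplicity q m * R" using \<open>R > 0\<close> by (rule mult_strict_right_mono)
    then show ?thesis using n R(1) by simp
  qed
  ultimately show ?thesis using that R by blast
qed

text \<open>The Chinese remainder theorem merges the arguments found for the separate primes, and
  \<open>cong\<close> carries the values along.\<close>

lemma exists_avoiding_residue:
  fixes f :: "int \<Rightarrow> int" and m :: nat
  assumes "m > 0"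
    and cong: "\<And>n i j. [i = j] (mod n) \<Longrightarrow> [f i = f j] (mod n)"
    and ex: "\<And>q. prime q \<Longrightarrow> q dvd m \<Longrightarrow> \<exists>k. \<not> int q dvd f k"
  shows "\<exists>k. coprime (f k) (int m)"
  using assms(1) ex
proof (induction m rule: less_induct)
  case (less m)
  show ?case
  proof (cases "m = 1")
    case True
    then show ?thesis by simp
  next
    case False
    then obtain q where q: "prime q" "q dvd m" using prime_factor_nat by blast
    obtain n R where nR: "m = q ^ n * R" "\<not> q dvd R" and R: "R > 0" "R < m" and n: "n > 0"
      using prime_power_cofactor[OF less.prems(1) q(1)] q(2) by metis
    obtain k1 where k1: "coprime (f k1) (int R)"
      using less.IH[OF R(2,1)] less.prems(2) nR(1) by (meson dvd_mult)
    obtain k2 where k2: "\<not> int q dvd f k2" using less.prems(2)[OF q] by blast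
    have "coprime (int q) (int R)" using nR(2) q(1) by (simp add: prime_imp_coprime)
    then obtain k where k: "[k = k2] (mod int q)" "[k = k1] (mod int R)"
      using binary_chinese_remainder_int by blast
    have "coprime (f k) (int R)" using cong_imp_coprime[OF cong_sym[OF cong[OF k(2)]]] k1 by simp
    moreover have "\<not> int q dvd f k" using cong_dvd_iff[OF cong[OF k(1)]] k2 by simp
    then have "coprime (f k) (int q ^ n)" using coprime_prime_power_iff[OF q(1) n] by blast
    ultimately show ?thesis by (auto simp: nR(1))
  qed
qed

context congruence_tower
begin

lemma rigid_at_prime_power:
  assumes u: "unitary (int q ^ n) e" and q: "prime q" "5 \<le> q" and n: "n > 0"
  shows "rigid_at e"
proof (rule rigid_atI[OF u])
  have q2: "2 < q" using q by simp
  let ?x = "\<lambda>i. X (e * i)" and ?y = "\<lambda>i. Y (e * i)" and ?F = "\<lambda>u. torus (1 + e * (u - 1))"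
  interpret L: torus_system ?x ?y "int q ^ n" ?F
    by (rule torus_system_idempotent[OF unitaryD(2,3)[OF u]])
  obtain g g' :: int where g: "[g * g' = 1] (mod int q ^ n)"
    "\<And>u. coprime u (int q ^ n) \<Longrightarrow> \<exists>i. [u = g ^ i] (mod int q ^ n)"
    using odd_prime_power_generator[OF q(1) q2] by blast
  interpret C: torus_system_commute ?x ?y "int q ^ n" ?F
  proof
    have gen: "\<exists>e i. [e * e = 1] (mod int q ^ n) \<and> [u = e * g ^ i] (mod int q ^ n)"
      if cu: "coprime u (int q ^ n)" for u
    proof -
      obtain i where "[u = g ^ i] (mod int q ^ n)" using g(2)[OF cu] ..
      then show ?thesis by (intro exI[of _ 1] exI[of _ i]) simp
    qed
    show "f * f' = f' * f" if "coprime u (int q ^ n)" "coprime v (int q ^ n)" "f \<in> ?F u" "f' \<in> ?F v"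
      for u v f f'
      by (rule L.F_commute_generated[OF g(1) gen that(1,3,2,4)])
  qed
  have "C.unit_rigid" by (rule C.unit_rigid_ge_5[OF q refl n])
  then show "L.rigid" by (rule C.rigid_odd_prime_power[OF _ q(1) q2 refl n])
qed

lemma rigid_at_trivial:
  assumes "unitary 1 e"
  shows "rigid_at e"
proof -
  have "N dvd e * i" for i using unitaryD(3)[OF assms] by simp
  then have "X (e * i) = 1" "Y (e * i) = 1" for i by (simp_all add: X_eq_1 Y_eq_1)
  then have "Kw (e * b) (e * t) w = 1" for b t w
    using X_eq_1[of "- (e * b * w)"] Y_eq_1[of "- (e * t * w)"] \<open>\<And>i. N dvd e * i\<close>
    by (simp add: Kw_def mult.assoc)
  then show ?thesis by (simp add: rigid_at_def)
qed

lemma rigid_at_coprime_6: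
  assumes "unitary (int Q) e" "coprime Q 6"
  shows "rigid_at e"
  using assms
proof (induction Q arbitrary: e rule: less_induct)
  case (less Q)
  show ?case
  proof (cases "Q = 1")
    case True
    then show ?thesis using less.prems rigid_at_trivial by simp
  next
    case False
    have Q0: "Q > 0" using unitaryD(1)[OF less.prems(1)] by simp
    from False obtain q where q: "prime q" "q dvd Q" using prime_factor_nat by blast
    obtain n R where nR: "Q = q ^ n * R" "\<not> q dvd R" and R: "R > 0" "R < Q" and n: "n > 0"
      using prime_power_cofactor[OF Q0 q(1)] q(2) by metis
    have c6: "coprime q 6" "coprime R 6" using less.prems(2) nR(1) n by simp_all
    have "q \<ge> 5"
    proof -
      have "q \<ge> 2" using q(1) by (rule prime_ge_2_nat)
      moreover have "q \<noteq> 2" "q \<noteq> 3" "q \<noteq> 4" using c6(1) coprime_common_divisor[of q 6 2] coprime_common_divisor[of q 6 3]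
        by auto
      ultimately show ?thesis by linarith
    qed
    have cop: "coprime (int q ^ n) (int R)" using nR(2) q(1) by (simp add: prime_imp_coprime)
    have "unitary (int q ^ n * int R) e" using less.prems(1) by (simp add: nR(1))
    then obtain e1 e2 where e: "unitary (int q ^ n) e1" "unitary (int R) e2"
      "[e1 + e2 = e] (mod N)" "[e1 * e2 = 0] (mod N)"
      by (rule unitary_split[OF _ cop]) (use q(1) R prime_gt_0_nat in auto)
    have "rigid_at e1" by (rule rigid_at_prime_power[OF e(1) q(1) \<open>q \<ge> 5\<close> n])
    moreover have "rigid_at e2" by (rule less.IH[OF R(2) e(2) c6(2)])
    ultimately show ?thesis by (rule rigid_at_add[OF e(1,2) cop e(4,3)])
  qed
qed

text \<open>These words are equal already as integer matrices, so no central ambiguity can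
  arise.\<close>

lemma Kw_minus_1:
  "Kw 1 (-2) (-1) = r (-1) 0 0 (-1)" "Kw (-1) 2 (-1) = r (-1) 0 0 (-1)" "Kw (-2) 1 (-1) = r (-1) 0 0 (-1)"
  by (simp_all add: Kw_eq)

text \<open>Both words have upper left entry \<open>1 + 1 * 2 = p\<close>, where
  \<open>prime_power_row_unique\<close> removes the central ambiguity.\<close>

lemma Kw_p:
  assumes "[p * w = 1] (mod N)" "p = 3"
  shows "Kw 1 2 w = Kw (-1) (-2) w"
proof -
  have w: "[(1 + 1 * 2) * w = 1] (mod N)" "[(1 + (-1) * (-2)) * w = 1] (mod N)" using assms by simp_all
  have "r (p ^ 1) (1 - 1 * w * (1 + 1 * 2)) (2 - 2 * w * (1 + 1 * 2)) (1 - 1 * w * 2 - 2 * w * (1 - 1 * w * (1 + 1 * 2)))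
    = r (p ^ 1) (-1 - -1 * w * (1 + (-1) * (-2))) (-2 - -2 * w * (1 + (-1) * (-2)))
       (1 - -1 * w * -2 - -2 * w * (-1 - -1 * w * (1 + (-1) * (-2))))"
    by (rule prime_power_row_unique)
      (use Kw_det[of 1 2 w] Kw_det[of "-1" "-2" w] Kw_dvd[OF w(1)] Kw_dvd[OF w(2)] assms(2) in simp_all)
  then show ?thesis unfolding Kw_eq using assms(2) by simp
qed

text \<open>The equalities between words are available only at the full level \<open>N\<close>. The
  complementary component is rigid already, so its factor in \<open>Kw_split\<close> is the same on
  both sides and cancels. \<open>5 - p\<close> is the other element of {2, 3}.\<close>

lemma rigid_at_special:
  assumes u: "unitary Q' e'" "unitary (q0 ^ n) e0" "coprime Q' (q0 ^ n)" "[e' * e0 = 0] (mod N)"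
    "[e' + e0 = 1] (mod N)"
    and r: "rigid_at e'" and n: "n > 0" and q0: "q0 = 5 - p"
  shows "rigid_at e0"
proof (rule rigid_atI[OF u(2)])
  let ?x = "\<lambda>i. X (e0 * i)" and ?y = "\<lambda>i. Y (e0 * i)" and ?F = "\<lambda>u. torus (1 + e0 * (u - 1))"
  interpret L: torus_system ?x ?y "q0 ^ n" ?F
    by (rule torus_system_idempotent[OF unitaryD(2,3)[OF u(2)]])
  have K: "L.K b t w = Kw (e0 * b) (e0 * t) w" for b t w
    by (simp add: L.K_def Kw_def mult.assoc)
  have transfer: "L.K b t w = L.K b' t' w"
    if "Kw b t w = Kw b' t' w" "[(1 + b * t) * w = 1] (mod N)" "b * t = b' * t'" for b t b' t' w
  proof -
    have "Kw (e' * b) (e' * t) w = Kw (e' * b') (e' * t') w"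
      using r that(2,3) cong_scalar_left[OF that(2), of e'] unfolding rigid_at_def by (metis cong_refl mult_1_right)
    then show ?thesis
      using that(1) Kw_split[OF u, of b t w] Kw_split[OF u, of b' t' w] by (simp add: K group_left_cancel)
  qed
  have K1: "L.K (-1) 2 (-1) = L.K 1 (-2) (-1)" by (rule transfer) (simp_all add: Kw_minus_1)
  show "L.rigid"
    using p
  proof
    assume p2: "p = 2"
    then have q3: "q0 = 3" using q0 by simp
    have 3: "prime (3::nat)" "2 < (3::nat)" by simp_all
    obtain g g' :: int where g: "[g * g' = 1] (mod int 3 ^ n)"
      "\<And>u. coprime u (int 3 ^ n) \<Longrightarrow> \<exists>i. [u = g ^ i] (mod int 3 ^ n)"
      using odd_prime_power_generator[OF 3] by blast
    then have g: "[g * g' = 1] (mod q0 ^ n)"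
      "\<And>u. coprime u (q0 ^ n) \<Longrightarrow> \<exists>i. [u = g ^ i] (mod q0 ^ n)"
      by (simp_all add: q3)
    interpret C: torus_system_commute ?x ?y "q0 ^ n" ?F
    proof
      have gen: "\<exists>e i. [e * e = 1] (mod q0 ^ n) \<and> [u = e * g ^ i] (mod q0 ^ n)"
        if cu: "coprime u (q0 ^ n)" for u
      proof -
        obtain i where "[u = g ^ i] (mod q0 ^ n)" using g(2)[OF cu] ..
        then show ?thesis by (intro exI[of _ 1] exI[of _ i]) simp
      qed
      show "f * f' = f' * f" if "coprime u (q0 ^ n)" "coprime v (q0 ^ n)" "f \<in> ?F u" "f' \<in> ?F v"
        for u v f f'
        by (rule L.F_commute_generated[OF g(1) gen that(1,3,2,4)])
    qed
    have "C.unit_rigid" by (rule C.unit_rigid_3[OF _ n K1]) (simp add: q3)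
    then show "L.rigid" by (rule C.rigid_odd_prime_power[OF _ 3 _ n]) (simp add: q3)
  next
    assume p3: "p = 3"
    then have q2: "q0 = 2" using q0 by simp
    obtain w where w: "[p * w = 1] (mod N)" using p_N cong_solve_coprime_int by blast
    have "[3 * iw = 1] (mod q0 ^ n) \<Longrightarrow> L.K 1 2 iw = L.K (-1) (-2) iw" for iw
    proof -
      assume iw: "[3 * iw = 1] (mod q0 ^ n)"
      have "q0 ^ n dvd N" using u(2) by (auto simp: unitary_def)
      from cong_dvd_modulus[OF w this] have w3: "[3 * w = 1] (mod q0 ^ n)" by (simp add: p3)
      have "[iw * (3 * w) = iw * 1] (mod q0 ^ n)" by (rule cong_scalar_left[OF w3])
      moreover have "[3 * iw * w = 1 * w] (mod q0 ^ n)" by (rule cong_scalar_right[OF iw])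
      ultimately have iw': "[iw = w] (mod q0 ^ n)" by (metis cong_sym cong_trans mult.assoc mult.commute mult_1)
      have "L.K 1 2 w = L.K (-1) (-2) w"
        by (rule transfer[OF Kw_p[OF w p3]]) (use w p3 in simp_all)
      then show "L.K 1 2 iw = L.K (-1) (-2) iw"
        using L.K_cong[OF cong_refl cong_refl iw'] by simp
    qed
    note K3 = this
    have g: "[3 * w = 1] (mod q0 ^ n)"
    proof -
      have "q0 ^ n dvd N" using u(2) by (auto simp: unitary_def)
      from cong_dvd_modulus[OF w this] show ?thesis by (simp add: p3)
    qed
    interpret C: torus_system_commute ?x ?y "q0 ^ n" ?F
    proof
      have gen: "\<exists>e i. [e * e = 1] (mod q0 ^ n) \<and> [u = e * 3 ^ i] (mod q0 ^ n)"
        if "coprime u (q0 ^ n)" for u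
      proof -
        have "odd u" using that n by (simp add: q2)
        then obtain e i where "e \<in> {1, -1}" "[u = e * 3 ^ i] (mod 2 ^ n)"
          using two_power_generator by blast
        then show ?thesis by (intro exI[of _ e] exI[of _ i]) (auto simp: q2)
      qed
      show "f * f' = f' * f" if "coprime u (q0 ^ n)" "coprime v (q0 ^ n)" "f \<in> ?F u" "f' \<in> ?F v"
        for u v f f'
        by (rule L.F_commute_generated[OF g gen that(1,3,2,4)])
    qed
    have Q: "q0 ^ n = 2 ^ n" by (simp add: q2)
    have ur: "C.unit_rigid" by (rule C.unit_rigid_2[OF Q n K1 K3])
    show "L.rigid"
    proof (rule C.rigid_2[OF ur Q n])
      show "L.K (-2) 1 (-1) = L.K 1 (-2) (-1)" by (rule transfer) (simp_all add: Kw_minus_1)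
      show "J * X (e0 * i) = Y (e0 * - i) * J" "J * Y (e0 * i) = X (e0 * - i) * J" for i
        by (simp_all add: J_X J_Y)
    qed
  qed
qed

lemma rigid_at_1: "rigid_at 1"
proof -
  define q0 where "q0 = 5 - p"
  have q0: "prime (nat q0)" "int (nat q0) = q0" "q0 * p = 6" "q0 > 0" using p by (auto simp: q0_def)
  have "nat N > 0" using N_pos by simp
  from this q0(1) obtain n R where nR: "nat N = nat q0 ^ n * R" "\<not> nat q0 dvd R" and "R > 0"
    by (rule prime_power_cofactor)
  have "int (nat N) = int (nat q0 ^ n * R)" by (simp only: nR(1))
  then have N: "N = int R * q0 ^ n" using N_pos q0(2) by (simp add: mult.commute)
  have c0: "coprime (int R) q0"
    using nR(2) q0 prime_imp_coprime[of "nat q0" R] by (metis coprime_commute coprime_int_iff)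
  have cR: "coprime (int R) p" using p_N N by (simp add: coprime_commute)
  have "coprime (int R) (q0 * p)" using c0 cR by simp
  then have "coprime (int R) (int 6)" using q0(3) by simp
  then have R6: "coprime R 6" by (simp only: coprime_int_iff)
  show ?thesis
  proof (cases "n = 0")
    case True
    then have "N = int R * 1" using N by simp
    then have "unitary (int R) 1"
      unfolding unitary_def using \<open>R > 0\<close> by (intro conjI exI[of _ 1]) simp_all
    then show ?thesis using R6 by (rule rigid_at_coprime_6)
  next
    case False
    have c: "coprime (int R) (q0 ^ n)" using c0 by simp
    have "N = int R * q0 ^ n * 1" using N by simp
    then have "unitary (int R * q0 ^ n) 1"
      unfolding unitary_def using N_pos by (intro conjI exI[of _ 1]) simp_all
    then obtain e' e0 where e: "unitary (int R) e'" "unitary (q0 ^ n) e0"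
      "[e' + e0 = 1] (mod N)" "[e' * e0 = 0] (mod N)"
      by (rule unitary_split[OF _ c]) (use \<open>R > 0\<close> q0 in auto)
    have r: "rigid_at e'" by (rule rigid_at_coprime_6[OF e(1) R6])
    have "rigid_at e0"
      by (rule rigid_at_special[OF e(1,2) c e(4,3) r _ q0_def]) (use False in simp)
    with r show ?thesis by (rule rigid_at_add[OF e(1,2) c e(4,3)])
  qed
qed

lemma rigid: "[(1 + b * t) * w = 1] (mod N) \<Longrightarrow> [b * t = b' * t'] (mod N) \<Longrightarrow> Kw b t w = Kw b' t' w"
  using rigid_at_1 unfolding rigid_at_def mult_1 by blast

end

section \<open>Normal form of the image\<close>

lemma cong_combination_eq:
  fixes n :: int
  assumes "[h1 = k1] (mod n)" "[h2 = k2] (mod n)" "h3 = k3"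
    "e1 - e2 = A * (h1 - k1) + B * (h2 - k2) + C * (h3 - k3)"
  shows "[e1 = e2] (mod n)"
  by (rule cong_combination[OF assms(1,2)]) (use assms(3,4) in simp)

context congruence_tower
begin

definition diag where "diag u w = Kw 1 (u - 1) w"

lemma diag_torus: "[u * w = 1] (mod N) \<Longrightarrow> diag u w \<in> torus u"
  using Kw_torus[of 1 "u - 1" w] by (simp add: diag_def)

lemma diag_cong: "[u = u'] (mod N) \<Longrightarrow> [w = w'] (mod N) \<Longrightarrow> diag u w = diag u' w'"
  unfolding diag_def by (intro Kw_cong cong_mult cong_diff cong_refl)

lemma diag_1: "diag 1 1 = 1"
  using X_add[of 1 "- 1"] by (simp add: diag_def Kw_def)

lemma X_Y:
  assumes "[(1 + b * t) * w = 1] (mod N)"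
  shows "X b * Y t = Y (t * w) * diag (1 + b * t) w * X (b * w)"
proof -
  have "diag (1 + b * t) w = Kw b t w"
    unfolding diag_def by (rule rigid) (use assms in simp_all)
  moreover have "Y (t * w) * (Y (- (t * w)) * g) = g" for g
    using Y_add[of "t * w" "- (t * w)"] by (simp flip: mult.assoc)
  moreover have "g * X (- (b * w)) * X (b * w) = g" for g
    using X_add[of "- (b * w)" "b * w"] by (simp add: mult.assoc)
  ultimately show ?thesis by (simp add: Kw_def mult.assoc)
qed

text \<open>\<open>K_add_right\<close> for \<open>b = 1\<close> produces a second factor with
  parameters \<open>w\<close> and \<open>u * (v - 1)\<close>; rigidity replaces them by 1 and
  \<open>v - 1\<close>.\<close>

lemma diag_mult:
  assumes "[u * w = 1] (mod N)" "[v * w' = 1] (mod N)"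
  shows "diag u w * diag v w' = diag (u * v) (w * w')"
proof -
  interpret L: torus_system "\<lambda>i. X (1 * i)" "\<lambda>i. Y (1 * i)" N "\<lambda>u. torus (1 + 1 * (u - 1))"
    by (rule torus_system_idempotent) simp_all
  have K: "L.K b t w = Kw b t w" for b t w
    unfolding L.K_def Kw_def by simp
  have 1: "[(1 + 1 * w * (u * (v - 1))) * w' = 1] (mod N)"
    by (rule cong_combination[OF assms, of _ _ "- w' + v * w'" 1]) (simp add: algebra_simps)
  have "Kw w (u * (v - 1)) w' = Kw 1 (v - 1) w'"
    by (rule rigid)
      (use 1 cong_scalar_right[OF assms(1), of "v - 1"] in \<open>simp_all add: mult_ac\<close>)
  moreover have "Kw 1 (u * v - 1) (w * w') = Kw 1 (u - 1) w * Kw w (u * (v - 1)) w'"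
    using L.K_add_right[OF _ 1, of "u - 1"] assms(1) unfolding K by (simp add: algebra_simps)
  ultimately show ?thesis by (simp add: diag_def)
qed

lemma X_diag:
  assumes "[u * w = 1] (mod N)"
  shows "X s * diag u w = diag u w * X (w ^ 2 * s)"
proof -
  have "[u ^ 2 * (w ^ 2 * s) = s] (mod N)"
    using cong_scalar_right[OF cong_pow[OF assms, of 2], of s] by (simp add: power_mult_distrib mult_ac)
  from X_cong[OF this] show ?thesis using torus_X_shift[OF diag_torus[OF assms], of "w ^ 2 * s"] by simp
qed

lemma diag_Y: "[u * w = 1] (mod N) \<Longrightarrow> diag u w * Y s = Y (w ^ 2 * s) * diag u w"
  by (rule torus_Y_shift[OF diag_torus])

text \<open>Not every matrix lies in the big cell modulo \<open>N\<close>; left multiplication by a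
  suitable \<open>X k\<close> makes the upper left entry \<open>a + k * c\<close> a unit.\<close>

definition factored where
  "factored a b c d k w \<longleftrightarrow> X k * r a b c d = Y (c * w) * diag (a + k * c) w * X ((b + k * d) * w)"

text \<open>The extra factor \<open>X (k - k0)\<close> is moved through the decomposition by
  \<open>X_Y\<close> and absorbed by \<open>diag_mult\<close>. Hence each later step may choose its
  own \<open>k\<close>.\<close>

lemma factored_shift:
  assumes det: "a * d - b * c = 1" and f: "factored a b c d k0 w0" and w0: "[(a + k0 * c) * w0 = 1] (mod N)"
    and w: "[(a + k * c) * w = 1] (mod N)"
  shows "factored a b c d k w"
proof -
  define i u \<beta> where "i = k - k0" and "u = a + k0 * c" and "\<beta> = b + k0 * d"
  have k: "k = i + k0" "a + k * c = u + i * c" "b + k * d = \<beta> + i * d"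
    by (simp_all add: i_def u_def \<beta>_def algebra_simps)
  have det': "u * d - \<beta> * c = 1" using det by (simp add: u_def \<beta>_def algebra_simps)
  note w0 = w0[folded u_def] and w = w[unfolded k(2)]
  have inv: "[(1 + i * (c * w0)) * (w * u) = 1] (mod N)"
    by (rule cong_combination[OF w0 w, of _ _ "1 - u * w" "u * w0"]) (simp add: algebra_simps)
  have e1: "[c * w0 * (w * u) = c * w] (mod N)"
    by (rule cong_combination[OF w0 w, of _ _ "c * w" 0]) (simp add: algebra_simps)
  have e2: "[1 + i * (c * w0) = (u + i * c) * w0] (mod N)"
    by (rule cong_combination[OF w0 w, of _ _ "- 1" 0]) (simp add: algebra_simps)
  have e3: "[w0 ^ 2 * (i * (w * u)) + \<beta> * w0 = (\<beta> + i * d) * w] (mod N)"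
    by (rule cong_combination_eq[OF w0 w det', of _ _ "\<beta> * w + d * i * w + i * w * w0" "- \<beta> * w0" "- i * w * w0"])
      (simp add: algebra_simps power2_eq_square)
  have inv2: "[((u + i * c) * w0) * (w * u) = 1] (mod N)"
    using cong_mult[OF w0 w] by (simp add: mult_ac)
  have e4: "[(u + i * c) * w0 * u = u + i * c] (mod N)" "[w * u * w0 = w] (mod N)"
    using cong_scalar_left[OF w0, of "u + i * c"] cong_scalar_left[OF w0, of w] by (simp_all add: mult_ac)
  have "X k * r a b c d = X i * (X k0 * r a b c d)"
    by (simp add: k(1) X_add mult.assoc)
  also have "\<dots> = X i * Y (c * w0) * (diag u w0 * X (\<beta> * w0))"
    using f by (simp add: factored_def u_def \<beta>_def mult.assoc)
  also have "X i * Y (c * w0) = Y (c * w0 * (w * u)) * diag (1 + i * (c * w0)) (w * u) * X (i * (w * u))"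
    by (rule X_Y[OF inv])
  also have "\<dots> * (diag u w0 * X (\<beta> * w0))
      = Y (c * w0 * (w * u)) * diag (1 + i * (c * w0)) (w * u) * (X (i * (w * u)) * diag u w0) * X (\<beta> * w0)"
    by (simp only: mult.assoc)
  also have "\<dots> = Y (c * w0 * (w * u)) * (diag (1 + i * (c * w0)) (w * u) * diag u w0)
      * (X (w0 ^ 2 * (i * (w * u))) * X (\<beta> * w0))"
    by (simp only: X_diag[OF w0] mult.assoc)
  also have "\<dots> = Y (c * w0 * (w * u)) * diag ((u + i * c) * w0 * u) (w * u * w0)
      * X (w0 ^ 2 * (i * (w * u)) + \<beta> * w0)"
    by (simp only: diag_cong[OF e2 cong_refl] diag_mult[OF inv2 w0] X_add)
  also have "\<dots> = Y (c * w) * diag (u + i * c) w * X ((\<beta> + i * d) * w)"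
    by (simp only: Y_cong[OF e1] diag_cong[OF e4] X_cong[OF e3])
  finally show ?thesis by (simp only: factored_def k(2,3))
qed

definition normal_form where
  "normal_form a b c d \<longleftrightarrow> (\<forall>k w. [(a + k * c) * w = 1] (mod N) \<longrightarrow> factored a b c d k w)"

lemma normal_form_1: "normal_form 1 0 0 1"
  unfolding normal_form_def
proof (intro allI impI)
  fix k w assume w: "[(1 + k * 0) * w = 1] (mod N)"
  have "factored 1 0 0 1 0 1" by (simp add: factored_def diag_1)
  then show "factored 1 0 0 1 k w" by (rule factored_shift[rotated]) (use w in simp_all)
qed

lemma normal_form_X:
  assumes det: "a * d - b * c = 1" and nf: "normal_form a b c d"
  shows "normal_form a (b + n * a) c (d + n * c)"
  unfolding normal_form_def
proof (intro allI impI)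
  fix k w assume w: "[(a + k * c) * w = 1] (mod N)"
  have e: "[(b + k * d) * w + n = (b + n * a + k * (d + n * c)) * w] (mod N)"
    by (rule cong_combination[OF w w, of _ _ "- n" 0]) (simp add: algebra_simps)
  have "factored a b c d k w" using nf w by (simp add: normal_form_def)
  then have "X k * r a b c d * X n = Y (c * w) * diag (a + k * c) w * X ((b + k * d) * w + n)"
    by (simp add: factored_def X_add mult.assoc)
  then show "factored a (b + n * a) c (d + n * c) k w"
    by (simp add: factored_def mult.assoc r_X[OF det] X_cong[OF e])
qed

text \<open>The step needs a common \<open>k\<close> for which the upper left entries before and after it are both units;
  modulo 2 there is none if \<open>c\<close> is odd and \<open>d\<close> is even. Then the braid relation replaces \<open>Y n\<close> by
  \<open>X n * Y n * X (- n) * Y n * X n\<close>, all of whose steps are possible.\<close>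

lemma normal_form_Y:
  assumes det: "a * d - b * c = 1" and nf: "normal_form a b c d"
    and n: "n = 1 \<or> n = -1" and good: "even c \<or> odd d"
  shows "normal_form (a + n * b) b (c + n * d) d"
proof -
  define f where "f k = (a + k * c) * (a + n * b + k * (c + n * d))" for k
  have root: "int q dvd \<gamma> * (k - k')"
    if "int q dvd \<alpha> + k * \<gamma>" "int q dvd \<alpha> + k' * \<gamma>" for q \<alpha> \<gamma> k k'
    using dvd_diff[OF that] by (simp add: algebra_simps)
  have det2: "(a + n * b) * d - b * (c + n * d) = 1" using det by (simp add: algebra_simps)
  have ex: "\<exists>k. \<not> int q dvd f k" if q: "prime q" for q
  proof (rule ccontr)
    assume "\<not> ?thesis"
    then have all: "int q dvd a + k * c \<or> int q dvd a + n * b + k * (c + n * d)" for k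
      using q by (simp add: f_def prime_dvd_mult_iff)
    have coprime_col: False
      if "\<alpha> * d' - \<beta> * \<gamma> = 1" "int q dvd \<alpha> + k * \<gamma>" "int q dvd \<alpha> + k' * \<gamma>" "coprime (int q) (k - k')"
      for \<alpha> \<beta> \<gamma> d' k k' :: int
    proof -
      have "int q dvd \<gamma>" using root[OF that(2,3)] that(4) by (simp add: coprime_dvd_mult_left_iff)
      moreover from this that(2) have "int q dvd \<alpha>" by (metis dvd_add_left_iff dvd_mult)
      ultimately have "int q dvd 1" using that(1) by (metis dvd_diff dvd_mult dvd_mult2)
      then show False using q by simp
    qed
    show False
    proof (cases "q = 2")
      case True
      have "odd (a * d - b * c)" using det by simp
      then show False using all[of 0] all[of 1] good n True by auto
    next
      case False
      have "odd q" using False q prime_odd_nat[of q] prime_ge_2_nat[of q] by linarith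
      then have c: "coprime (int q) 1" "coprime (int q) 2" "coprime (int q) (-1)" "coprime (int q) (-2)" by simp_all
      have "\<not> (int q dvd a + k * c \<and> int q dvd a + k' * c)"
        "\<not> (int q dvd a + n * b + k * (c + n * d) \<and> int q dvd a + n * b + k' * (c + n * d))"
        if "coprime (int q) (k - k')" for k k'
        using coprime_col[OF det _ _ that] coprime_col[OF det2 _ _ that] by blast+
      \<comment> \<open>Pigeonhole: modulo an odd prime each of the two linear forms vanishes for at
        most one of the values 0, 1, 2 of \<open>k\<close>.\<close>
      from this[of 0 1] this[of 0 2] this[of 1 2] show False
        using all[of 0] all[of 1] all[of 2] c by auto
    qed
  qed
  have cong: "[f i = f j] (mod m)" if "[i = j] (mod m)" for m i j
    unfolding f_def by (intro cong_mult cong_add cong_refl that)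
  have "nat N > 0" using N_pos by simp
  then have "\<exists>k. coprime (f k) (int (nat N))" using cong ex by (rule exists_avoiding_residue)
  then obtain k where "coprime (f k) N" using N_pos by auto
  then have "coprime (a + k * c) N" "coprime (a + n * b + k * (c + n * d)) N" by (simp_all add: f_def)
  then obtain w z where w: "[(a + k * c) * w = 1] (mod N)" and z: "[(a + n * b + k * (c + n * d)) * z = 1] (mod N)"
    using cong_solve_coprime_int by meson
  define u \<beta> where "u = a + k * c" and "\<beta> = b + k * d"
  have k: "a + n * b + k * (c + n * d) = u + n * \<beta>"
    by (simp_all add: u_def \<beta>_def algebra_simps)
  have det': "u * d - \<beta> * c = 1" using det by (simp add: u_def \<beta>_def algebra_simps)
  note w' = w[folded u_def] and z' = z[unfolded k]
  have inv: "[(1 + \<beta> * w * n) * (u * z) = 1] (mod N)"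
    by (rule cong_combination[OF w' z', of _ _ "1 - u * z" "u * w"]) (simp add: algebra_simps)
  have e1: "[1 + \<beta> * w * n = w * (u + n * \<beta>)] (mod N)"
    by (rule cong_combination[OF w' z', of _ _ "- 1" 0]) (simp add: algebra_simps)
  have e2: "[c * w + w ^ 2 * (n * (u * z)) = (c + n * d) * z] (mod N)"
    by (rule cong_combination_eq[OF w' z' det', of _ _ "c * z + d * n * z + n * w * z" "- c * w" "- n * w * z"])
      (simp add: algebra_simps power2_eq_square)
  have inv2: "[w * (u + n * \<beta>) * (u * z) = 1] (mod N)"
    using cong_mult[OF w' z'] by (simp add: mult_ac)
  have e3: "[u * (w * (u + n * \<beta>)) = u + n * \<beta>] (mod N)" "[w * (u * z) = z] (mod N)"
    "[\<beta> * w * (u * z) = \<beta> * z] (mod N)"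
    using cong_scalar_right[OF w', of "u + n * \<beta>"] cong_scalar_right[OF w', of z]
      cong_scalar_right[OF w', of "\<beta> * z"] by (simp_all add: mult_ac)
  have "X k * r (a + n * b) b (c + n * d) d = X k * r a b c d * Y n"
    by (simp add: r_Y[OF det] mult.assoc)
  also have "X k * r a b c d = Y (c * w) * diag u w * X (\<beta> * w)"
    using nf w by (simp add: normal_form_def factored_def u_def \<beta>_def)
  also have "\<dots> * Y n = Y (c * w) * diag u w * (X (\<beta> * w) * Y n)" by (simp only: mult.assoc)
  also have "X (\<beta> * w) * Y n = Y (n * (u * z)) * diag (1 + \<beta> * w * n) (u * z) * X (\<beta> * w * (u * z))"
    by (rule X_Y[OF inv])
  also have "Y (c * w) * diag u w * \<dots>
      = Y (c * w) * (diag u w * Y (n * (u * z))) * diag (1 + \<beta> * w * n) (u * z) * X (\<beta> * w * (u * z))"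
    by (simp only: mult.assoc)
  also have "\<dots> = (Y (c * w) * Y (w ^ 2 * (n * (u * z)))) * (diag u w * diag (w * (u + n * \<beta>)) (u * z))
      * X (\<beta> * w * (u * z))"
    unfolding diag_Y[OF w'] diag_cong[OF e1 cong_refl] by (simp only: mult.assoc)
  also have "\<dots> = Y ((c + n * d) * z) * diag (u + n * \<beta>) z * X (\<beta> * z)"
    by (simp only: diag_mult[OF w' inv2] Y_add[symmetric] Y_cong[OF e2] diag_cong[OF e3(1,2)] X_cong[OF e3(3)])
  finally have f: "factored (a + n * b) b (c + n * d) d k z" unfolding factored_def k \<beta>_def .
  show ?thesis
    unfolding normal_form_def using factored_shift[OF det2 f z] by blast
qed

lemma normal_form_Y':
  assumes det: "a * d - b * c = 1" and nf: "normal_form a b c d" and n: "n = 1 \<or> n = -1"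
  shows "normal_form (a + n * b) b (c + n * d) d"
proof (cases "even c \<or> odd d")
  case True
  then show ?thesis by (rule normal_form_Y[OF assms])
next
  case False
  define b1 d1 where "b1 = b + n * a" and "d1 = d + n * c"
  define a2 c2 where "a2 = a + n * b1" and "c2 = c + n * d1"
  define b3 d3 where "b3 = b1 + - n * a2" and "d3 = d1 + - n * c2"
  define a4 c4 where "a4 = a2 + n * b3" and "c4 = c2 + n * d3"
  note defs = b1_def d1_def a2_def c2_def b3_def d3_def a4_def c4_def
  have n2: "n * n = 1" "odd n" using n by auto
  have d: "a * d1 - b1 * c = 1" "a2 * d1 - b1 * c2 = 1" "a2 * d3 - b3 * c2 = 1" "a4 * d3 - b3 * c4 = 1"
    using det by (simp_all add: defs algebra_simps)
  have "normal_form a b1 c d1" unfolding b1_def d1_def by (rule normal_form_X[OF det nf])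
  then have "normal_form a2 b1 c2 d1" unfolding a2_def c2_def
    by (rule normal_form_Y[OF d(1) _ n]) (use False n2 in \<open>simp add: d1_def\<close>)
  then have "normal_form a2 b3 c2 d3" unfolding b3_def d3_def by (rule normal_form_X[OF d(2)])
  then have "normal_form a4 b3 c4 d3" unfolding a4_def c4_def
    by (rule normal_form_Y[OF d(3) _ n]) (use False n2 in \<open>simp add: c2_def d1_def\<close>)
  then have "normal_form a4 (b3 + n * a4) c4 (d3 + n * c4)" by (rule normal_form_X[OF d(4)])
  moreover have "a4 = a + n * b" "c4 = c + n * d" "b3 + n * a4 = b" "d3 + n * c4 = d"
    using n by (auto simp: defs)
  ultimately show ?thesis by simp
qed

lemma normal_form:
  assumes "a * d - b * c = 1"
  shows "normal_form a b c d"
  using assms normal_form_1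
proof (rule SL2_induct_right[where P = normal_form])
  fix a b c d :: int assume *: "a * d - b * c = 1" "normal_form a b c d"
  show "normal_form a (b + a) c (d + c)" "normal_form a (b - a) c (d - c)"
    using normal_form_X[OF *, of 1] normal_form_X[OF *, of "-1"] by simp_all
  show "normal_form (a + b) b (c + d) d" "normal_form (a - b) b (c - d) d"
    using normal_form_Y'[OF *, of 1] normal_form_Y'[OF *, of "-1"] by simp_all
qed

theorem congruence_kernel:
  assumes "a * d - b * c = 1" "N dvd b" "N dvd c" "[a = 1] (mod N)"
  shows "r a b c d = 1"
proof -
  have "factored a b c d 0 1" using normal_form[OF assms(1)] assms(4) by (simp add: normal_form_def)
  then have "r a b c d = Y c * diag a 1 * X b" by (simp add: factored_def)
  also have "\<dots> = 1" by (simp add: Y_eq_1 X_eq_1 assms diag_cong[OF assms(4) cong_refl] diag_1)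
  finally show ?thesis .
qed

end

section \<open>Galois action on the image\<close>

context SL2_hom
begin

lemma X_minus: "X (- i) = inverse (X i)" and Y_minus: "Y (- i) = inverse (Y i)"
  using X_add[of i "- i"] Y_add[of i "- i"] by (simp_all add: inverse_eqI)

lemma X_powi: "X (k * i) = X k powi i"
proof (induction i rule: int_induct[where k = 0])
  case (step1 i)
  have "k * (i + 1) = k + k * i" by (simp add: algebra_simps)
  then show ?case by (simp only: X_add group_powi_Suc step1)
next
  case (step2 i)
  have "k * (i - 1) + k = k * i" by (simp add: algebra_simps)
  then have "X (k * (i - 1)) * X k = X (k * i)" by (simp flip: X_add)
  also have "\<dots> = X k powi (i - 1) * X k" using group_powi_add[of "X k" "i - 1" 1] step2 by simp
  finally show ?case by (simp add: group_right_cancel)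
qed simp

lemma J_conjugate: "J * X i * inverse J = Y (- i)" "J * Y i * inverse J = X (- i)"
  by (simp_all add: J_X J_Y mult.assoc)

lemma J_word: "J = X 1 * Y (- 1) * X 1"
  by (simp add: J_def X_def Y_def hom)

lemma J_J_r: "a * d - b * c = 1 \<Longrightarrow> J * J * r a b c d = r (- a) (- b) (- c) (- d)"
  by (simp add: J_J hom)

end

lemma (in modular_pair) J_eq: "J = S"
  by (simp add: J_def w_S_1)

lemma (in modular_pair) X_eq: "X i = T powi i"
  using X_powi[of 1 i] by (simp add: X_def w_T_1)

lemma (in modular_pair) T_powi_cong:
  assumes "T powi n = 1" "[i = j] (mod n)"
  shows "T powi i = T powi j"
proof -
  obtain k where "j = i + n * k" using assms(2) by (auto simp: cong_iff_lin mult.commute)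
  then have "X j = X i * X n powi k" by (simp only: X_add X_powi)
  also have "X n powi k = 1" unfolding X_eq assms(1) by (rule group_powi_left_1)
  finally show ?thesis by (simp add: X_eq)
qed

text \<open>The domain \<open>D\<close> is explicit because a Galois automorphism is multiplicative
  only on matrices over the cyclotomic field.\<close>

locale partial_hom =
  fixes D :: "'g::group_mult set" and \<alpha> :: "'g \<Rightarrow> 'g"
  assumes one_D: "1 \<in> D" and mult_D: "g \<in> D \<Longrightarrow> h \<in> D \<Longrightarrow> g * h \<in> D"
    and inverse_D: "g \<in> D \<Longrightarrow> inverse g \<in> D"
    and \<alpha>_mult: "g \<in> D \<Longrightarrow> h \<in> D \<Longrightarrow> \<alpha> (g * h) = \<alpha> g * \<alpha> h"
    and \<alpha>_inj: "inj_on \<alpha> D"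
begin

lemma \<alpha>_1: "\<alpha> 1 = 1"
  using \<alpha>_mult[OF one_D one_D] by (metis group_left_cancel mult_1_right)

lemma \<alpha>_inverse: "g \<in> D \<Longrightarrow> \<alpha> (inverse g) = inverse (\<alpha> g)"
  using \<alpha>_mult[of g "inverse g"] inverse_D \<alpha>_1 by (simp add: inverse_eqI)

lemma powi_D: "g \<in> D \<Longrightarrow> g powi i \<in> D"
proof -
  assume g: "g \<in> D"
  have "h \<in> D \<Longrightarrow> h ^ n \<in> D" for h n
    by (induction n) (simp_all add: one_D mult_D)
  then show ?thesis using g inverse_D by (simp add: power_int_def)
qed

lemma \<alpha>_powi: "g \<in> D \<Longrightarrow> \<alpha> (g powi i) = \<alpha> g powi i"
proof -
  assume g: "g \<in> D"
  have *: "h \<in> D \<Longrightarrow> h ^ n \<in> D \<and> \<alpha> (h ^ n) = \<alpha> h ^ n" for h n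
    by (induction n) (simp_all add: one_D mult_D \<alpha>_1 \<alpha>_mult)
  then show ?thesis using g inverse_D by (simp add: power_int_def \<alpha>_inverse)
qed

lemma \<alpha>_eq_1: "g \<in> D \<Longrightarrow> \<alpha> g = 1 \<longleftrightarrow> g = 1"
  using \<alpha>_inj one_D \<alpha>_1 by (metis inj_onD)

text \<open>\<open>\<alpha>\<close> acts on \<open>\<Gamma>\<^sub>0(p)\<close> like conjugation by \<open>diag(p, 1)\<close>. Since \<open>\<alpha>\<close> is injective, the kernel is
  invariant under this conjugation.\<close>

lemma congruence_tower:
  assumes pair: "modular_pair S T" and N: "N > 0" and p: "p = 2 \<or> p = 3" and cop: "coprime p N"
    and T_N: "T powi N = 1" and S_D: "S \<in> D" and T_D: "T \<in> D"
    and \<alpha>_T: "\<alpha> T = T powi p" and \<alpha>_z: "\<alpha> (S * S) = S * S"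
    and \<alpha>_Y: "\<alpha> (S * T powi (- p) * inverse S) = S * inverse T * inverse S"
  shows "congruence_tower (modular_word S T) N p"
proof -
  interpret modular_pair S T by (rule pair)
  have X_D: "X i \<in> D" for i using powi_D[OF T_D] by (simp add: X_eq)
  have Y: "Y i = S * T powi (- i) * inverse S" for i
    using J_conjugate(1)[of "- i"] by (simp add: X_eq J_eq)
  have Y_D: "Y i \<in> D" for i
    using mult_D S_D powi_D[OF T_D] inverse_D by (simp add: Y)
  have r_D: "w a b c d \<in> D" if "a * d - b * c = 1" for a b c d
    using that
  proof (rule SL2_induct)
    show "w 1 0 0 1 \<in> D" by (simp add: one_D)
    fix a b c d assume *: "a * d - b * c = (1::int)" "w a b c d \<in> D"
    show "w (a + c) (b + d) c d \<in> D" "w (a - c) (b - d) c d \<in> D"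
      "w a b (c + a) (d + b) \<in> D" "w a b (c - a) (d - b) \<in> D"
      using X_r[OF *(1), of 1] X_r[OF *(1), of "-1"] Y_r[OF *(1), of 1] Y_r[OF *(1), of "-1"]
        mult_D[OF X_D *(2)] mult_D[OF Y_D *(2)] by (metis mult_1 mult_minus1 uminus_add_conv_diff add.commute)+
  qed
  have \<alpha>_X1: "\<alpha> (X 1) = X p" using \<alpha>_T by (simp add: X_eq)
  have \<alpha>_Yp: "\<alpha> (Y p) = Y 1" using \<alpha>_Y by (simp add: Y group_powi_minus)
  have \<alpha>_Xm: "\<alpha> (X (- 1)) = X (- p)" and \<alpha>_Ym: "\<alpha> (Y (- p)) = Y (- 1)"
    using \<alpha>_inverse[OF X_D[of 1]] \<alpha>_inverse[OF Y_D[of p]] \<alpha>_X1 \<alpha>_Yp by (simp_all add: X_minus Y_minus)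
  have \<alpha>_r: "\<alpha> (w a b (p * c) d) = w a (p * b) c d" if "a * d - b * (p * c) = 1" for a b c d
    using _ _ that
  proof (rule Gamma0_induct)
    show "1 \<le> p" "p \<le> 3" using p by auto
    show "\<alpha> (w 1 0 (p * 0) 1) = w 1 (p * 0) 0 1" by (simp add: \<alpha>_1)
    fix a b c d assume det: "a * d - b * (p * c) = 1" and eq: "\<alpha> (w a b (p * c) d) = w a (p * b) c d"
    have det': "a * d - p * b * c = 1" using det by (simp add: mult_ac)
    note m = \<alpha>_mult[OF _ r_D[OF det], unfolded eq]
    have z_D: "S * S \<in> D" by (rule mult_D[OF S_D S_D])
    show "\<alpha> (w (- a) (- b) (p * - c) (- d)) = w (- a) (p * - b) (- c) (- d)"
      using m[OF z_D] J_J_r[OF det] J_J_r[OF det'] by (simp add: J_eq \<alpha>_z)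
    show "\<alpha> (w (a + p * c) (b + d) (p * c) d) = w (a + p * c) (p * (b + d)) c d"
      using m[OF X_D[of 1]] X_r[OF det, of 1] X_r[OF det', of p] by (simp add: \<alpha>_X1 distrib_left)
    show "\<alpha> (w (a - p * c) (b - d) (p * c) d) = w (a - p * c) (p * (b - d)) c d"
      using m[OF X_D[of "- 1"]] X_r[OF det, of "- 1"] X_r[OF det', of "- p"] by (simp add: \<alpha>_Xm right_diff_distrib)
    show "\<alpha> (w a b (p * (c + a)) (d + p * b)) = w a (p * b) (c + a) (d + p * b)"
      using m[OF Y_D[of p]] Y_r[OF det, of p] Y_r[OF det', of 1] by (simp add: \<alpha>_Yp distrib_left)
    show "\<alpha> (w a b (p * (c - a)) (d - p * b)) = w a (p * b) (c - a) (d - p * b)"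
      using m[OF Y_D[of "- p"]] Y_r[OF det, of "- p"] Y_r[OF det', of "- 1"] by (simp add: \<alpha>_Ym right_diff_distrib)
  qed
  show ?thesis
  proof
    show "N > 0" "p = 2 \<or> p = 3" "coprime p N" by (rule N, rule p, rule cop)
    show "X N = 1" using T_N by (simp add: X_eq)
    show "w a b (p * c) d = 1 \<longleftrightarrow> w a (p * b) c d = 1" if "a * d - b * (p * c) = 1" for a b c d
      using \<alpha>_eq_1[OF r_D[OF that]] \<alpha>_r[OF that] by simp
  qed
qed

end

locale galois_action = modular_pair S T + partial_hom D \<alpha>
  for S T :: "'g::group_mult" and D \<alpha> +
  fixes G :: 'g and l N :: int
  assumes S_D: "S \<in> D" and T_D: "T \<in> D" and T_N: "T powi N = 1" and \<alpha>_T: "\<alpha> T = T powi l"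
    and \<alpha>_S: "\<alpha> S = G * S" and \<alpha>_S': "\<alpha> S = S * inverse G"
    and G_T: "G * T = T powi (l ^ 2) * G"
begin

lemma X_cong: "[i = j] (mod N) \<Longrightarrow> X i = X j"
  unfolding X_eq by (rule T_powi_cong[OF T_N])

lemma Y_cong: "[i = j] (mod N) \<Longrightarrow> Y i = Y j"
  using X_cong[of "- i" "- j"] J_conjugate(1)[of "- i"] J_conjugate(1)[of "- j"] by (simp add: cong_minus_minus_iff)

lemma X_D: "X i \<in> D"
  using powi_D[OF T_D] by (simp add: X_eq)

lemma Y_D: "Y i \<in> D"
  using J_conjugate(1)[of "- i"] by (simp add: J_eq) (metis X_D S_D mult_D inverse_D)

lemma \<alpha>_z: "\<alpha> (S * S) = S * S"
proof -
  have "\<alpha> (S * S) = (S * inverse G) * (G * S)" using \<alpha>_mult[OF S_D S_D] \<alpha>_S \<alpha>_S' by simp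
  then show ?thesis by (simp add: mult.assoc)
qed

lemma \<alpha>_X: "\<alpha> (X i) = X (l * i)"
  using X_powi[of l i] by (simp add: X_eq \<alpha>_powi[OF T_D] \<alpha>_T)

lemma G_X: "G * X i = X (l ^ 2 * i) * G"
proof -
  have 1: "G * X 1 = X (l ^ 2) * G" using G_T by (simp add: X_eq)
  show ?thesis
  proof (induction i rule: int_induct[where k = 0])
    case (step1 i)
    have "G * X (i + 1) = (G * X i) * X 1" by (simp only: X_add mult.assoc)
    also have "\<dots> = X (l ^ 2 * i) * (G * X 1)" unfolding step1 by (rule mult.assoc)
    also have "\<dots> = X (l ^ 2 * (i + 1)) * G"
      unfolding 1 by (simp only: distrib_left X_add mult.assoc mult_1_right)
    finally show ?case .
  next
    case (step2 i)
    have i: "l ^ 2 * i = l ^ 2 * (i - 1) + l ^ 2" "i = i - 1 + 1" by (simp_all add: algebra_simps)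
    have "G * X (i - 1) * X 1 = G * X i" by (simp add: mult.assoc flip: X_add)
    also have "\<dots> = X (l ^ 2 * (i - 1)) * (G * X 1)"
      unfolding step2 1 i(1) X_add mult.assoc ..
    finally show ?case by (simp only: mult.assoc[symmetric] group_right_cancel)
  qed simp
qed

text \<open>With \<open>\<alpha> S = S * inverse G\<close>, conjugation by \<open>inverse G\<close>
  divides the exponent by \<open>l ^ 2\<close>. This undoes the factor \<open>l\<close> in the
  argument and the one produced by \<open>\<alpha>\<close>.\<close>

lemma \<alpha>_Y: "\<alpha> (Y (l * i)) = Y i"
proof -
  have Y: "Y i = S * X (- i) * inverse S" for i
    using J_conjugate(1)[of "- i"] by (simp add: J_eq)
  have "\<alpha> (Y (l * i)) = \<alpha> S * \<alpha> (X (- (l * i))) * inverse (\<alpha> S)"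
    unfolding Y by (simp add: \<alpha>_mult \<alpha>_inverse S_D X_D mult_D inverse_D)
  also have "\<dots> = S * inverse G * (X (l ^ 2 * (- i)) * G) * inverse S"
    unfolding \<alpha>_X \<alpha>_S' by (simp add: group_inverse_mult mult.assoc power2_eq_square)
  also have "\<dots> = Y i"
    unfolding G_X[symmetric] Y by (simp add: mult.assoc)
  finally show ?thesis .
qed

text \<open>Since \<open>l ^ 2\<close> is 1 modulo \<open>N\<close>, \<open>G\<close> commutes with
  \<open>X l\<close>. Applying \<open>\<alpha>\<close> to both sides of \<open>STS\<close>, the
  relation for \<open>S * (T * S)\<close>, then shows that \<open>inverse G\<close> is the cube of
  \<open>S * X l\<close>.\<close>

lemma G_word:
  assumes "[l * l = 1] (mod N)"
  shows "inverse G = S * S * (Y (- l) * X l * Y (- l) * S)"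
proof -
  have "[l ^ 2 * l = l] (mod N)" using cong_scalar_right[OF assms, of l] by (simp add: power2_eq_square)
  from X_cong[OF this] have GX: "G * X l = X l * G" using G_X[of l] by simp
  have STS: "S * (T * S) = inverse T * (inverse S * inverse T)"
  proof -
    have "(S * (T * S)) * (T * (S * T)) = 1" using ST3 by (simp add: mult.assoc)
    from inverse_eqI'[OF this] show ?thesis by (simp add: group_inverse_mult mult.assoc)
  qed
  have "\<alpha> (S * (T * S)) = S * inverse G * (X l * (G * S))"
    using \<alpha>_S \<alpha>_S' by (simp add: \<alpha>_mult S_D T_D mult_D \<alpha>_T X_eq)
  also have "\<dots> = S * (X l * S)"
    by (metis GX inverse_mult_cancel_left mult.assoc)
  finally have 1: "\<alpha> (S * (T * S)) = S * (X l * S)" .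
  have "\<alpha> (S * (T * S)) = inverse (X l) * (inverse (G * S) * inverse (X l))"
    unfolding STS by (simp add: \<alpha>_mult \<alpha>_inverse S_D T_D mult_D inverse_D \<alpha>_T \<alpha>_S X_eq)
  then have "S * (X l * S) = inverse (X l) * (inverse S * (inverse G * inverse (X l)))"
    unfolding 1 by (simp add: group_inverse_mult mult.assoc)
  then have "S * (X l * (S * (X l * S) * X l)) = inverse G" by (simp add: mult.assoc)
  then have G: "inverse G = (S * X l) * ((S * X l) * (S * X l))" by (simp only: mult.assoc)
  have SX: "S * X l = Y (- l) * S" and SY: "S * Y (- l) = X l * S"
    using J_X[of l] J_Y[of "- l"] by (simp_all add: J_eq)
  have "S * S * Y (- l) = (S * X l) * S" by (simp only: mult.assoc SY)
  then have zY: "S * S * Y (- l) = Y (- l) * (S * S)" unfolding SX by (simp only: mult.assoc)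
  have "g * (g * g) = h * (g * h)" if "g = h" for g h :: 'g using that by simp
  from this[OF SX] have "inverse G = Y (- l) * (S * S) * (X l * (Y (- l) * S))"
    unfolding G by (simp only: mult.assoc)
  then show ?thesis unfolding zY[symmetric] by (simp only: mult.assoc)
qed

end

section \<open>Splitting a representation into two levels\<close>

text \<open>With \<open>f = d\<close> the assumption is a consequence of relation (i).\<close>

locale modular_splitting = modular_pair S T for S T :: "'g::group_mult" +
  fixes f :: int
  assumes com: "X (f * i) * Y ((1 - f) * j) = Y ((1 - f) * j) * X (f * i)"
begin

lemma com': "X ((1 - f) * i) * Y (f * j) = Y (f * j) * X ((1 - f) * i)"
proof -
  have conj: "J * (g * h) * inverse J = (J * g * inverse J) * (J * h * inverse J)" for g h
    by (simp add: mult.assoc)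
  have "J * (X (f * (- j)) * Y ((1 - f) * (- i))) * inverse J = J * (Y ((1 - f) * (- i)) * X (f * (- j))) * inverse J"
    by (simp only: com)
  then show ?thesis unfolding conj J_conjugate by simp
qed

end

lemma modular_splitting_swap: "modular_splitting S T f \<Longrightarrow> modular_splitting S T (1 - f)"
proof -
  assume "modular_splitting S T f"
  then interpret modular_splitting S T f .
  show ?thesis by unfold_locales (simp add: com')
qed

context modular_splitting
begin

text \<open>\<open>J_word\<close> with \<open>k\<close> in place of 1; for \<open>k = f\<close> it
  is the component of \<open>S\<close> that belongs to \<open>f\<close>.\<close>

definition part where "part k = X k * Y (- k) * X k"

lemma S_split: "S = part f * part (1 - f)"
proof -
  have XX: "X i * X j = X j * X i" for i j by (simp add: add.commute flip: X_add)
  have c: "X (1 - f) * Y (- f) = Y (- f) * X (1 - f)" "X f * Y (- (1 - f)) = Y (- (1 - f)) * X f"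
    using com'[of 1 "- 1"] com[of 1 "- 1"] by (simp_all only: mult_1_right mult_minus_right)
  have "S = X (f + (1 - f)) * Y (- f + - (1 - f)) * X (f + (1 - f))"
    using J_word by (simp add: J_eq)
  also have "\<dots> = X f * (X (1 - f) * Y (- f)) * (Y (- (1 - f)) * X f) * X (1 - f)"
    by (simp only: X_add Y_add mult.assoc)
  also have "\<dots> = X f * Y (- f) * (X (1 - f) * X f) * Y (- (1 - f)) * X (1 - f)"
    unfolding c(1) c(2)[symmetric] by (simp only: mult.assoc)
  also have "\<dots> = part f * part (1 - f)"
    unfolding part_def XX[of "1 - f" f] by (simp only: mult.assoc)
  finally show ?thesis .
qed

lemma part_commute:
  "part f * X ((1 - f) * i) = X ((1 - f) * i) * part f" "part f * Y ((1 - f) * i) = Y ((1 - f) * i) * part f"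
proof -
  have XX: "X i * X j = X j * X i" and YY: "Y i * Y j = Y j * Y i" for i j
    by (simp_all add: add.commute flip: X_add Y_add)
  have "X f * Y ((1 - f) * i) = Y ((1 - f) * i) * X f" "X ((1 - f) * i) * Y (- f) = Y (- f) * X ((1 - f) * i)"
    using com[of 1 i] com'[of i "- 1"] by simp_all
  moreover note XX[of f "(1 - f) * i"] YY[of "- f" "(1 - f) * i"]
  ultimately show "part f * X ((1 - f) * i) = X ((1 - f) * i) * part f"
    "part f * Y ((1 - f) * i) = Y ((1 - f) * i) * part f"
    unfolding part_def by (intro commute_mult; simp)+
qed

lemma parts_commute: "part f * part (1 - f) = part (1 - f) * part f"
proof -
  have "part f * X (1 - f) = X (1 - f) * part f" "part f * Y (- (1 - f)) = Y (- (1 - f)) * part f"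
    using part_commute(1)[of 1] part_commute(2)[of "- 1"] by (simp_all only: mult_1_right mult_minus_right)
  then show ?thesis unfolding part_def[of "1 - f"] by (metis commute_mult')
qed

lemma part_X: "part f * X (f * i) = Y (- (f * i)) * part f"
  and part_Y: "part f * Y (f * i) = X (- (f * i)) * part f"
proof -
  interpret swap: modular_splitting S T "1 - f"
    by (rule modular_splitting_swap) unfold_locales
  have c: "part (1 - f) * X (f * i) = X (f * i) * part (1 - f)" "part (1 - f) * Y (f * i) = Y (f * i) * part (1 - f)"
    using swap.part_commute[of i] by simp_all
  have J: "J = part f * part (1 - f)" unfolding J_eq by (rule S_split)
  have "part f * X (f * i) * part (1 - f) = J * X (f * i)"
    unfolding J mult.assoc c(1) ..
  also have "\<dots> = Y (- (f * i)) * part f * part (1 - f)" unfolding J_X by (simp only: J mult.assoc)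
  finally show "part f * X (f * i) = Y (- (f * i)) * part f" by (simp only: group_right_cancel)
  have "part f * Y (f * i) * part (1 - f) = J * Y (f * i)"
    unfolding J mult.assoc c(2) ..
  also have "\<dots> = X (- (f * i)) * part f * part (1 - f)" unfolding J_Y by (simp only: J mult.assoc)
  finally show "part f * Y (f * i) = X (- (f * i)) * part f" by (simp only: group_right_cancel)
qed

lemma part_X_1: "part f * X f = Y (- f) * part f" and part_Y_1: "part f * Y (- f) = X f * part f"
  using part_X[of 1] part_Y[of "- 1"] by simp_all

text \<open>The braid relation for \<open>X f\<close> and \<open>Y (- f)\<close>, read off from the
  action of \<open>part f\<close> on its own factors.\<close>

lemma part_alt: "part f = Y (- f) * X f * Y (- f)"
proof -
  have "part f * part f = (part f * X f) * Y (- f) * X f"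
    by (simp only: part_def[of f] mult.assoc)
  also have "\<dots> = Y (- f) * (part f * Y (- f)) * X f"
    unfolding part_X_1 by (simp only: mult.assoc)
  also have "\<dots> = Y (- f) * X f * Y (- f) * part f"
    unfolding part_Y_1 mult.assoc part_X_1 ..
  finally show ?thesis by (simp only: group_right_cancel)
qed

lemma part_square_X: "part f * part f * X f = X f * (part f * part f)"
  by (simp only: mult.assoc part_X_1) (simp only: mult.assoc[symmetric] part_Y_1)

text \<open>For a part, the cube of the product of its generators equals the fourth power of
  \<open>part f\<close>, so all relations follow once this fourth power is 1.\<close>

lemma modular_pair_part:
  assumes "part f * part f * (part f * part f) = 1"
  shows "modular_pair (part f) (X f)"
proof
  show "part f * part f * (part f * part f) = 1" by fact
  show "part f * part f * X f = X f * (part f * part f)" by (rule part_square_X)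
  have "part f * X f * (part f * X f) * (part f * X f) = part f * ((X f * part f) * (X f * part f)) * X f"
    by (simp only: mult.assoc)
  also have "\<dots> = part f * (part f * (Y (- f) * part f) * Y (- f)) * X f"
    unfolding part_Y_1[symmetric] by (simp only: mult.assoc)
  also have "\<dots> = part f * part f * part f * part f"
    unfolding part_X_1[symmetric] by (simp only: part_def[of f] mult.assoc)
  also have "\<dots> = 1" using assms by (simp add: mult.assoc)
  finally show "part f * X f * (part f * X f) * (part f * X f) = 1" .
qed

lemma part_hom:
  assumes "part f * part f * (part f * part f) = 1"
  shows "SL2_hom.X (modular_word (part f) (X f)) i = X (f * i)"
    "SL2_hom.Y (modular_word (part f) (X f)) i = Y (f * i)"
proof -
  interpret p: modular_pair "part f" "X f" by (rule modular_pair_part[OF assms])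
  show X: "p.X i = X (f * i)" for i by (simp only: p.X_eq X_powi)
  have "p.Y i = part f * X (f * - i) * inverse (part f)"
    using p.J_conjugate(1)[of "- i"] X[of "- i"] by (simp add: p.J_eq)
  also have "\<dots> = Y (f * i)" unfolding part_X by (simp add: mult.assoc)
  finally show "p.Y i = Y (f * i)" .
qed

text \<open>The unipotents of one part commute with the words of the other, so a row operation acts
  on both factors at once.\<close>

lemma modular_word_split:
  assumes f: "part f * part f * (part f * part f) = 1"
    and f': "part (1 - f) * part (1 - f) * (part (1 - f) * part (1 - f)) = 1"
    and det: "a * d - b * c = 1"
  shows "w a b c d = modular_word (part f) (X f) a b c d * modular_word (part (1 - f)) (X (1 - f)) a b c d"
proof -
  interpret p: modular_pair "part f" "X f" by (rule modular_pair_part[OF f])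
  interpret swap: modular_splitting S T "1 - f"
    by (rule modular_splitting_swap) unfold_locales
  interpret q: modular_pair "part (1 - f)" "X (1 - f)" by (rule swap.modular_pair_part[OF f'])
  note pX = part_hom[OF f] and qX = swap.part_hom[OF f']
  have XX: "X i * X j = X j * X i" and YY: "Y i * Y j = Y j * Y i" for i j
    by (simp_all add: add.commute flip: X_add Y_add)
  have com1: "X ((1 - f) * i) * p.w a b c d = p.w a b c d * X ((1 - f) * i)"
    "Y ((1 - f) * i) * p.w a b c d = p.w a b c d * Y ((1 - f) * i)"
    if "a * d - b * c = 1" for a b c d i
    by (rule p.commute_r[OF _ _ that]; simp only: pX XX YY com com')+
  have split: "X i = p.X i * q.X i" "Y i = p.Y i * q.Y i" for i
    unfolding pX qX X_add[symmetric] Y_add[symmetric] by (simp_all add: algebra_simps)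
  have swap4: "(g * h) * (g' * h') = (g * g') * (h * h')" if "h * g' = g' * h" for g h g' h' :: 'g
    by (metis that mult.assoc)
  show ?thesis
    using det
  proof (rule SL2_induct)
    fix a b c d :: int
    assume det: "a * d - b * c = 1" and eq: "w a b c d = p.w a b c d * q.w a b c d"
    have "X i * w a b c d = (p.X i * p.w a b c d) * (q.X i * q.w a b c d)"
      "Y i * w a b c d = (p.Y i * p.w a b c d) * (q.Y i * q.w a b c d)" for i
      by (rule trans[OF arg_cong2[where f = "(*)", OF split(1) eq] swap4], simp only: qX com1[OF det])
        (rule trans[OF arg_cong2[where f = "(*)", OF split(2) eq] swap4], simp only: qX com1[OF det])
    note this[of 1] this[of "- 1"]
    then show "w (a + c) (b + d) c d = p.w (a + c) (b + d) c d * q.w (a + c) (b + d) c d"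
      "w (a - c) (b - d) c d = p.w (a - c) (b - d) c d * q.w (a - c) (b - d) c d"
      "w a b (c + a) (d + b) = p.w a b (c + a) (d + b) * q.w a b (c + a) (d + b)"
      "w a b (c - a) (d - b) = p.w a b (c - a) (d - b) * q.w a b (c - a) (d - b)"
      by (simp_all add: X_r[OF det] Y_r[OF det] p.X_r[OF det] p.Y_r[OF det] q.X_r[OF det] q.Y_r[OF det])
  qed simp
qed

text \<open>On the component \<open>f\<close> the index \<open>l\<close> acts as the prime
  \<open>p\<close>, so on the part \<open>\<alpha>\<close> satisfies the conditions of a tower of
  level \<open>Q\<close>.\<close>

lemma part_kernel:
  assumes "galois_action S T D \<alpha> G l N" and "[l * f = p * f] (mod N)" and "N dvd f * Q" and Q: "Q > 0"
    and p: "p = 2 \<or> p = 3" "coprime p Q"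
    and order: "part f * part f * (part f * part f) = 1" and fixed: "\<alpha> (part f * part f) = part f * part f"
    and det: "a * d - b * c = 1" "Q dvd b" "Q dvd c" "[a = 1] (mod Q)"
  shows "modular_word (part f) (X f) a b c d = 1"
proof -
  interpret g: galois_action S T D \<alpha> G l N by fact
  have part_D: "part f \<in> D" by (simp add: part_def g.X_D g.Y_D g.mult_D)
  have "congruence_tower (modular_word (part f) (X f)) Q p"
  proof (rule g.congruence_tower[OF modular_pair_part[OF order] Q p _ part_D g.X_D _ fixed])
    show "X f powi Q = 1" using g.X_cong[of "f * Q" 0] assms(3) by (simp add: X_powi cong_0_iff)
    show "\<alpha> (X f) = X f powi p"
      using g.X_cong[OF assms(2)] by (simp add: g.\<alpha>_X mult.commute flip: X_powi)
    have "part f * X f powi (- p) * inverse (part f) = Y (f * p)"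
      using part_X[of "- p"] by (simp add: mult.assoc flip: X_powi)
    also have "\<alpha> \<dots> = Y f" using g.Y_cong[OF assms(2)] g.\<alpha>_Y[of f] by (simp add: mult.commute)
    also have "Y f = part f * inverse (X f) * inverse (part f)"
      using part_X[of "- 1"] by (simp add: mult.assoc X_minus)
    finally show "\<alpha> (part f * X f powi (- p) * inverse (part f)) = part f * inverse (X f) * inverse (part f)" .
  qed
  then interpret t: congruence_tower "modular_word (part f) (X f)" Q p .
  show ?thesis by (rule t.congruence_kernel[OF det])
qed

end

text \<open>The splitting with \<open>f = 1\<close>, whose first part is the whole
  representation.\<close>

theorem galois_action_kernel:
  assumes g: "galois_action S T D \<alpha> G p N" and "p = 2 \<or> p = 3" "coprime p N" "N > 0"
    and "a * d - b * c = 1" "N dvd b" "N dvd c" "[a = 1] (mod N)"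
  shows "modular_word S T a b c d = 1"
proof -
  interpret galois_action S T D \<alpha> G p N by fact
  interpret modular_splitting S T 1 by unfold_locales simp
  have S: "part 1 = S" using J_word by (simp add: part_def J_eq)
  have "modular_word (part 1) (X 1) a b c d = 1"
    by (rule part_kernel[OF g]) (use assms S4 \<alpha>_z in \<open>simp_all add: S\<close>)
  then show ?thesis by (simp add: S X_eq)
qed

theorem galois_action_kernel_split:
  assumes g1: "galois_action S T D \<alpha>1 G1 (2 * f - 1) N"
    and g2: "galois_action S T D \<alpha>2 G2 (2 - f) N"
    and g3: "galois_action S T D \<alpha>3 G3 (1 + 2 * f) N"
    and fixed: "G1 \<in> D" "\<alpha>2 G1 = G1" "\<alpha>3 G1 = G1"
    and N: "N = A * m" "A > 0" "m > 0" "coprime 3 A" "coprime 2 m"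
    and f: "[f = 1] (mod A)" "[f = 0] (mod m)"
    and com: "T powi A * (S * T powi m * inverse S) = S * T powi m * inverse S * T powi A"
    and det: "a * d - b * c = 1" "N dvd b" "N dvd c" "[a = 1] (mod N)"
  shows "modular_word S T a b c d = 1"
proof -
  interpret g1: galois_action S T D \<alpha>1 G1 "2 * f - 1" N by fact
  interpret g3: galois_action S T D \<alpha>3 G3 "1 + 2 * f" N by fact
  obtain k where k: "1 - f = A * k"
    using f(1) by (metis cong_iff_dvd_diff cong_sym dvd_def)
  obtain k' where k': "f = m * k'" using f(2) by (auto simp: cong_0_iff)
  \<comment> \<open>The given commutation is raised to powers in one factor, conjugated by
    \<open>J\<close>, raised to powers in the other factor and conjugated back to the required
    form.\<close>
  have comXY: "g1.X (A * i) * g1.Y (m * j) = g1.Y (m * j) * g1.X (A * i)" for i j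
  proof -
    have "T powi A * g1.Y (- m) = g1.Y (- m) * T powi A"
      using com g1.J_conjugate(1)[of m] by (simp add: g1.J_eq g1.X_eq)
    then have "g1.Y (- m) * g1.X (A * i) = g1.X (A * i) * g1.Y (- m)"
      using central_powi[of "g1.Y (- m)" "T powi A" i] by (simp only: g1.X_powi g1.X_eq[of A])
    then have "g1.J * (g1.Y (- m) * g1.X (A * i)) * inverse g1.J = g1.J * (g1.X (A * i) * g1.Y (- m)) * inverse g1.J"
      by simp
    moreover have "g1.J * (g * h) * inverse g1.J = (g1.J * g * inverse g1.J) * (g1.J * h * inverse g1.J)" for g h
      by (simp add: mult.assoc)
    ultimately have "g1.Y (- (A * i)) * g1.X m = g1.X m * g1.Y (- (A * i))"
      by (simp add: g1.J_conjugate)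
    then have "g1.Y (- (A * i)) * g1.X (m * (- j)) = g1.X (m * (- j)) * g1.Y (- (A * i))"
      using central_powi[of "g1.Y (- (A * i))" "g1.X m" "- j"] by (simp only: g1.X_powi)
    then have "g1.J * (g1.Y (- (A * i)) * g1.X (m * (- j))) * inverse g1.J
        = g1.J * (g1.X (m * (- j)) * g1.Y (- (A * i))) * inverse g1.J"
      by simp
    moreover have "g1.J * (g * h) * inverse g1.J = (g1.J * g * inverse g1.J) * (g1.J * h * inverse g1.J)" for g h
      by (simp add: mult.assoc)
    ultimately show ?thesis by (simp add: g1.J_conjugate)
  qed
  interpret q: modular_splitting S T "1 - f"
  proof
    show "g1.X ((1 - f) * i) * g1.Y ((1 - (1 - f)) * j) = g1.Y ((1 - (1 - f)) * j) * g1.X ((1 - f) * i)" for i j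
    proof -
      have "(1 - f) * i = A * (k * i)" "(1 - (1 - f)) * j = m * (k' * j)" by (simp only: k mult.assoc) (simp add: k')
      then show ?thesis using comXY[of "k * i" "k' * j"] by (simp only:)
    qed
  qed
  interpret p: modular_splitting S T f
    using modular_splitting_swap[OF q.modular_splitting_axioms] by simp
  define P Q where "P = p.part f" and "Q = p.part (1 - f)"
  have ff: "[f * f = f] (mod N)"
  proof -
    have "A dvd 1 - f" "m dvd f" using k k' by (metis dvd_triv_left)+
    then have "A * m dvd (1 - f) * f" by (rule mult_dvd_mono)
    then show ?thesis by (simp add: N(1) cong_iff_dvd_diff algebra_simps dvd_diff_commute)
  qed
  note comb = cong_combination[OF ff ff, where B = 0]
  have S: "S = P * Q" and PQ: "P * Q = Q * P"
    unfolding P_def Q_def by (rule p.S_split, rule p.parts_commute)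
  then have QP: "Q * P = P * Q" "Q * (P * h) = P * (Q * h)" for h
    by (simp_all only: mult.assoc[symmetric])
  have P4Q4: "P * P * (P * P) * (Q * Q * (Q * Q)) = 1"
    using g1.S4 unfolding S by (simp only: mult.assoc QP)
  have l: "[(2 * f - 1) * (2 * f - 1) = 1] (mod N)"
    by (rule comb[of _ _ 4]) (simp add: algebra_simps)
  have "inverse G1 = S * S * (g1.Y (- (2 * f - 1)) * g1.X (2 * f - 1) * g1.Y (- (2 * f - 1)) * S)"
    by (rule g1.G_word[OF l])
  \<comment> \<open>\<open>2 * f - 1\<close> is the difference of the components \<open>f\<close>
    and \<open>1 - f\<close>, so the word splits into \<open>P\<close> and the inverse of
    \<open>Q\<close>.\<close>
  also have "g1.Y (- (2 * f - 1)) * g1.X (2 * f - 1) * g1.Y (- (2 * f - 1)) = P * inverse Q"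
  proof -
    have P: "P = g1.Y (- f) * (g1.X f * g1.Y (- f))" and iQ: "inverse Q = g1.Y (1 - f) * (g1.X (- (1 - f)) * g1.Y (1 - f))"
      unfolding P_def Q_def p.part_alt q.part_alt
      by (simp_all add: group_inverse_mult mult.assoc flip: g1.X_minus g1.Y_minus)
    have e: "g1.Y (- (2 * f - 1)) = g1.Y (- f) * g1.Y (1 - f)" "g1.X (2 * f - 1) = g1.X f * g1.X (- (1 - f))"
      by (simp_all flip: g1.X_add g1.Y_add)
    have c1: "g1.Y (1 - f) * g1.X f = g1.X f * g1.Y (1 - f)"
      using p.com[of 1 1] by simp
    have c2: "g1.X (- (1 - f)) * g1.Y (- f) = g1.Y (- f) * g1.X (- (1 - f))"
      using p.com'[of "- 1" "- 1"] by (simp only: mult_1_right mult_minus_right)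
    have c3: "g1.Y (1 - f) * g1.Y (- f) = g1.Y (- f) * g1.Y (1 - f)"
      by (simp add: add.commute flip: g1.Y_add)
    have c': "g1.Y (1 - f) * (g1.X f * h) = g1.X f * (g1.Y (1 - f) * h)"
      "g1.X (- (1 - f)) * (g1.Y (- f) * h) = g1.Y (- f) * (g1.X (- (1 - f)) * h)"
      "g1.Y (1 - f) * (g1.Y (- f) * h) = g1.Y (- f) * (g1.Y (1 - f) * h)" for h
      using c1 c2 c3 by (simp_all only: mult.assoc[symmetric])
    show ?thesis
      unfolding P iQ e mult.assoc c' ..
  qed
  also have "P * inverse Q * S = P * P" unfolding S PQ by (simp only: mult.assoc inverse_mult_cancel_left)
  also have "S * S * (P * P) = Q * Q * (P * P * (P * P))"
    unfolding S by (simp only: mult.assoc QP)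
  finally have G1: "inverse G1 = Q * Q * (P * P * (P * P))" .
  \<comment> \<open>So \<open>G1\<close> commutes with \<open>S\<close>, and comparing the two values of \<open>\<alpha>1 S\<close> shows that it is an involution.\<close>
  have "inverse G1 * S = S * inverse G1" unfolding G1 S by (simp only: mult.assoc QP)
  then have "G1 * S = inverse G1 * S" using g1.\<alpha>_S g1.\<alpha>_S' by simp
  then have G1i: "inverse G1 = G1" by (simp add: group_right_cancel)
  then have "inverse G1 * inverse G1 = 1" by (metis inverse_mult_self)
  \<comment> \<open>The square of \<open>inverse G1\<close> is the fourth power of \<open>S\<close>,
    which is 1, times the fourth power of \<open>P\<close>.\<close>
  then have "P * P * (P * P) * (Q * Q * (Q * Q)) * (P * P * (P * P)) = 1"
    unfolding G1 by (simp only: mult.assoc QP)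
  then have P4: "P * P * (P * P) = 1" unfolding P4Q4 by simp
  then have Q4: "Q * Q * (Q * Q) = 1" using P4Q4 by simp
  have G1Q: "G1 = Q * Q" using G1 G1i P4 by simp
  \<comment> \<open>This writes \<open>P * P\<close> through elements that \<open>\<alpha>3\<close>
    fixes.\<close>
  have PP: "P * P = S * S * G1"
  proof -
    have "S * S * G1 = P * P * (Q * Q * (Q * Q))" unfolding S G1Q by (simp only: mult.assoc QP)
    then show ?thesis by (simp add: Q4)
  qed
  have fP: "\<alpha>3 (P * P) = P * P"
    unfolding PP using g3.\<alpha>_mult[OF g3.mult_D[OF g3.S_D g3.S_D] fixed(1)] g3.\<alpha>_z fixed(3) by simp
  have fQ: "\<alpha>2 (Q * Q) = Q * Q" using fixed(2) by (simp add: G1Q)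
  have Am: "A dvd x" "m dvd x" if "N dvd x" for x using that unfolding N(1) by (auto dest: dvd_mult_left dvd_mult_right)
  have detA: "A dvd b" "A dvd c" "[a = 1] (mod A)" and detm: "m dvd b" "m dvd c" "[a = 1] (mod m)"
    using det Am by (auto simp: cong_iff_dvd_diff)
  have "modular_word (p.part f) (g1.X f) a b c d = 1"
  proof (rule p.part_kernel[OF g3 _ _ N(2) _ N(4) _ _ det(1) detA])
    show "[(1 + 2 * f) * f = 3 * f] (mod N)" by (rule comb[of _ _ 2]) (simp add: algebra_simps)
    show "N dvd f * A" unfolding N(1) k' by simp
  qed (use P4 fP in \<open>simp_all add: P_def\<close>)
  moreover have "modular_word (p.part (1 - f)) (g1.X (1 - f)) a b c d = 1"
  proof (rule q.part_kernel[OF g2 _ _ N(3) _ N(5) _ _ det(1) detm])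
    show "[(2 - f) * (1 - f) = 2 * (1 - f)] (mod N)" by (rule comb[of _ _ 1]) (simp add: algebra_simps)
    show "N dvd (1 - f) * m" unfolding N(1) k by simp
  qed (use Q4 fQ in \<open>simp_all add: Q_def\<close>)
  moreover have "modular_word S T a b c d = modular_word (p.part f) (g1.X f) a b c d * modular_word (p.part (1 - f)) (g1.X (1 - f)) a b c d"
    using P4 Q4 by (intro p.modular_word_split det(1)) (simp_all add: P_def Q_def)
  ultimately show ?thesis by simp
qed

section \<open>Invertible matrices\<close>

lemma matrix_inv_cancel:
  assumes "invertible A"
  shows "A ** matrix_inv A = mat 1" "matrix_inv A ** A = mat 1"
  using someI_ex[of "\<lambda>A'. A ** A' = mat 1 \<and> A' ** A = mat 1"] assms
  unfolding invertible_def matrix_inv_def by blast+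

lemma invertibleI: "A ** B = mat 1 \<Longrightarrow> B ** A = mat 1 \<Longrightarrow> invertible A"
  unfolding invertible_def by blast

text \<open>Bundling invertibility into a type makes the matrices an instance of
  \<open>group_mult\<close>, to which the abstract results apply.\<close>

typedef (overloaded) 'n gl = "{A :: complex ^ 'n ^ 'n. invertible A}"
  morphisms mat_of gl_of
  by (rule exI[of _ "mat 1"]) (auto intro: invertibleI)

lemma invertible_mat_of: "invertible (mat_of g)"
  using mat_of[of g] by simp

lemma mat_of_gl_of [simp]: "invertible A \<Longrightarrow> mat_of (gl_of A) = A"
  by (simp add: gl_of_inverse)

instantiation gl :: (finite) group_mult
begin

definition one_gl :: "'a gl" where "one_gl = gl_of (mat 1)"
definition times_gl :: "'a gl \<Rightarrow> 'a gl \<Rightarrow> 'a gl" where "times_gl g h = gl_of (mat_of g ** mat_of h)"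
definition inverse_gl :: "'a gl \<Rightarrow> 'a gl" where "inverse_gl g = gl_of (matrix_inv (mat_of g))"
definition divide_gl :: "'a gl \<Rightarrow> 'a gl \<Rightarrow> 'a gl" where "divide_gl g h = g * inverse h"

lemma mat_of_1: "mat_of (1 :: 'a gl) = mat 1"
  unfolding one_gl_def by (rule mat_of_gl_of) (auto intro: invertibleI)

lemma mat_of_mult: "mat_of (g * h :: 'a gl) = mat_of g ** mat_of h"
  unfolding times_gl_def by (rule mat_of_gl_of) (simp add: invertible_mult invertible_mat_of)

lemma mat_of_inv: "mat_of (inverse g :: 'a gl) = matrix_inv (mat_of g)"
  unfolding inverse_gl_def
  by (rule mat_of_gl_of) (use matrix_inv_cancel[OF invertible_mat_of] in \<open>blast intro: invertibleI\<close>)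

instance
proof
  fix a b c :: "'a gl"
  show "a * b * c = a * (b * c)" "1 * a = a" "a * 1 = a" "inverse a * a = 1"
    by (simp_all add: mat_of_inject[symmetric] mat_of_mult mat_of_1 mat_of_inv matrix_mul_assoc
        matrix_inv_cancel[OF invertible_mat_of])
qed

end

lemma mat_of_power: "mat_of (g ^ n) = mat_pow (mat_of g) n"
  by (induction n) (simp_all add: mat_of_1 mat_of_mult)

lemma mat_of_powi: "mat_of (g powi k) = mat_powi (mat_of g) k"
  by (simp add: power_int_def mat_powi_def mat_of_power mat_of_inv)

lemma powi_of_nat: "(g :: 'g::group_mult) powi int n = g ^ n"
  by (simp add: power_int_def)

definition entries_in :: "'c set \<Rightarrow> 'c ^ 'n ^ 'm \<Rightarrow> bool" where
  "entries_in K A \<longleftrightarrow> (\<forall>i j. A $ i $ j \<in> K)"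

definition map_mat :: "('c \<Rightarrow> 'd) \<Rightarrow> 'c ^ 'n ^ 'm \<Rightarrow> 'd ^ 'n ^ 'm" where
  "map_mat \<sigma> A = (\<chi> i j. \<sigma> (A $ i $ j))"

section \<open>Cyclotomic fields\<close>

lemma of_rat_in_cyclotomic: "of_rat q \<in> cyclotomic_field n"
  unfolding cyclotomic_field_def by (rule image_eqI[of _ _ "[:q:]"]) (simp_all add: map_poly_pCons)

lemma cyclotomic_0: "0 \<in> cyclotomic_field n" and cyclotomic_1: "1 \<in> cyclotomic_field n"
  using of_rat_in_cyclotomic[of 0] of_rat_in_cyclotomic[of 1] by simp_all

lemma xi_in_cyclotomic: "xi n \<in> cyclotomic_field n"
  unfolding cyclotomic_field_def by (rule image_eqI[of _ _ "[:0, 1:]"]) (simp_all add: map_poly_pCons)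

lemma cyclotomic_add:
  assumes "x \<in> cyclotomic_field n" "y \<in> cyclotomic_field n"
  shows "x + y \<in> cyclotomic_field n"
proof -
  obtain p q where "x = poly (map_poly of_rat p) (xi n)" "y = poly (map_poly of_rat q) (xi n)"
    using assms by (auto simp: cyclotomic_field_def)
  moreover have "map_poly of_rat (p + q) = (map_poly of_rat p + map_poly of_rat q :: complex poly)"
    by (intro poly_eqI) (simp add: coeff_map_poly of_rat_add)
  ultimately have "x + y = poly (map_poly of_rat (p + q)) (xi n)" by simp
  then show ?thesis unfolding cyclotomic_field_def by blast
qed

lemma cyclotomic_mult:
  assumes "x \<in> cyclotomic_field n" "y \<in> cyclotomic_field n"
  shows "x * y \<in> cyclotomic_field n"
proof -
  obtain p q where "x = poly (map_poly of_rat p) (xi n)" "y = poly (map_poly of_rat q) (xi n)"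
    using assms by (auto simp: cyclotomic_field_def)
  moreover have "map_poly of_rat (p * q) = (map_poly of_rat p * map_poly of_rat q :: complex poly)"
    by (intro poly_eqI) (simp add: coeff_map_poly coeff_mult of_rat_sum of_rat_mult)
  ultimately have "x * y = poly (map_poly of_rat (p * q)) (xi n)" by simp
  then show ?thesis unfolding cyclotomic_field_def by blast
qed

lemma cyclotomic_power: "x \<in> cyclotomic_field n \<Longrightarrow> x ^ k \<in> cyclotomic_field n"
  by (induction k) (simp_all add: cyclotomic_1 cyclotomic_mult)

lemma cyclotomic_sum: "(\<And>i. i \<in> I \<Longrightarrow> f i \<in> cyclotomic_field n) \<Longrightarrow> sum f I \<in> cyclotomic_field n"
  by (induction I rule: infinite_finite_induct) (simp_all add: cyclotomic_0 cyclotomic_add)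

lemma entries_in_cyclotomic_mult:
  "entries_in (cyclotomic_field n) A \<Longrightarrow> entries_in (cyclotomic_field n) B \<Longrightarrow>
    entries_in (cyclotomic_field n) (A ** B)"
  unfolding entries_in_def matrix_matrix_mult_def by (simp add: cyclotomic_sum cyclotomic_mult)

lemma entries_in_cyclotomic_1: "entries_in (cyclotomic_field n) (mat 1)"
  by (simp add: entries_in_def mat_def cyclotomic_0 cyclotomic_1)

lemma entries_in_cyclotomic_power:
  "entries_in (cyclotomic_field n) A \<Longrightarrow> entries_in (cyclotomic_field n) (mat_pow A k)"
  by (induction k) (simp_all add: entries_in_cyclotomic_1 entries_in_cyclotomic_mult)

text \<open>The condition on the inverse makes it unnecessary to know that \<open>cyclotomic_field n\<close> is closed
  under inverses.\<close>

definition cyclotomic_gl :: "nat \<Rightarrow> 'n::finite gl set" where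
  "cyclotomic_gl n = {g. entries_in (cyclotomic_field n) (mat_of g) \<and>
     entries_in (cyclotomic_field n) (mat_of (inverse g))}"

definition galois_gl :: "(complex \<Rightarrow> complex) \<Rightarrow> 'n::finite gl \<Rightarrow> 'n gl" where
  "galois_gl \<sigma> g = gl_of (map_mat \<sigma> (mat_of g))"

context
  fixes n :: nat and \<sigma> :: "complex \<Rightarrow> complex"
  assumes aut: "galois_aut n \<sigma>"
begin

lemma galois_of_rat: "\<sigma> (of_rat q) = of_rat q"
  using aut by (simp add: galois_aut_def)

lemma galois_0: "\<sigma> 0 = 0" and galois_1: "\<sigma> 1 = 1"
  using galois_of_rat[of 0] galois_of_rat[of 1] by simp_all

lemma galois_mult: "x \<in> cyclotomic_field n \<Longrightarrow> y \<in> cyclotomic_field n \<Longrightarrow> \<sigma> (x * y) = \<sigma> x * \<sigma> y"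
  using aut by (simp add: galois_aut_def)

lemma galois_power: "x \<in> cyclotomic_field n \<Longrightarrow> \<sigma> (x ^ k) = \<sigma> x ^ k"
  by (induction k) (simp_all add: galois_1 galois_mult cyclotomic_power)

lemma galois_sum:
  "(\<And>i. i \<in> I \<Longrightarrow> f i \<in> cyclotomic_field n) \<Longrightarrow> \<sigma> (sum f I) = (\<Sum>i\<in>I. \<sigma> (f i))"
proof (induction I rule: infinite_finite_induct)
  case (insert i I)
  then have "\<sigma> (f i + sum f I) = \<sigma> (f i) + \<sigma> (sum f I)"
    using aut cyclotomic_sum[of I f n] by (simp add: galois_aut_def)
  then show ?case using insert by simp
qed (simp_all add: galois_0)

lemma map_mat_mult:
  assumes "entries_in (cyclotomic_field n) A" "entries_in (cyclotomic_field n) B"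
  shows "map_mat \<sigma> (A ** B) = map_mat \<sigma> A ** map_mat \<sigma> B"
  using assms by (simp add: map_mat_def matrix_matrix_mult_def vec_eq_iff entries_in_def
      galois_sum galois_mult cyclotomic_mult)

lemma map_mat_1: "map_mat \<sigma> (mat 1) = mat 1"
  by (simp add: map_mat_def mat_def vec_eq_iff galois_0 galois_1)

lemma map_mat_inverse:
  assumes "g \<in> cyclotomic_gl n"
  shows "map_mat \<sigma> (mat_of g) ** map_mat \<sigma> (mat_of (inverse g)) = mat 1"
    "map_mat \<sigma> (mat_of (inverse g)) ** map_mat \<sigma> (mat_of g) = mat 1"
proof -
  have "entries_in (cyclotomic_field n) (mat_of g)" "entries_in (cyclotomic_field n) (mat_of (inverse g))"
    using assms by (simp_all add: cyclotomic_gl_def)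
  then show "map_mat \<sigma> (mat_of g) ** map_mat \<sigma> (mat_of (inverse g)) = mat 1"
    "map_mat \<sigma> (mat_of (inverse g)) ** map_mat \<sigma> (mat_of g) = mat 1"
    by (simp_all only: map_mat_mult[symmetric] mat_of_mult[symmetric] mult_inverse_self inverse_mult_self
        mat_of_1 map_mat_1)
qed

lemma mat_of_galois_gl: "g \<in> cyclotomic_gl n \<Longrightarrow> mat_of (galois_gl \<sigma> g) = map_mat \<sigma> (mat_of g)"
  unfolding galois_gl_def by (rule mat_of_gl_of) (rule invertibleI[OF map_mat_inverse])

lemma partial_hom_galois_gl: "partial_hom (cyclotomic_gl n) (galois_gl \<sigma> :: 'n::finite gl \<Rightarrow> _)"
proof
  fix g h :: "'n gl"
  show "1 \<in> cyclotomic_gl n" by (simp add: cyclotomic_gl_def mat_of_1 entries_in_cyclotomic_1)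
  show gh: "g * h \<in> cyclotomic_gl n" if "g \<in> cyclotomic_gl n" "h \<in> cyclotomic_gl n"
    using that by (simp add: cyclotomic_gl_def group_inverse_mult mat_of_mult entries_in_cyclotomic_mult)
  show "inverse g \<in> cyclotomic_gl n" if "g \<in> cyclotomic_gl n"
    using that by (simp add: cyclotomic_gl_def)
  show "galois_gl \<sigma> (g * h) = galois_gl \<sigma> g * galois_gl \<sigma> h" if "g \<in> cyclotomic_gl n" "h \<in> cyclotomic_gl n"
  proof -
    have "entries_in (cyclotomic_field n) (mat_of g)" "entries_in (cyclotomic_field n) (mat_of h)"
      using that by (simp_all add: cyclotomic_gl_def)
    then show ?thesis using gh[OF that] that
      by (simp add: mat_of_inject[symmetric] mat_of_mult mat_of_galois_gl map_mat_mult)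
  qed
  have inj: "inj_on \<sigma> (cyclotomic_field n)" using aut by (simp add: galois_aut_def bij_betw_def)
  show "inj_on (galois_gl \<sigma> :: 'n gl \<Rightarrow> _) (cyclotomic_gl n)"
  proof (rule inj_onI)
    fix g h :: "'n gl"
    assume gh: "g \<in> cyclotomic_gl n" "h \<in> cyclotomic_gl n" "galois_gl \<sigma> g = galois_gl \<sigma> h"
    then have "map_mat \<sigma> (mat_of g) = map_mat \<sigma> (mat_of h)" by (metis mat_of_galois_gl)
    then have "\<sigma> (mat_of g $ i $ j) = \<sigma> (mat_of h $ i $ j)" for i j
      by (simp add: map_mat_def vec_eq_iff)
    then have "mat_of g $ i $ j = mat_of h $ i $ j" for i j
      using gh(1,2) inj_onD[OF inj] by (simp add: cyclotomic_gl_def entries_in_def)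
    then have "mat_of g = mat_of h" by (simp add: vec_eq_iff)
    then show "g = h" by (simp add: mat_of_inject)
  qed
qed

lemma galois_gl_closed:
  fixes g :: "'n::finite gl"
  assumes g: "g \<in> cyclotomic_gl n"
  shows "galois_gl \<sigma> g \<in> cyclotomic_gl n"
proof -
  have K: "\<sigma> x \<in> cyclotomic_field n" if "x \<in> cyclotomic_field n" for x
    using aut that unfolding galois_aut_def by (auto dest: bij_betwE)
  interpret partial_hom "cyclotomic_gl n" "galois_gl \<sigma> :: 'n gl \<Rightarrow> _" by (rule partial_hom_galois_gl)
  have "entries_in (cyclotomic_field n) (mat_of (galois_gl \<sigma> h))" if "h \<in> cyclotomic_gl n" for h :: "'n gl"
    unfolding mat_of_galois_gl[OF that] using that K by (simp add: map_mat_def entries_in_def cyclotomic_gl_def)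
  from this[OF g] this[OF inverse_D[OF g]] show ?thesis
    by (simp add: cyclotomic_gl_def \<alpha>_inverse[OF g])
qed

lemma galois_rational:
  assumes "g \<in> cyclotomic_gl n" "\<And>i j. mat_of g $ i $ j \<in> \<rat>"
  shows "galois_gl \<sigma> g = g"
proof -
  have "\<sigma> (mat_of g $ i $ j) = mat_of g $ i $ j" for i j
    using assms(2)[of i j] by (auto simp: Rats_def galois_of_rat)
  then show ?thesis using assms(1) by (simp add: mat_of_inject[symmetric] mat_of_galois_gl map_mat_def)
qed

end

lemma xi_power_self: "n > 0 \<Longrightarrow> xi n ^ n = 1"
  by (simp add: xi_def flip: exp_of_nat_mult)

lemma xi_dvd_in_cyclotomic:
  assumes "N dvd M" "M > 0"
  shows "xi N \<in> cyclotomic_field M"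
proof -
  obtain k where k: "M = N * k" using assms(1) ..
  then have "xi M ^ k = xi N"
    using assms(2) by (simp add: xi_def field_simps flip: exp_of_nat_mult)
  then show ?thesis using cyclotomic_power[OF xi_in_cyclotomic] by metis
qed

lemma root_of_unity_xi:
  assumes "n > 0" "x ^ n = 1"
  obtains k where "x = xi n ^ k"
proof -
  have "x \<in> {x. x ^ n = 1}" using assms(2) by simp
  then obtain k where "x = exp (2 * of_real pi * \<i> * of_nat k / of_nat n)"
    using complex_roots_unity[of n] assms(1) by auto
  then have "x = xi n ^ k" by (simp add: xi_def mult_ac flip: exp_of_nat_mult)
  then show ?thesis using that by blast
qed

lemma powi_mod:
  assumes "(x::complex) ^ n = 1" "n > 0"
  shows "x powi l = x ^ nat (l mod int n)"
proof -
  have x: "x \<noteq> 0" using assms by (auto simp: power_0_left)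
  have "x powi l = x powi (int n * (l div int n) + l mod int n)" by simp
  also have "\<dots> = (x powi int n) powi (l div int n) * x powi (l mod int n)"
    using x by (simp only: power_int_add power_int_mult simp_thms)
  also have "\<dots> = x ^ nat (l mod int n)"
    using assms by (simp add: power_int_def[of x "l mod int n"])
  finally show ?thesis .
qed

lemma diagonal_mat_pow:
  assumes "diagonal_matrix T"
  shows "mat_pow T k $ a $ b = (if a = b then T $ a $ a ^ k else 0)"
proof (induction k arbitrary: a b)
  case (Suc k)
  have "mat_pow T (Suc k) $ a $ b = (\<Sum>c\<in>UNIV. T $ a $ c * (if c = b then T $ c $ c ^ k else 0))"
    by (simp add: matrix_matrix_mult_def Suc)
  also have "\<dots> = T $ a $ b * T $ b $ b ^ k" by (simp add: if_distrib cong: if_cong)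
  also have "\<dots> = (if a = b then T $ a $ a ^ Suc k else 0)" using assms by (simp add: diagonal_matrix_def)
  finally show ?case .
qed (simp add: mat_def)

lemma diagonal_root_of_unity:
  assumes T: "diagonal_matrix T" "mat_pow T N = mat 1" and N: "N > 0"
  obtains k where "T $ a $ a = xi N ^ k"
proof -
  have "mat_pow T N $ a $ a = T $ a $ a ^ N" by (simp add: diagonal_mat_pow[OF T(1)])
  then have "T $ a $ a ^ N = 1" unfolding T(2) by (simp add: mat_def)
  then show ?thesis using root_of_unity_xi[OF N] that by blast
qed

text \<open>The diagonal entries are powers of \<open>xi N\<close>. Reducing \<open>l\<close> modulo
  \<open>N\<close> turns a possibly negative exponent into a natural number.\<close>

lemma map_mat_diagonal:
  assumes T: "diagonal_matrix T" "mat_pow T N = mat 1" and N: "N > 0" "N dvd M" "M > 0"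
    and aut: "galois_aut M \<sigma>" and l: "\<sigma> (xi N) = xi N powi l"
  shows "map_mat \<sigma> T = mat_pow T (nat (l mod int N))"
proof -
  have "\<sigma> (T $ a $ b) = (if a = b then T $ a $ a ^ nat (l mod int N) else 0)" for a b
  proof (cases "a = b")
    case True
    obtain k where k: "T $ a $ a = xi N ^ k" using diagonal_root_of_unity[OF T N(1)] .
    have "\<sigma> (T $ a $ a) = (xi N ^ nat (l mod int N)) ^ k"
      unfolding k galois_power[OF aut xi_dvd_in_cyclotomic[OF N(2,3)]] l powi_mod[OF xi_power_self[OF N(1)] N(1)] ..
    also have "\<dots> = T $ a $ a ^ nat (l mod int N)" unfolding k by (simp add: mult.commute flip: power_mult)
    finally show ?thesis using True by simp
  qed (use T(1) in \<open>simp add: diagonal_matrix_def galois_0[OF aut]\<close>)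
  then show ?thesis by (simp add: map_mat_def vec_eq_iff diagonal_mat_pow[OF T(1)])
qed

lemma galois_sign_perm_mult:
  assumes "galois_sign_perm S \<sigma> eps \<pi>"
  shows "map_mat \<sigma> S = signed_perm_matrix eps \<pi> ** S" "map_mat \<sigma> S ** signed_perm_matrix eps \<pi> = S"
proof -
  have 1: "\<sigma> (S $ a $ b) = eps a * S $ \<pi> a $ b" "\<sigma> (S $ a $ b) = eps b * S $ a $ \<pi> b"
    and eps: "eps a \<in> {1, - 1}" and \<pi>: "bij \<pi>" for a b
    using assms unfolding galois_sign_perm_def by blast+
  have e: "eps a * eps a = 1" for a using eps[of a] by auto
  have "(\<Sum>c\<in>UNIV. (if c = \<pi> a then eps a else 0) * S $ c $ b) = eps a * S $ \<pi> a $ b" for a b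
    by (simp add: if_distrib[of "\<lambda>x. x * _"] cong: if_cong)
  then show "map_mat \<sigma> S = signed_perm_matrix eps \<pi> ** S"
    unfolding map_mat_def signed_perm_matrix_def matrix_matrix_mult_def vec_eq_iff by (simp add: 1(1))
  have "(\<Sum>c\<in>UNIV. \<sigma> (S $ a $ c) * (if b = \<pi> c then eps c else 0)) = S $ a $ b" for a b
  proof -
    obtain c0 where c0: "b = \<pi> c0" using \<pi> by (metis bij_pointE)
    have "(b = \<pi> c) \<longleftrightarrow> c = c0" for c using \<pi> c0 by (auto simp: bij_def inj_def)
    then have "(\<Sum>c\<in>UNIV. \<sigma> (S $ a $ c) * (if b = \<pi> c then eps c else 0)) = \<sigma> (S $ a $ c0) * eps c0"
      by (simp add: if_distrib cong: if_cong)
    also have "\<dots> = (eps c0 * eps c0) * S $ a $ b" unfolding 1(2) c0 by (simp only: mult_ac)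
    finally show ?thesis by (simp add: e)
  qed
  then show "map_mat \<sigma> S ** signed_perm_matrix eps \<pi> = S"
    unfolding map_mat_def signed_perm_matrix_def matrix_matrix_mult_def vec_eq_iff by simp
qed

section \<open>Modular data\<close>

locale rcft =
  fixes vac :: "'a::finite" and S T :: "complex ^ 'a ^ 'a" and N M :: nat
  assumes data: "modular_data vac S T" and N: "N > 0" and T_N: "mat_pow T N = mat 1"
    and M: "M > 0" and N_M: "N dvd M" and S_M: "S $ a $ b \<in> cyclotomic_field M"
begin

definition s where "s = gl_of S"
definition t where "t = gl_of T"

lemma mat_of_s: "mat_of s = S" and mat_of_t: "mat_of t = T"
proof -
  have "invertible S" "invertible T"
    using data unfolding modular_data_def unitary_matrix_def by (blast intro: invertibleI)+
  then show "mat_of s = S" "mat_of t = T" by (simp_all add: s_def t_def)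
qed

lemma modular_pair: "modular_pair s t"
proof
  have p: "mat_pow A 2 = A ** A" "mat_pow A 3 = A ** (A ** A)" for A :: "complex ^ 'a ^ 'a"
    by (simp_all add: numeral_2_eq_2 numeral_3_eq_3)
  show "s * s * (s * s) = 1" "s * s * t = t * (s * s)" "s * t * (s * t) * (s * t) = 1"
    using data unfolding modular_data_def mat_of_inject[symmetric] mat_of_mult mat_of_1 mat_of_s mat_of_t p
    by (simp_all add: matrix_mul_assoc)
qed

sublocale modular_pair s t
  by (rule modular_pair)

lemma t_N: "t powi int N = 1"
  using T_N unfolding powi_of_nat by (simp add: mat_of_inject[symmetric] mat_of_power mat_of_1 mat_of_t)

lemma t_mod: "t powi l = t ^ nat (l mod int N)"
  using T_powi_cong[OF t_N, of l "l mod int N"] N by (simp add: cong_def powi_of_nat[symmetric])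

lemma s_cyclotomic: "s \<in> cyclotomic_gl M"
proof -
  have S: "entries_in (cyclotomic_field M) S" using S_M by (simp add: entries_in_def)
  have "inverse s = s * (s * s)" by (rule inverse_eqI) (use S4 in \<open>simp add: mult.assoc\<close>)
  then have "mat_of (inverse s) = S ** (S ** S)" by (simp only: mat_of_mult mat_of_s)
  then show ?thesis using S by (simp add: cyclotomic_gl_def mat_of_s entries_in_cyclotomic_mult)
qed

lemma T_diagonal: "diagonal_matrix T"
  using data by (simp add: modular_data_def)

lemma t_cyclotomic: "t \<in> cyclotomic_gl M"
proof -
  have "T $ a $ b \<in> cyclotomic_field M" for a b
  proof (cases "a = b")
    case True
    obtain k where "T $ a $ a = xi N ^ k" using diagonal_root_of_unity[OF T_diagonal T_N N] .
    then show ?thesis using True cyclotomic_power[OF xi_dvd_in_cyclotomic[OF N_M M]] by simp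
  qed (use T_diagonal in \<open>simp add: diagonal_matrix_def cyclotomic_0\<close>)
  then have T: "entries_in (cyclotomic_field M) T" by (simp add: entries_in_def)
  have "inverse t = t powi (- 1)" using group_powi_minus[of t 1] by simp
  then have "inverse t = t ^ nat (- 1 mod int N)" by (simp only: t_mod)
  then have "mat_of (inverse t) = mat_pow T (nat (- 1 mod int N))" by (simp only: mat_of_power mat_of_t)
  then show ?thesis using T entries_in_cyclotomic_power[OF T] by (simp add: cyclotomic_gl_def mat_of_t)
qed

context
  fixes \<sigma> eps \<pi> G l
  assumes aut: "galois_aut M \<sigma>" and xi: "\<sigma> (xi N) = xi N powi l"
    and sign: "galois_sign_perm S \<sigma> eps \<pi>" and G: "G = signed_perm_matrix eps \<pi>"
begin

text \<open>Writing \<open>G\<close> as the transform of \<open>S\<close> times the inverse of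
  \<open>S\<close> yields its invertibility and the field of its entries at once.\<close>

lemma galois_s: "galois_gl \<sigma> s * inverse s \<in> cyclotomic_gl M" "mat_of (galois_gl \<sigma> s * inverse s) = G"
proof -
  interpret partial_hom "cyclotomic_gl M" "galois_gl \<sigma> :: 'a gl \<Rightarrow> _" by (rule partial_hom_galois_gl[OF aut])
  show "galois_gl \<sigma> s * inverse s \<in> cyclotomic_gl M"
    by (intro mult_D inverse_D galois_gl_closed[OF aut] s_cyclotomic)
  have "mat_of (galois_gl \<sigma> s * inverse s) = G ** (mat_of s ** mat_of (inverse s))"
    unfolding mat_of_mult mat_of_galois_gl[OF aut s_cyclotomic] mat_of_s galois_sign_perm_mult(1)[OF sign] G
      matrix_mul_assoc ..
  also have "mat_of s ** mat_of (inverse s) = mat 1"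
    unfolding mat_of_mult[symmetric] by (simp add: mat_of_1)
  finally show "mat_of (galois_gl \<sigma> s * inverse s) = G" by simp
qed

lemma gl_of_G: "gl_of G = galois_gl \<sigma> s * inverse s"
  unfolding galois_s(2)[symmetric] by (rule mat_of_inverse)

lemma mat_of_G: "mat_of (gl_of G) = G"
  unfolding gl_of_G by (rule galois_s(2))

lemma G_cyclotomic: "gl_of G \<in> cyclotomic_gl M"
  unfolding gl_of_G by (rule galois_s(1))

text \<open>The entries 0, 1 and -1 are rational.\<close>

lemma galois_G:
  assumes "galois_aut M \<tau>"
  shows "galois_gl \<tau> (gl_of G) = gl_of G"
proof (rule galois_rational[OF assms G_cyclotomic])
  fix i j
  have "eps i = 1 \<or> eps i = - 1" using sign by (simp add: galois_sign_perm_def)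
  then show "mat_of (gl_of G) $ i $ j \<in> \<rat>"
    unfolding mat_of_G by (auto simp: G signed_perm_matrix_def)
qed

lemma galois_action:
  assumes "gl_of G * t = t powi (l ^ 2) * gl_of G"
  shows "galois_action s t (cyclotomic_gl M) (galois_gl \<sigma>) (gl_of G) l (int N)"
proof -
  interpret partial_hom "cyclotomic_gl M" "galois_gl \<sigma> :: 'a gl \<Rightarrow> _" by (rule partial_hom_galois_gl[OF aut])
  show ?thesis
  proof
    show "s \<in> cyclotomic_gl M" "t \<in> cyclotomic_gl M" "t powi int N = 1"
      by (rule s_cyclotomic t_cyclotomic t_N)+
    show "galois_gl \<sigma> t = t powi l"
      using map_mat_diagonal[OF T_diagonal T_N N N_M M aut xi]
      by (simp add: t_mod mat_of_inject[symmetric] mat_of_power mat_of_galois_gl[OF aut t_cyclotomic] mat_of_t)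
    show "galois_gl \<sigma> s = gl_of G * s" by (simp add: gl_of_G mult.assoc)
    have "mat_of (galois_gl \<sigma> s * gl_of G) = mat_of s"
      unfolding mat_of_mult mat_of_G mat_of_galois_gl[OF aut s_cyclotomic] mat_of_s
      unfolding G by (rule galois_sign_perm_mult(2)[OF sign])
    then have "galois_gl \<sigma> s * gl_of G * inverse (gl_of G) = s * inverse (gl_of G)"
      by (simp add: mat_of_inject)
    then show "galois_gl \<sigma> s = s * inverse (gl_of G)" by (simp add: mult.assoc)
    show "gl_of G * t = t powi (l ^ 2) * gl_of G" by fact
  qed
qed

end

lemma has_congruence_propertyI:
  assumes "\<And>a b c d. a * d - b * c = 1 \<Longrightarrow> int N dvd b \<Longrightarrow> int N dvd c \<Longrightarrow> [a = 1] (mod int N) \<Longrightarrow>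
    modular_word s t a b c d = 1"
  shows "has_congruence_property S T N"
proof -
  define \<rho> :: "int ^ 2 ^ 2 \<Rightarrow> complex ^ 'a ^ 'a" where
    "\<rho> A = mat_of (modular_word s t (A $ 1 $ 1) (A $ 1 $ 2) (A $ 2 $ 1) (A $ 2 $ 2))" for A
  have "(A ** B) $ i $ j = A $ i $ 1 * B $ 1 $ j + A $ i $ 2 * B $ 2 $ j" for A B :: "int ^ 2 ^ 2" and i j
    by (simp add: matrix_matrix_mult_def sum_2)
  then have "\<rho> (A ** B) = \<rho> A ** \<rho> B" if "A \<in> SL2Z" "B \<in> SL2Z" for A B
    using w_hom[of "A $ 1 $ 1" "A $ 2 $ 2" "A $ 1 $ 2" "A $ 2 $ 1" "B $ 1 $ 1" "B $ 2 $ 2" "B $ 1 $ 2" "B $ 2 $ 1"] that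
    by (simp add: \<rho>_def SL2Z_def det_2 mat_of_mult[symmetric])
  then have "modular_rep S T \<rho>"
    unfolding modular_rep_def by (simp add: \<rho>_def mat_def mat_of_1[unfolded mat_def] w_S_1 w_T_1 mat_of_s mat_of_t)
  moreover have "\<rho> A = mat 1" if "A \<in> principal_congruence_subgroup N" for A
  proof -
    have c: "[A $ i $ j = mat 1 $ i $ j] (mod int N)" for i j
      using that by (simp add: principal_congruence_subgroup_def)
    have "modular_word s t (A $ 1 $ 1) (A $ 1 $ 2) (A $ 2 $ 1) (A $ 2 $ 2) = 1"
      by (rule assms)
        (use that c[of 1 1] c[of 1 2] c[of 2 1] in
          \<open>simp_all add: principal_congruence_subgroup_def SL2Z_def det_2 mat_def cong_0_iff\<close>)
    then show ?thesis by (simp add: \<rho>_def mat_of_1)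
  qed
  ultimately show ?thesis unfolding has_congruence_property_def by blast
qed

end

theorem theorem2:
  fixes z :: "'a::finite"
    and S T :: "complex ^ 'a ^ 'a"
    and N M :: nat
    and \<sigma> :: "int \<Rightarrow> complex \<Rightarrow> complex"
    and eps :: "int \<Rightarrow> 'a \<Rightarrow> complex"
    and \<pi> :: "int \<Rightarrow> 'a \<Rightarrow> 'a"
    and G :: "int \<Rightarrow> complex ^ 'a ^ 'a"
  assumes "modular_data z S T"
    and "N > 0" and "mat_pow T N = mat 1"
    and "M > 0" and "N dvd M" and "\<And>a b. S $ a $ b \<in> cyclotomic_field M"
    and "\<And>l. coprime l (int N) \<Longrightarrow> galois_aut M (\<sigma> l) \<and> \<sigma> l (xi N) = xi N powi l"
    and "\<And>l. coprime l (int N) \<Longrightarrow> galois_sign_perm S (\<sigma> l) (eps l) (\<pi> l)"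
    and "\<And>l. coprime l (int N) \<Longrightarrow> G l = signed_perm_matrix (eps l) (\<pi> l)"
    and "(\<exists>p::nat. (p = 2 \<or> p = 3) \<and> coprime N p \<and>
            G (int p) ** T = mat_pow T (p ^ 2) ** G (int p))
       \<or> (\<exists>(e::nat) (m::nat) (d::int). N = 2 ^ e * m \<and> odd m \<and>
            [d = 1] (mod 2 ^ e) \<and> [d = 0] (mod int m) \<and>
            mat_pow T (2 ^ e) ** (S ** mat_pow T m ** matrix_inv S) =
              (S ** mat_pow T m ** matrix_inv S) ** mat_pow T (2 ^ e) \<and>
            G (2 * d - 1) ** T = T ** G (2 * d - 1) \<and>
            G (2 - d) ** T = mat_powi T (4 - 3 * d) ** G (2 - d) \<and>
            G (1 + 2 * d) ** T = mat_powi T (1 + 8 * d) ** G (1 + 2 * d))"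
  shows "has_congruence_property S T N"
proof -
  interpret rcft z S T N M
    using assms(1-6) by unfold_locales
  note galois = assms(7)[THEN conjunct1] assms(7)[THEN conjunct2] assms(8,9)
  have mat_G: "mat_of (gl_of (G l)) = G l" if "coprime l (int N)" for l
    by (rule mat_of_G[OF galois[OF that]])
  have G_in: "gl_of (G l) \<in> cyclotomic_gl M" if "coprime l (int N)" for l
    by (rule G_cyclotomic[OF galois[OF that]])
  have fixed: "galois_gl (\<sigma> l') (gl_of (G l)) = gl_of (G l)" if "coprime l (int N)" "coprime l' (int N)" for l l'
    by (rule galois_G[OF galois[OF that(1)] galois(1)[OF that(2)]])
  have action: "galois_action s t (cyclotomic_gl M) (galois_gl (\<sigma> l)) (gl_of (G l)) l (int N)"
    if "coprime l (int N)" "G l ** T = mat_powi T k ** G l" "[k = l ^ 2] (mod int N)" for l k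
  proof (rule galois_action[OF galois[OF that(1)]])
    have "gl_of (G l) * t = t powi k * gl_of (G l)"
      using that(2) by (simp add: mat_of_inject[symmetric] mat_of_mult mat_of_powi mat_of_t mat_G[OF that(1)])
    then show "gl_of (G l) * t = t powi (l ^ 2) * gl_of (G l)"
      by (simp only: T_powi_cong[OF t_N that(3)])
  qed
  have N0: "int N > 0" using N by simp
  consider (a) p :: nat where "p = 2 \<or> p = 3" "coprime N p" "G (int p) ** T = mat_pow T (p ^ 2) ** G (int p)"
    | (b) e m :: nat and d :: int where "N = 2 ^ e * m" "odd m" "[d = 1] (mod 2 ^ e)" "[d = 0] (mod int m)"
      "mat_pow T (2 ^ e) ** (S ** mat_pow T m ** matrix_inv S) =
        (S ** mat_pow T m ** matrix_inv S) ** mat_pow T (2 ^ e)"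
      "G (2 * d - 1) ** T = T ** G (2 * d - 1)" "G (2 - d) ** T = mat_powi T (4 - 3 * d) ** G (2 - d)"
      "G (1 + 2 * d) ** T = mat_powi T (1 + 8 * d) ** G (1 + 2 * d)"
    using assms(10) by blast
  then show ?thesis
  proof cases
    case p: a
    then have cop: "coprime (int p) (int N)" by (simp add: coprime_commute)
    have "G (int p) ** T = mat_powi T (int p ^ 2) ** G (int p)"
      using p(3) by (simp add: mat_powi_def nat_power_eq)
    note action[OF cop this cong_refl]
    moreover have "int p = 2 \<or> int p = 3" using p(1) by auto
    ultimately have "modular_word s t a b c d = 1"
      if "a * d - b * c = 1" "int N dvd b" "int N dvd c" "[a = 1] (mod int N)" for a b c d
      using galois_action_kernel[OF _ _ cop N0 that] by blast
    then show ?thesis by (rule has_congruence_propertyI)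
  next
    case b
    note Nm = b(1,2) and d = b(3,4) and com = b(5) and G = b(6-8)
    have N': "int N = 2 ^ e * int m" by (simp add: Nm(1))
    have dd: "[d * d = d] (mod int N)"
    proof -
      have "2 ^ e dvd d - 1" "int m dvd d" using d by (simp_all add: cong_iff_dvd_diff)
      then have "2 ^ e * int m dvd (d - 1) * d" by (rule mult_dvd_mono)
      then show ?thesis by (simp add: N' cong_iff_dvd_diff algebra_simps)
    qed
    have coprimeI: "coprime (i + j * d) (int N)" if "coprime (i + j) (2 ^ e)" "coprime i (int m)" for i j
    proof -
      have "[i + j * d = i + j * 1] (mod 2 ^ e)" "[i + j * d = i + j * 0] (mod int m)"
        by (intro cong_add cong_mult cong_refl d)+
      then have "coprime (i + j * d) (2 ^ e)" "coprime (i + j * d) (int m)"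
        using that by (metis cong_imp_coprime cong_sym mult_1_right, metis add_0_right cong_imp_coprime cong_sym mult_zero_right)
      then show ?thesis by (simp add: N')
    qed
    have m2: "coprime 2 (int m)" using Nm(2) by simp
    have cop: "coprime (2 * d - 1) (int N)" "coprime (2 - d) (int N)" "coprime (1 + 2 * d) (int N)"
      using coprimeI[of "- 1" 2] coprimeI[of 2 "- 1"] coprimeI[of 1 2] m2 by simp_all
    \<comment> \<open>Since \<open>d\<close> is idempotent modulo \<open>N\<close>, the exponents 1,
      \<open>4 - 3 * d\<close> and \<open>1 + 8 * d\<close> are the squares of the three Galois
      indices.\<close>
    note comb = cong_combination[OF dd dd, where B = 0]
    have "G (2 * d - 1) ** T = mat_powi T 1 ** G (2 * d - 1)" using G(1) by (simp add: mat_powi_def)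
    moreover have "[1 = (2 * d - 1) ^ 2] (mod int N)"
      by (rule comb[of _ _ "- 4"]) (simp add: algebra_simps power2_eq_square)
    ultimately have g1: "galois_action s t (cyclotomic_gl M) (galois_gl (\<sigma> (2 * d - 1)))
        (gl_of (G (2 * d - 1))) (2 * d - 1) (int N)"
      by (rule action[OF cop(1)])
    have "[4 - 3 * d = (2 - d) ^ 2] (mod int N)"
      by (rule comb[of _ _ "- 1"]) (simp add: algebra_simps power2_eq_square)
    note g2 = action[OF cop(2) G(2) this]
    have "[1 + 8 * d = (1 + 2 * d) ^ 2] (mod int N)"
      by (rule comb[of _ _ "- 4"]) (simp add: algebra_simps power2_eq_square)
    note g3 = action[OF cop(3) G(3) this]
    have "t ^ 2 ^ e * (s * t ^ m * inverse s) = s * t ^ m * inverse s * t ^ 2 ^ e"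
      using com by (simp add: mat_of_inject[symmetric] mat_of_mult mat_of_power mat_of_inv mat_of_s mat_of_t)
    then have com': "t powi 2 ^ e * (s * t powi int m * inverse s) = s * t powi int m * inverse s * t powi 2 ^ e"
      using powi_of_nat[of t "2 ^ e"] by (simp add: powi_of_nat)
    have pos: "2 ^ e > (0::int)" "int m > 0" using Nm N by auto
    have cop3: "coprime 3 (2 ^ e :: int)" by simp
    show ?thesis
      by (rule has_congruence_propertyI,
          rule galois_action_kernel_split[OF g1 g2 g3 G_in[OF cop(1)] fixed[OF cop(1,2)] fixed[OF cop(1,3)]
            N' pos cop3 m2 d com'])
  qed
qed

end
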